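(* For every integer $r\ge 1$ there exists a set $\{n_k^{(r)}\}$ of positive integers which is an $r$-Bohr set but which is a non-recurrence set for some weakly mixing linear dynamical system.
   Context: $\mathbb{T}=\{\lambda\in\mathbb{C}:|\lambda|=1\}$. A set $\{n_k\}$ of positive integers is an $r$-Bohr set if for every $(\lambda_1,\dots,\lambda_r)\in\mathbb{T}^r$ and every $\varepsilon>0$ there exists $k$ with $\max_{1\le i\le r}|\lambda_i^{n_k}-1|<\varepsilon$. A Borel probability measure $m$ on a complex separable Banach space $X$ is (centered) Gaussian if every $x^*\in X^*$ has a centered complex Gaussian law under $m$; it is non-degenerate if $m(U)>0$ for every non-empty open $U$. A weakly mixing linear dynamical system is a bounded linear operator $T$ on a complex separable infinite-dimensional Banach space $X$ together with a non-degenerate Gaussian measure $m$ on the Borel $\sigma$-algebra $\mathcal{B}$ of $X$ such that $T$ is a measure-preserving, weakly mixing transformation of $(X,\mathcal{B},m)$. A set $\{n_k\}$ is a non-recurrence set for $(X,\mathcal{B},m,T)$ if there is $A\in\mathcal{B}$ with $m(A)>0$ and $m(T^{-n_k}A\cap A)=0$ for every $k$. *)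

theory Defs
  imports "HOL-Probability.Probability"
begin

text \<open>Ambient space: \<open>linf\<close> = bounded complex sequences with the sup norm (complex l-infinity).
  Every complex separable Banach space is complex-linearly isometric to a closed subspace of it,
  so a complex separable Banach space X is represented by a closed complex-linear subspace V.\<close>

type_synonym linf = "(nat, complex) bcontfun"

definition cscale :: "complex \<Rightarrow> linf \<Rightarrow> linf" where
  "cscale c f = Bcontfun (\<lambda>n. c * apply_bcontfun f n)"

definition cspan :: "linf set \<Rightarrow> linf set" where
  "cspan F = {x. \<exists>c. x = (\<Sum>v\<in>F. cscale (c v) v)}"

definition complex_subspace :: "linf set \<Rightarrow> bool" where
  "complex_subspace V \<longleftrightarrow> 0 \<in> V \<and> (\<forall>x\<in>V. \<forall>y\<in>V. x + y \<in> V) \<and> (\<forall>c. \<forall>x\<in>V. cscale c x \<in> V)"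

definition sep_inf_banach :: "linf set \<Rightarrow> bool" where
  "sep_inf_banach V \<longleftrightarrow> complex_subspace V \<and> closed V \<and>
     (\<exists>D. countable D \<and> D \<subseteq> V \<and> V \<subseteq> closure D) \<and>
     (\<forall>F. finite F \<and> F \<subseteq> V \<longrightarrow> \<not> V \<subseteq> cspan F)"

definition bounded_op :: "linf set \<Rightarrow> (linf \<Rightarrow> linf) \<Rightarrow> bool" where
  "bounded_op V T \<longleftrightarrow> T ` V \<subseteq> V \<and>
     (\<forall>x\<in>V. \<forall>y\<in>V. T (x + y) = T x + T y) \<and> (\<forall>c. \<forall>x\<in>V. T (cscale c x) = cscale c (T x)) \<and>
     (\<exists>K. \<forall>x\<in>V. norm (T x) \<le> K * norm x)"

definition cdual :: "linf set \<Rightarrow> (linf \<Rightarrow> complex) \<Rightarrow> bool" where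
  "cdual V \<phi> \<longleftrightarrow>
     (\<forall>x\<in>V. \<forall>y\<in>V. \<phi> (x + y) = \<phi> x + \<phi> y) \<and> (\<forall>c. \<forall>x\<in>V. \<phi> (cscale c x) = c * \<phi> x) \<and>
     (\<exists>K. \<forall>x\<in>V. cmod (\<phi> x) \<le> K * norm x)"

definition complex_gaussian_law :: "complex measure \<Rightarrow> bool" where
  "complex_gaussian_law \<mu> \<longleftrightarrow> \<mu> = return borel 0 \<or>
     (\<exists>s>0. \<mu> = density lborel (\<lambda>z. ennreal (exp (- (cmod z)\<^sup>2 / s) / (pi * s))))"

definition borel_prob_on :: "linf set \<Rightarrow> linf measure \<Rightarrow> bool" where
  "borel_prob_on V m \<longleftrightarrow> prob_space m \<and> space m = V \<and> sets m = sets (restrict_space borel V)"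

definition gaussian_measure :: "linf set \<Rightarrow> linf measure \<Rightarrow> bool" where
  "gaussian_measure V m \<longleftrightarrow> borel_prob_on V m \<and>
     (\<forall>\<phi>. cdual V \<phi> \<longrightarrow> complex_gaussian_law (distr m borel \<phi>))"

definition non_degenerate :: "linf set \<Rightarrow> linf measure \<Rightarrow> bool" where
  "non_degenerate V m \<longleftrightarrow> (\<forall>U. open U \<and> U \<inter> V \<noteq> {} \<longrightarrow> emeasure m (U \<inter> V) > 0)"

definition measure_preserving_map :: "linf measure \<Rightarrow> (linf \<Rightarrow> linf) \<Rightarrow> bool" where
  "measure_preserving_map m T \<longleftrightarrow> T \<in> m \<rightarrow>\<^sub>M m \<and>
     (\<forall>A\<in>sets m. emeasure m (T -` A \<inter> space m) = emeasure m A)"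

definition weakly_mixing :: "linf measure \<Rightarrow> (linf \<Rightarrow> linf) \<Rightarrow> bool" where
  "weakly_mixing m T \<longleftrightarrow> (\<forall>A\<in>sets m. \<forall>B\<in>sets m.
     (\<lambda>N. (\<Sum>n<N. \<bar>measure m ((T ^^ n) -` A \<inter> B) - measure m A * measure m B\<bar>) / real N)
       \<longlonglongrightarrow> 0)"

definition weakly_mixing_lds :: "linf set \<Rightarrow> (linf \<Rightarrow> linf) \<Rightarrow> linf measure \<Rightarrow> bool" where
  "weakly_mixing_lds V T m \<longleftrightarrow> sep_inf_banach V \<and> bounded_op V T \<and>
     gaussian_measure V m \<and> non_degenerate V m \<and> measure_preserving_map m T \<and> weakly_mixing m T"

definition non_recurrence_set :: "linf measure \<Rightarrow> (linf \<Rightarrow> linf) \<Rightarrow> nat set \<Rightarrow> bool" where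
  "non_recurrence_set m T N \<longleftrightarrow> (\<exists>A\<in>sets m. measure m A > 0 \<and>
     (\<forall>n\<in>N. measure m ((T ^^ n) -` A \<inter> A) = 0))"

definition r_Bohr :: "nat \<Rightarrow> nat set \<Rightarrow> bool" where
  "r_Bohr r N \<longleftrightarrow> (\<forall>lam::nat \<Rightarrow> complex. (\<forall>i\<in>{1..r}. cmod (lam i) = 1) \<longrightarrow>
     (\<forall>\<epsilon>>0. \<exists>n\<in>N. \<forall>i\<in>{1..r}. cmod (lam i ^ n - 1) < \<epsilon>))"

end

theory Submission
  imports Defs "HOL-Analysis.Kronecker_Approximation_Theorem"
begin

text \<open>
  Put \<open>q = r + 1\<close>. The Bohr set consists of times that are short relative to a rapidly growing
  scale \<open>2 ^ wt k\<close> and whose 2-adic valuation is one of the \<open>q\<close> prescribed numbers \<open>uu k j - 1\<close>.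
  Dirichlet's theorem gives an approximating time below \<open>2 ^ (q * blk k)\<close>; multiplying it by a
  power of \<open>2\<close> smaller than \<open>2 ^ blk k\<close> moves its valuation to one of these \<open>q\<close> values.

  To each \<open>j < q\<close> belongs a stationary complex Gaussian process whose spectral measure is the law of
  \<open>\<Sum>k. 2 ^ - uu k j + \<beta> k * 2 ^ - wt k\<close> with independent fair bits \<open>\<beta> k\<close>. The covariance at
  a time of valuation \<open>uu k j - 1\<close> on scale \<open>k\<close> is summably close to \<open>-1\<close>, so with positive
  probability all these values are close to minus the initial value while the initial values lie in
  a half plane; this gives the non-recurrent set. The bits make the spectral measures continuous:
  the process is uncorrelated along the times \<open>2 ^ (wt l - 1)\<close>, and Bessel's inequality then shows
  that the covariances tend to zero in Cesaro mean.

  The processes are interleaved into one sequence \<open>G n\<close>, and \<open>G\<close> is realised in \<open>linf\<close> as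
  \<open>x n = 2 ^ - n * G n\<close>, on which the time shift acts as the bounded operator \<open>x n \<mapsto> 2 ^ q * x (n + q)\<close>.
  A Cholesky decomposition of the covariance writes the random vector as a series \<open>\<Sum>k. \<omega> k * e k\<close>
  with independent Gaussian coefficients. Equality of laws and weak mixing are checked on
  characters and extended to all sets by bounded pointwise limits.
\<close>

text \<open>With a single process every scale would have one admissible valuation, and lifting an
  arbitrary valuation to it could cost a factor near \<open>2 ^ (q * blk k)\<close>, far beyond the
  accuracy \<open>2 ^ - (blk k + k)\<close> of the approximation. Cutting the range of valuations
  into \<open>q\<close> blocks lowers the cost below \<open>2 ^ blk k\<close>, so there is one
  process for each block. Two numbers with real part above 1/2 cannot have a sum of modulus below 1,
  whereas a covariance near -1 makes a sum of modulus at least 1 improbable. This must hold at all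
  times of a scale simultaneously; the union bound over up to \<open>2 ^ horizon k\<close> times
  dictates the growth of \<open>wt\<close>. Without the bits each spectral measure would be a point
  mass, the process a rotating multiple of one Gaussian variable, and mixing would fail. The weights
  \<open>2 ^ - n\<close> make almost every sample bounded. The price is that the shift does not
  visibly preserve the separable subspace spanned by the Cholesky columns; that it does is deduced
  from the invariance and full support of the law.\<close>

section \<open>Measures determined by characters\<close>

text \<open>Limits are taken at every point and under one uniform bound, so the class refers to no
  measure, while every property stable under dominated convergence passes from \<open>M\<close> to
  it. It serves both for the uniqueness of laws and for the Cesaro decorrelation of events.\<close>

inductive bounded_closure :: "('a \<Rightarrow> complex) set \<Rightarrow> ('a \<Rightarrow> complex) \<Rightarrow> bool" for M where
  base: "f \<in> M \<Longrightarrow> bounded_closure M f"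
| add: "bounded_closure M f \<Longrightarrow> bounded_closure M g \<Longrightarrow> bounded_closure M (\<lambda>x. f x + g x)"
| scale: "bounded_closure M f \<Longrightarrow> bounded_closure M (\<lambda>x. c * f x)"
| lim: "(\<And>n. bounded_closure M (F n)) \<Longrightarrow> (\<And>n x. norm (F n x) \<le> B) \<Longrightarrow>
    (\<And>x. (\<lambda>n. F n x) \<longlonglongrightarrow> f x) \<Longrightarrow> bounded_closure M f"

lemma bounded_closure_bounded:
  assumes "bounded_closure M f" and M: "\<And>f. f \<in> M \<Longrightarrow> \<exists>B. \<forall>x. norm (f x) \<le> B"
  shows "\<exists>B. \<forall>x. norm (f x) \<le> B"
  using assms(1)
proof induction
  case (base f)
  then show ?case using M by blast
next
  case (add f g)
  then obtain B C where "\<forall>x. norm (f x) \<le> B" "\<forall>x. norm (g x) \<le> C" by blast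
  then have "\<forall>x. norm (f x + g x) \<le> B + C" using norm_triangle_mono by blast
  then show ?case by blast
next
  case (scale f c)
  then obtain B where "\<forall>x. norm (f x) \<le> B" by blast
  then have "\<forall>x. norm (c * f x) \<le> norm c * B" by (simp add: norm_mult mult_left_mono)
  then show ?case by blast
next
  case (lim F B f)
  have "norm (f x) \<le> B" for x
    using lim by (intro LIMSEQ_le_const2[OF tendsto_norm[OF lim(3)]]) auto
  then show ?case by blast
qed

lemma bounded_closure_mult:
  assumes f: "bounded_closure M f" and g: "bounded_closure M g"
    and M: "\<And>f. f \<in> M \<Longrightarrow> \<exists>B. \<forall>x. norm (f x) \<le> B"
    and mult: "\<And>f g. f \<in> M \<Longrightarrow> g \<in> M \<Longrightarrow> (\<lambda>x. f x * g x) \<in> M"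
  shows "bounded_closure M (\<lambda>x. f x * g x)"
proof -
  have lim_case: "bounded_closure M (\<lambda>x. h x * l x)"
    if h: "\<forall>x. norm (h x) \<le> C" and "\<And>n. bounded_closure M (\<lambda>x. h x * F n x)"
      "\<And>n x. norm (F n x) \<le> B" "\<And>x. (\<lambda>n. F n x) \<longlonglongrightarrow> l x" for h F l B C
  proof (rule bounded_closure.lim[where F = "\<lambda>n x. h x * F n x" and B = "C * B"])
    show "norm (h x * F n x) \<le> C * B" for n x
      unfolding norm_mult using h that(3)[of n x] norm_ge_zero[of "h x"]
      by (intro mult_mono) (auto intro: order_trans[OF norm_ge_zero])
  qed (use that in \<open>auto intro!: tendsto_mult_left\<close>)
  \<comment> \<open>With one factor a generator, closure of \<open>M\<close> under products starts
    the induction; the later induction on \<open>g\<close> replaces that generator by an arbitrary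
    member of the class.\<close>
  have 1: "bounded_closure M (\<lambda>x. h x * f x)" if h: "h \<in> M" for h
    using f
  proof induction
    case (base f)
    then show ?case using mult h by (intro bounded_closure.base) auto
  next
    case (add f g)
    then show ?case using bounded_closure.add[OF add.IH] by (simp add: algebra_simps)
  next
    case (scale f c)
    then show ?case using bounded_closure.scale[OF scale.IH, of c] by (simp add: algebra_simps)
  next
    case (lim F B l)
    obtain C where "\<forall>x. norm (h x) \<le> C" using M h by blast
    then show ?case using lim_case[of h C F B l] lim by blast
  qed
  obtain C where C: "\<forall>x. norm (f x) \<le> C" using bounded_closure_bounded[OF f M] by blast
  show ?thesis
    using g
  proof induction
    case (base h)
    then show ?case using 1[of h] by (simp add: mult.commute)
  next
    case (add g h)
    then show ?case using bounded_closure.add[OF add.IH] by (simp add: algebra_simps)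
  next
    case (scale g c)
    then show ?case using bounded_closure.scale[OF scale.IH, of c] by (simp add: algebra_simps)
  next
    case (lim F B l)
    then show ?case using lim_case[of f C F B l] C by blast
  qed
qed

text \<open>A real vector space of functions whose characters \<open>cis (u x)\<close> are therefore
  closed under products. It is instantiated with the real linear functionals on the complex plane
  and with those of finitely many coordinates on \<open>linf\<close>.\<close>

locale additive_functions =
  fixes U :: "('a \<Rightarrow> real) set"
  assumes U_nonempty: "U \<noteq> {}"
    and U_add: "u \<in> U \<Longrightarrow> v \<in> U \<Longrightarrow> (\<lambda>x. u x + v x) \<in> U"
    and U_scale: "u \<in> U \<Longrightarrow> (\<lambda>x. c * u x) \<in> U"
begin

abbreviation trig :: "('a \<Rightarrow> complex) set" where
  "trig \<equiv> (\<lambda>u x. cis (u x)) ` U"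

abbreviation trig_closure :: "('a \<Rightarrow> complex) \<Rightarrow> bool" where
  "trig_closure \<equiv> bounded_closure trig"

lemma trig_closure_mult:
  "trig_closure f \<Longrightarrow> trig_closure g \<Longrightarrow> trig_closure (\<lambda>x. f x * g x)"
proof (rule bounded_closure_mult, assumption+)
  show "(\<lambda>x. f x * g x) \<in> trig" if "f \<in> trig" "g \<in> trig" for f g
    using that U_add by (fastforce simp: cis_mult)
qed (auto intro: exI[of _ 1])

lemma trig_closure_const: "trig_closure (\<lambda>x. c)"
proof -
  obtain u where "u \<in> U" using U_nonempty by blast
  then have "(\<lambda>x. 0) \<in> U" using U_scale[of u 0] by simp
  then have "trig_closure (\<lambda>x. cis 0)" by (intro bounded_closure.base) (force simp: image_iff)
  from bounded_closure.scale[OF this, of c] show ?thesis by simp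
qed

lemma trig_closure_sum:
  "(\<And>i. i \<in> I \<Longrightarrow> trig_closure (f i)) \<Longrightarrow> trig_closure (\<lambda>x. \<Sum>i\<in>I. f i x)"
  by (induction I rule: infinite_finite_induct)
    (auto intro: trig_closure_const bounded_closure.add)

lemma trig_closure_prod:
  "(\<And>i. i \<in> I \<Longrightarrow> trig_closure (f i)) \<Longrightarrow> trig_closure (\<lambda>x. \<Prod>i\<in>I. f i x)"
  by (induction I rule: infinite_finite_induct)
    (auto intro: trig_closure_const trig_closure_mult)

lemma trig_closure_diff:
  assumes "trig_closure f" "trig_closure g" shows "trig_closure (\<lambda>x. f x - g x)"
  using bounded_closure.add[OF assms(1) bounded_closure.scale[OF assms(2), of "-1"]] by simp

lemma trig_closure_power: "trig_closure f \<Longrightarrow> trig_closure (\<lambda>x. f x ^ n)"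
  by (induction n) (auto intro: trig_closure_const trig_closure_mult)

text \<open>Bernstein polynomials of \<open>F\<close> evaluated at \<open>s\<close> lie in the class
  because it is an algebra, and they converge uniformly on the unit interval.\<close>

lemma trig_closure_continuous:
  assumes s: "trig_closure (\<lambda>x. complex_of_real (s x))" and s01: "\<And>x. s x \<in> {0..1}"
    and F: "continuous_on {0..1} F"
  shows "trig_closure (\<lambda>x. complex_of_real (F (s x)))"
proof -
  define P where "P n x = (\<Sum>k\<le>n. F (k/n) * Bernstein n k x)" for n :: nat and x :: real
  have conv: "\<exists>N. \<forall>n x. N \<le> n \<and> x \<in> {0..1} \<longrightarrow> \<bar>F x - P n x\<bar> < e" if "e > 0" for e
    using Bernstein_Weierstrass[OF F that] by (simp add: P_def)
  obtain N where N: "\<And>n x. N \<le> n \<Longrightarrow> x \<in> {0..1} \<Longrightarrow> \<bar>F x - P n x\<bar> < 1"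
    using conv[of 1] by auto
  have "bounded (F ` {0..1})"
    by (intro compact_imp_bounded compact_continuous_image F) auto
  then obtain B where B: "\<And>x. x \<in> {0..1} \<Longrightarrow> \<bar>F x\<bar> \<le> B" unfolding bounded_iff by fastforce
  show ?thesis
  \<comment> \<open>The closure rule wants one bound for all members of the sequence. From
    \<open>N\<close> on the polynomials are within 1 of \<open>F\<close>, hence the shifted index
    and the bound \<open>B + 1\<close>.\<close>
  proof (rule bounded_closure.lim[where F = "\<lambda>n x. of_real (P (n + N) (s x))" and B = "B + 1"])
    fix n
    have "trig_closure (\<lambda>x. \<Sum>k\<le>n+N. of_real (F (k/(n+N)) * ((n+N) choose k)) *
        (of_real (s x) ^ k * (1 - of_real (s x)) ^ (n + N - k)))"
      by (intro trig_closure_sum bounded_closure.scale trig_closure_mult trig_closure_power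
          trig_closure_diff trig_closure_const s)
    then show "trig_closure (\<lambda>x. complex_of_real (P (n + N) (s x)))"
      by (simp add: P_def Bernstein_def mult_ac)
  next
    fix n x
    show "norm (complex_of_real (P (n + N) (s x))) \<le> B + 1"
      using N[of "n + N" "s x"] B[of "s x"] s01[of x] by simp
  next
    fix x
    have "(\<lambda>n. P n (s x)) \<longlonglongrightarrow> F (s x)"
    proof (rule LIMSEQ_I)
      fix e :: real assume "e > 0"
      from conv[OF this] s01[of x] show "\<exists>no. \<forall>n\<ge>no. norm (P n (s x) - F (s x)) < e"
        by (metis real_norm_def abs_minus_commute)
    qed
    then show "(\<lambda>n. complex_of_real (P (n + N) (s x))) \<longlonglongrightarrow> complex_of_real (F (s x))"
      by (intro tendsto_of_real LIMSEQ_ignore_initial_segment)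
  qed
qed

text \<open>Ramps of slope \<open>n\<close> that start at 1/2 converge at every point to the
  indicator.\<close>

lemma trig_closure_indicator_half:
  assumes s: "trig_closure (\<lambda>x. complex_of_real (s x))" and s01: "\<And>x. s x \<in> {0..1}"
  shows "trig_closure (indicator {x. s x > 1/2})"
proof (rule bounded_closure.lim[where B = 1 and
    F = "\<lambda>n x. of_real ((\<lambda>t. min 1 (max 0 (real n * (t - 1/2)))) (s x))"])
  show "trig_closure (\<lambda>x. of_real ((\<lambda>t. min 1 (max 0 (real n * (t - 1/2)))) (s x)))" for n
    by (rule trig_closure_continuous[OF s s01]) (intro continuous_intros)
  fix x
  show "(\<lambda>n. complex_of_real (min 1 (max 0 (real n * (s x - 1 / 2)))))
      \<longlonglongrightarrow> indicator {x. 1 / 2 < s x} x"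
  proof (cases "s x > 1/2")
    case True
    obtain n0 :: nat where n0: "1 / (s x - 1/2) \<le> real n0" using real_arch_simple by blast
    have "\<forall>\<^sub>F n in sequentially. complex_of_real (min 1 (max 0 (real n * (s x - 1 / 2)))) = 1"
    proof (rule eventually_sequentiallyI[of n0])
      fix n assume "n0 \<le> n"
      then have "1 / (s x - 1/2) \<le> real n" using n0 by simp
      then have "1 \<le> real n * (s x - 1/2)" using True by (simp add: field_simps)
      then show "complex_of_real (min 1 (max 0 (real n * (s x - 1 / 2)))) = 1" by simp
    qed
    then show ?thesis using True by (simp add: tendsto_eventually)
  next
    case False
    then have "real n * (s x - 1 / 2) \<le> 0" for n
      by (intro mult_nonneg_nonpos) auto
    then have "max 0 (real n * (s x - 1 / 2)) = 0" for n by (simp add: max_absorb1)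
    then show ?thesis using False by simp
  qed
qed auto

text \<open>Since \<open>u\<close> may be unbounded it is compressed by the sine: once
  \<open>Suc n\<close> exceeds \<open>\<bar>u x - a\<bar>\<close>, the argument has modulus below 1,
  hence below \<open>pi\<close>, and the sine has the sign of \<open>u x - a\<close>.\<close>

lemma trig_closure_indicator_greater:
  assumes u: "u \<in> U"
  shows "trig_closure (indicator {x. u x > a})"
proof (rule bounded_closure.lim[where B = 1 and
    F = "\<lambda>n. indicator {x. (1 + sin ((u x - a) / Suc n)) / 2 > 1/2}"])
  fix n :: nat
  let ?c = "1 / real (Suc n)"
  have "trig_closure (\<lambda>x. cis (c * u x))" for c
    by (intro bounded_closure.base) (use U_scale[OF u] in force)
  note this[of ?c] this[of "- ?c"]
  from bounded_closure.scale[OF this(1), of "cis (- ?c * a) / (2*\<i>)"]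
    bounded_closure.scale[OF this(2), of "- (cis (?c * a) / (2*\<i>))"]
  have "trig_closure (\<lambda>x. cis (- ?c * a) / (2*\<i>) * cis (?c * u x)
      + - (cis (?c * a) / (2*\<i>)) * cis (- ?c * u x))" by (rule bounded_closure.add)
  also have "(\<lambda>x. cis (- ?c * a) / (2*\<i>) * cis (?c * u x)
      + - (cis (?c * a) / (2*\<i>)) * cis (- ?c * u x))
    = (\<lambda>x. (cis (?c * (u x - a)) - cis (- (?c * (u x - a)))) / (2 * \<i>))"
    by (rule ext) (simp add: cis_mult diff_divide_distrib add_divide_distrib algebra_simps)
  also have "\<dots> = (\<lambda>x. complex_of_real (sin ((u x - a) / Suc n)))"
    by (rule ext) (auto simp: complex_eq_iff)
  finally have "trig_closure (\<lambda>x. (1/2) * (1 + complex_of_real (sin ((u x - a) / Suc n))))"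
    by (intro bounded_closure.scale bounded_closure.add trig_closure_const)
  then have *: "trig_closure (\<lambda>x. complex_of_real ((1 + sin ((u x - a) / Suc n)) / 2))"
    by (simp add: add_divide_distrib)
  show "trig_closure (indicator {x. (1 + sin ((u x - a) / Suc n)) / 2 > 1/2})"
  proof (rule trig_closure_indicator_half[OF *])
    have "(1 + sin y) / 2 \<in> {0..1}" for y :: real
    proof -
      have "0 \<le> 1 + sin y" "1 + sin y \<le> 2" using abs_sin_le_one[of y] by arith+
      then show ?thesis by simp
    qed
    then show "(1 + sin ((u x - a) / real (Suc n))) / 2 \<in> {0..1}" for x .
  qed
next
  fix x
  let ?d = "u x - a"
  obtain n0 :: nat where n0: "\<bar>?d\<bar> \<le> real n0" using real_arch_simple by blast
  have "\<forall>\<^sub>F n in sequentially. indicator {x. (1 + sin ((u x - a) / Suc n)) / 2 > 1/2} x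
      = (indicator {x. u x > a} x :: complex)"
  proof (rule eventually_sequentiallyI[of n0])
    fix n assume "n0 \<le> n"
    then have "\<bar>?d\<bar> < real (Suc n)" using n0 by linarith
    then have lt: "\<bar>?d / Suc n\<bar> < 1" by simp
    have "0 < sin (?d / Suc n) \<longleftrightarrow> ?d > 0"
    proof (cases "?d > 0")
      case True
      have "?d / Suc n < pi" using lt pi_gt3 by linarith
      then show ?thesis using True sin_gt_zero[of "?d / Suc n"] by simp
    next
      case False
      then have "0 \<le> - (?d / Suc n)" by (simp add: divide_nonpos_pos)
      moreover have "- (?d / Suc n) \<le> pi" using lt pi_gt3 by linarith
      ultimately have "0 \<le> sin (- (?d / Suc n))" by (rule sin_ge_zero)
      then show ?thesis using False by simp
    qed
    then show "indicator {x. (1 + sin ((u x - a) / Suc n)) / 2 > 1/2} x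
      = (indicator {x. u x > a} x :: complex)"
      by (simp add: indicator_def)
  qed
  then show "(\<lambda>n. indicator {x. (1 + sin ((u x - a) / Suc n)) / 2 > 1/2} x)
      \<longlonglongrightarrow> (indicator {x. u x > a} x :: complex)"
    by (rule tendsto_eventually)
qed (auto simp: indicator_def)

definition gen :: "'a set set" where
  "gen = {{x. u x > a} |u a. u \<in> U}"

lemma genI: "u \<in> U \<Longrightarrow> {x. a < u x} \<in> gen"
  unfolding gen_def by blast

text \<open>The class is an algebra, so an arbitrary countable union, disjoint or not, is reached as
  the limit of one minus finite products of complementary indicators.\<close>

lemma trig_closure_indicator:
  assumes "A \<in> sigma_sets UNIV gen"
  shows "trig_closure (indicator A)"
  using assms
proof induction
  case (Basic A)
  then show ?case using trig_closure_indicator_greater by (auto simp: gen_def)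
next
  case Empty
  then show ?case using trig_closure_const[of 0] by (simp add: indicator_def)
next
  case (Compl A)
  have "indicator (UNIV - A) = (\<lambda>x. 1 - indicator A x :: complex)"
    by (auto simp: indicator_def)
  then show ?case using trig_closure_diff[OF trig_closure_const[of 1] Compl.IH] by simp
next
  case (Union A)
  show ?case
  proof (rule bounded_closure.lim[where F = "\<lambda>n x. 1 - (\<Prod>i<n. 1 - indicator (A i) x)" and B = 1])
    show "trig_closure (\<lambda>x. 1 - (\<Prod>i<n. 1 - indicator (A i) x))" for n
      by (intro trig_closure_diff trig_closure_const trig_closure_prod Union.IH)
    have eq: "1 - (\<Prod>i<n. 1 - indicator (A i) x) = (indicator (\<Union>i<n. A i) x :: complex)" for n x
      by (induction n) (auto simp: indicator_def lessThan_Suc)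
    show "norm (1 - (\<Prod>i<n. 1 - indicator (A i) x) :: complex) \<le> 1" for n x
      unfolding eq by (simp add: indicator_def)
    fix x
    show "(\<lambda>n. 1 - (\<Prod>i<n. 1 - indicator (A i) x)) \<longlonglongrightarrow> (indicator (\<Union>i. A i) x :: complex)"
      unfolding eq by (rule LIMSEQ_indicator_UN)
  qed
qed

text \<open>Dominated convergence carries the equality of integrals from the characters to their
  bounded closure, which contains the indicators of all sets of the generated sigma-algebra.\<close>

theorem char_measure_eqI:
  assumes M: "finite_measure M" "finite_measure N"
    and sets: "sets M = sigma_sets UNIV gen" "sets N = sigma_sets UNIV gen"
    and eq: "\<And>u. u \<in> U \<Longrightarrow> (\<integral>x. cis (u x) \<partial>M) = (\<integral>x. cis (u x) \<partial>N)"
  shows "M = N"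
proof -
  interpret M: finite_measure M by fact
  interpret N: finite_measure N by fact
  have sp: "space M = UNIV" "space N = UNIV"
    using sets by (metis sets.top sigma_sets_top sets.sets_into_space subset_UNIV top.extremum_unique)+
  have sMN: "sets M = sets N" using sets by simp
  have u_meas: "u \<in> borel_measurable M" if "u \<in> U" for u
    unfolding borel_measurable_iff_greater sp sets using that
    by (auto simp: gen_def intro!: sigma_sets.Basic)
  have key: "f \<in> borel_measurable M \<and> (\<exists>B. \<forall>x. norm (f x) \<le> B) \<and>
      integral\<^sup>L M f = integral\<^sup>L N f" if "trig_closure f" for f
    using that
  proof induction
    case (base f)
    then obtain u where u: "u \<in> U" "f = (\<lambda>x. cis (u x))" by blast
    then have "f \<in> borel_measurable M" 
      using measurable_compose[OF u_meas borel_measurable_continuous_onI[of cis]]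
      by (auto simp: continuous_on_cis)
    then show ?case using u eq by (auto intro: exI[of _ 1])
  next
    case (add f g)
    then have *: "integrable M f" "integrable M g" "integrable N f" "integrable N g"
      by (auto intro!: M.integrable_const_bound N.integrable_const_bound simp: measurable_cong_sets[OF sMN refl])
    have "\<exists>B. \<forall>x. norm (f x + g x) \<le> B" using add.IH by (meson norm_triangle_mono)
    then show ?case using add.IH * by auto
  next
    case (scale f c)
    then have *: "integrable M f" "integrable N f" 
      by (auto intro!: M.integrable_const_bound N.integrable_const_bound simp: measurable_cong_sets[OF sMN refl])
    have "\<exists>B. \<forall>x. norm (c * f x) \<le> B" using scale.IH by (metis mult_left_mono norm_ge_zero norm_mult)
    then show ?case using scale.IH * by auto
  next
    case (lim F B f)
    have meas[measurable]: "F n \<in> borel_measurable M" "F n \<in> borel_measurable N" for n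
      using lim by (auto simp: measurable_cong_sets[OF sMN refl])
    have fm[measurable]: "f \<in> borel_measurable M"
      by (rule borel_measurable_LIMSEQ_metric[where f = F]) (use lim in auto)
    then have fn[measurable]: "f \<in> borel_measurable N"
      by (simp add: measurable_cong_sets[OF sMN refl])
    have 1: "(\<lambda>n. integral\<^sup>L M (F n)) \<longlonglongrightarrow> integral\<^sup>L M f"
      by (rule integral_dominated_convergence[where w = "\<lambda>_. B"]) (use lim in auto)
    have 2: "(\<lambda>n. integral\<^sup>L N (F n)) \<longlonglongrightarrow> integral\<^sup>L N f"
      by (rule integral_dominated_convergence[where w = "\<lambda>_. B"]) (use lim in auto)
    have "integral\<^sup>L M f = integral\<^sup>L N f"
      using LIMSEQ_unique[OF 1] 2 lim by simp
    moreover have "norm (f x) \<le> B" for x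
      using lim by (intro LIMSEQ_le_const2[OF tendsto_norm[OF lim(3)]]) auto
    ultimately show ?case by auto
  qed
  show ?thesis
  proof (rule measure_eqI[OF sMN])
    fix A assume A: "A \<in> sets M"
    then have "integral\<^sup>L M (indicator A :: _ \<Rightarrow> complex) = integral\<^sup>L N (indicator A)"
      using key[OF trig_closure_indicator] sets by auto
    then have "(\<integral>x. complex_of_real (indicator A x) \<partial>M) = (\<integral>x. complex_of_real (indicator A x) \<partial>N)"
      by (simp add: of_real_indicator)
    then have "measure M A = measure N A" using sp by simp
    then show "emeasure M A = emeasure N A"
      by (simp add: M.emeasure_eq_measure N.emeasure_eq_measure)
  qed
qed

end

section \<open>Complex Gaussian laws\<close>

text \<open>The circular law with mean square modulus \<open>s\<close>: real and imaginary part are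
  independent centred normals of variance \<open>s/2\<close>.\<close>

definition cgauss :: "real \<Rightarrow> complex measure" where
  "cgauss s = density lborel (\<lambda>z. ennreal (exp (- (cmod z)\<^sup>2 / s) / (pi * s)))"

lemma measurable_Complex[measurable]:
  "(\<lambda>(x, y). Complex x y) \<in> borel_measurable (borel \<Otimes>\<^sub>M borel)"
  unfolding Complex_eq by measurable

lemma lborel_complex:
  "(lborel :: complex measure) = distr (lborel \<Otimes>\<^sub>M lborel) borel (\<lambda>(x, y). Complex x y)"
proof (rule lborel_eqI)
  fix l u :: complex
  assume le: "\<And>b. b \<in> Basis \<Longrightarrow> l \<bullet> b \<le> u \<bullet> b"
  have [measurable]: "(\<lambda>(x, y). Complex x y) \<in> borel_measurable (lborel \<Otimes>\<^sub>M lborel)" by measurable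
  have le': "Re l \<le> Re u" "Im l \<le> Im u"
    using le[of 1] le[of \<i>] by (simp_all add: Basis_complex_def)
  have "(\<lambda>(x, y). Complex x y) -` box l u = {Re l <..< Re u} \<times> {Im l <..< Im u}"
    by (auto simp: box_def Basis_complex_def)
  then have "emeasure (distr (lborel \<Otimes>\<^sub>M lborel) borel (\<lambda>(x, y). Complex x y)) (box l u)
    = emeasure (lborel \<Otimes>\<^sub>M lborel) ({Re l <..< Re u} \<times> {Im l <..< Im u})"
    by (subst emeasure_distr) (auto simp: space_pair_measure)
  also have "\<dots> = ennreal (Re u - Re l) * ennreal (Im u - Im l)"
    using le' by (subst lborel.emeasure_pair_measure_Times) auto
  also have "\<dots> = ennreal (\<Prod>b\<in>Basis. (u - l) \<bullet> b)"
    using le' by (simp add: Basis_complex_def ennreal_mult)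
  finally show "emeasure (distr (lborel \<Otimes>\<^sub>M lborel) borel (\<lambda>(x, y). Complex x y)) (box l u)
    = ennreal (\<Prod>b\<in>Basis. (u - l) \<bullet> b)" .
qed simp

abbreviation normal_dist :: "real \<Rightarrow> real measure" where
  "normal_dist \<sigma> \<equiv> density lborel (\<lambda>x. ennreal (normal_density 0 \<sigma> x))"

lemma cgauss_eq_pair:
  assumes s: "s > 0"
  shows "cgauss s = distr (normal_dist (sqrt (s/2)) \<Otimes>\<^sub>M normal_dist (sqrt (s/2))) borel (\<lambda>(x, y). Complex x y)"
proof -
  let ?\<sigma> = "sqrt (s/2)"
  have \<sigma>: "?\<sigma> > 0" "?\<sigma>\<^sup>2 = s/2" using s by auto
  interpret N: prob_space "normal_dist ?\<sigma>" by (rule prob_space_normal_density) fact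
  have "cgauss s = distr (density (lborel \<Otimes>\<^sub>M lborel)
      (\<lambda>p. ennreal (exp (- (cmod ((\<lambda>(x, y). Complex x y) p))\<^sup>2 / s) / (pi * s)))) borel (\<lambda>(x, y). Complex x y)"
    unfolding cgauss_def by (subst lborel_complex, subst density_distr) (auto simp: case_prod_beta)
  also have "density (lborel \<Otimes>\<^sub>M lborel)
      (\<lambda>p. ennreal (exp (- (cmod ((\<lambda>(x, y). Complex x y) p))\<^sup>2 / s) / (pi * s)))
    = density (lborel \<Otimes>\<^sub>M lborel)
      (\<lambda>(x, y). ennreal (normal_density 0 ?\<sigma> x) * ennreal (normal_density 0 ?\<sigma> y))"
  proof (rule arg_cong[where f = "density _"], rule ext, clarify)
    fix x y :: real
    have "normal_density 0 ?\<sigma> x * normal_density 0 ?\<sigma> y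
      = (1 / sqrt (pi * s))^2 * (exp (- x\<^sup>2 / s) * exp (- y\<^sup>2 / s))"
      using s by (simp add: normal_density_def \<sigma>(2) power2_eq_square mult_ac)
    also have "(1 / sqrt (pi * s))^2 = 1 / (pi * s)"
      using s by (simp add: power_divide)
    also have "exp (- x\<^sup>2 / s) * exp (- y\<^sup>2 / s) = exp (- (x\<^sup>2 + y\<^sup>2) / s)"
      by (simp add: exp_add[symmetric] add_divide_distrib diff_divide_distrib)
    finally show "ennreal (exp (- (cmod (Complex x y))\<^sup>2 / s) / (pi * s))
      = ennreal (normal_density 0 ?\<sigma> x) * ennreal (normal_density 0 ?\<sigma> y)"
      by (simp add: ennreal_mult[symmetric] normal_density_nonneg cmod_power2)
  qed
  also have "\<dots> = normal_dist ?\<sigma> \<Otimes>\<^sub>M normal_dist ?\<sigma>"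
    by (rule pair_measure_density[symmetric])
      (auto intro: lborel.sigma_finite_measure_axioms N.sigma_finite_measure_axioms)
  finally show ?thesis .
qed

lemma char_normal_dist:
  assumes \<sigma>: "\<sigma> > 0"
  shows "(\<integral>x. cis (t * x) \<partial>normal_dist \<sigma>) = complex_of_real (exp (- (\<sigma> * t)\<^sup>2 / 2))"
proof -
  interpret S: prob_space std_normal_distribution by (rule prob_space_normal_density) simp
  have "distributed std_normal_distribution lborel (\<lambda>x. x) (\<lambda>x. ennreal (std_normal_density x))"
    unfolding distributed_def using distr_id2[of lborel std_normal_distribution] by auto
  from S.normal_density_affine[OF this, of \<sigma> 0] \<sigma>
  have "distributed std_normal_distribution lborel (\<lambda>x. \<sigma> * x) (\<lambda>x. ennreal (normal_density 0 \<sigma> x))"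
    by simp
  from distributed_distr_eq_density[OF this]
  have "(\<integral>x. cis (t * x) \<partial>normal_dist \<sigma>)
      = (\<integral>x. cis (t * x) \<partial>distr std_normal_distribution lborel (\<lambda>x. \<sigma> * x))" by simp
  also have "\<dots> = (\<integral>x. cis (t * (\<sigma> * x)) \<partial>std_normal_distribution)"
    by (subst integral_distr) (auto intro!: borel_measurable_continuous_onI continuous_intros)
  also have "\<dots> = char std_normal_distribution (\<sigma> * t)"
    by (simp add: char_def cis_conv_exp mult_ac)
  finally show ?thesis by (simp add: char_std_normal_distribution)
qed

text \<open>\<open>Re (w * z)\<close> combines the two independent parts of \<open>z\<close> with
  coefficients \<open>Re w\<close> and \<open>- Im w\<close>. Its variance is \<open>s/2\<close>
  times the squared modulus of \<open>w\<close>, and the exponent is minus half of that.\<close>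

lemma char_cgauss:
  assumes s: "s > 0"
  shows "(\<integral>z. cis (Re (w * z)) \<partial>cgauss s) = complex_of_real (exp (- s * (cmod w)\<^sup>2 / 4))"
proof -
  let ?\<sigma> = "sqrt (s/2)"
  have \<sigma>: "?\<sigma> > 0" using s by auto
  have \<sigma>2: "(?\<sigma> * t)\<^sup>2 = s / 2 * t\<^sup>2" for t using s by (simp add: power_mult_distrib)
  interpret N: prob_space "normal_dist ?\<sigma>" by (rule prob_space_normal_density) fact
  interpret P: pair_prob_space "normal_dist ?\<sigma>" "normal_dist ?\<sigma>" ..
  have m1: "cis \<in> borel_measurable borel"
    by (intro borel_measurable_continuous_onI continuous_intros)
  have "(\<integral>z. cis (Re (w * z)) \<partial>cgauss s)
    = (\<integral>p. cis (Re (w * (\<lambda>(x, y). Complex x y) p)) \<partial>(normal_dist ?\<sigma> \<Otimes>\<^sub>M normal_dist ?\<sigma>))"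
    unfolding cgauss_eq_pair[OF s]
  proof (subst integral_distr)
    show "(\<lambda>(x, y). Complex x y) \<in> normal_dist ?\<sigma> \<Otimes>\<^sub>M normal_dist ?\<sigma> \<rightarrow>\<^sub>M borel" by measurable
  qed (auto intro!: borel_measurable_continuous_onI continuous_intros)
  also have "\<dots> = (\<integral>(x, y). cis (Re w * x) * cis (- Im w * y) \<partial>(normal_dist ?\<sigma> \<Otimes>\<^sub>M normal_dist ?\<sigma>))"
    by (intro Bochner_Integration.integral_cong) (auto simp: cis_mult)
  also have "\<dots> = (\<integral>x. (\<integral>y. cis (Re w * x) * cis (- Im w * y) \<partial>normal_dist ?\<sigma>) \<partial>normal_dist ?\<sigma>)"
  proof (rule P.integral_fst[symmetric], rule P.integrable_const_bound[of _ 1])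
    show "(\<lambda>(x, y). cis (Re w * x) * cis (- Im w * y))
      \<in> borel_measurable (normal_dist ?\<sigma> \<Otimes>\<^sub>M normal_dist ?\<sigma>)"
      unfolding case_prod_beta using m1
      by (intro borel_measurable_times measurable_compose[OF _ m1]) measurable
  qed (auto simp: norm_mult)
  also have "\<dots> = complex_of_real (exp (- (?\<sigma> * Re w)\<^sup>2 / 2)) * complex_of_real (exp (- (?\<sigma> * (- Im w))\<^sup>2 / 2))"
    unfolding integral_mult_right_zero integral_mult_left_zero
    by (simp only: char_normal_dist[OF \<sigma>])
  also have "\<dots> = complex_of_real (exp (- s * (cmod w)\<^sup>2 / 4))"
    unfolding \<sigma>2 of_real_mult[symmetric] exp_add[symmetric] cmod_power2
    by (simp add: algebra_simps add_divide_distrib diff_divide_distrib)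
  finally show ?thesis .
qed

lemma prob_space_cgauss: "s > 0 \<Longrightarrow> prob_space (cgauss s)"
proof -
  assume s: "s > 0"
  let ?\<sigma> = "sqrt (s/2)"
  have \<sigma>: "?\<sigma> > 0" using s by auto
  interpret N: prob_space "normal_dist ?\<sigma>" by (rule prob_space_normal_density) fact
  interpret P: pair_prob_space "normal_dist ?\<sigma>" "normal_dist ?\<sigma>" ..
  show ?thesis
    unfolding cgauss_eq_pair[OF s] by (rule P.prob_space_distr) measurable
qed

lemma sets_cgauss[simp, measurable_cong]: "sets (cgauss s) = sets borel"
  by (simp add: cgauss_def)

lemma space_cgauss[simp]: "space (cgauss s) = UNIV"
  by (simp add: cgauss_def)

lemma nn_integral_sq_normal:
  assumes "\<sigma> > 0"
  shows "(\<integral>\<^sup>+x. ennreal (x\<^sup>2) \<partial>normal_dist \<sigma>) = ennreal (\<sigma>\<^sup>2)"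
proof -
  have *: "has_bochner_integral lborel (\<lambda>x. normal_density 0 \<sigma> x * x\<^sup>2) (\<sigma>\<^sup>2)"
    using normal_moment_even[OF assms, of 0 1] by (simp add: fact_2)
  have "(\<integral>\<^sup>+x. ennreal (x\<^sup>2) \<partial>normal_dist \<sigma>) = (\<integral>\<^sup>+x. ennreal (normal_density 0 \<sigma> x * x\<^sup>2) \<partial>lborel)"
    by (subst nn_integral_density) (auto simp: ennreal_mult)
  also have "\<dots> = ennreal (\<sigma>\<^sup>2)"
    using * by (subst nn_integral_eq_integral) (auto simp: has_bochner_integral_iff)
  finally show ?thesis .
qed

lemma nn_integral_sq_cgauss:
  assumes s: "s > 0"
  shows "(\<integral>\<^sup>+z. ennreal ((cmod z)\<^sup>2) \<partial>cgauss s) = ennreal s"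
proof -
  let ?\<sigma> = "sqrt (s/2)"
  have \<sigma>: "?\<sigma> > 0" using s by auto
  interpret N: prob_space "normal_dist ?\<sigma>" by (rule prob_space_normal_density) fact
  have N1: "emeasure (normal_dist ?\<sigma>) UNIV = 1" using N.emeasure_space_1 by simp
  have "(\<integral>\<^sup>+z. ennreal ((cmod z)\<^sup>2) \<partial>cgauss s)
    = (\<integral>\<^sup>+p. ennreal ((cmod ((\<lambda>(x, y). Complex x y) p))\<^sup>2) \<partial>(normal_dist ?\<sigma> \<Otimes>\<^sub>M normal_dist ?\<sigma>))"
    unfolding cgauss_eq_pair[OF s]
  proof (subst nn_integral_distr)
    show "(\<lambda>(x, y). Complex x y) \<in> normal_dist ?\<sigma> \<Otimes>\<^sub>M normal_dist ?\<sigma> \<rightarrow>\<^sub>M borel" by measurable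
  qed auto
  also have "\<dots> = (\<integral>\<^sup>+p. (\<lambda>(x, y). ennreal (x\<^sup>2) + ennreal (y\<^sup>2)) p \<partial>(normal_dist ?\<sigma> \<Otimes>\<^sub>M normal_dist ?\<sigma>))"
    by (intro nn_integral_cong) (auto simp: cmod_power2)
  also have "\<dots> = (\<integral>\<^sup>+x. (\<integral>\<^sup>+y. ennreal (x\<^sup>2) + ennreal (y\<^sup>2) \<partial>normal_dist ?\<sigma>) \<partial>normal_dist ?\<sigma>)"
    by (subst N.nn_integral_fst[symmetric]) auto
  also have "\<dots> = ennreal (?\<sigma>\<^sup>2) + ennreal (?\<sigma>\<^sup>2)"
    using \<sigma> N1 by (simp add: nn_integral_add nn_integral_sq_normal del: real_sqrt_pow2)
  also have "\<dots> = ennreal s" using s by (simp add: ennreal_plus[symmetric] del: ennreal_plus)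
  finally show ?thesis .
qed

text \<open>Chebyshev's inequality with second moment \<open>s\<close>.\<close>

lemma cgauss_tail:
  assumes s: "s > 0" and \<delta>: "\<delta> > 0"
  shows "measure (cgauss s) {z. cmod z \<ge> \<delta>} \<le> s / \<delta>\<^sup>2"
proof -
  interpret G: prob_space "cgauss s" by (rule prob_space_cgauss) fact
  have "emeasure (cgauss s) {z. cmod z \<ge> \<delta>} = (\<integral>\<^sup>+z. indicator {z. cmod z \<ge> \<delta>} z \<partial>cgauss s)"
    by (subst nn_integral_indicator) auto
  also have "\<dots> \<le> (\<integral>\<^sup>+z. ennreal (1 / \<delta>\<^sup>2) * ennreal ((cmod z)\<^sup>2) \<partial>cgauss s)"
  proof (rule nn_integral_mono)
    fix z
    have "1 \<le> 1 / \<delta>\<^sup>2 * (cmod z)\<^sup>2" if "\<delta> \<le> cmod z"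
      using \<delta> that by (simp add: field_simps power_mono)
    then show "indicator {z. \<delta> \<le> cmod z} z \<le> ennreal (1 / \<delta>\<^sup>2) * ennreal ((cmod z)\<^sup>2)"
      by (auto simp: indicator_def ennreal_mult[symmetric] simp flip: ennreal_1 intro: ennreal_leI)
  qed
  also have "\<dots> = ennreal (s / \<delta>\<^sup>2)"
    using s by (subst nn_integral_cmult) (auto simp: nn_integral_sq_cgauss ennreal_mult[symmetric])
  finally show ?thesis using s by (simp add: G.emeasure_eq_measure)
qed

text \<open>The density is strictly positive, so a null ball would be Lebesgue null.\<close>

lemma cgauss_ball_pos:
  assumes s: "s > 0" and r: "r > 0"
  shows "measure (cgauss s) (ball a r) > 0"
proof -
  interpret G: prob_space "cgauss s" by (rule prob_space_cgauss) fact
  have "emeasure (cgauss s) (ball a r) \<noteq> 0"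
  proof
    assume "emeasure (cgauss s) (ball a r) = 0"
    then have "ball a r \<in> null_sets (cgauss s)" by auto
    then have "AE z in lborel. z \<in> ball a r \<longrightarrow> ennreal (exp (- (cmod z)\<^sup>2 / s) / (pi * s)) = 0"
      unfolding cgauss_def by (subst (asm) null_sets_density_iff) auto
    then have "AE z in lborel. z \<notin> ball a r"
    proof (rule eventually_mono)
      fix z :: complex
      have "exp (- (cmod z)\<^sup>2 / s) / (pi * s) > 0" using s by simp
      then show "z \<in> ball a r \<longrightarrow> ennreal (exp (- (cmod z)\<^sup>2 / s) / (pi * s)) = 0 \<Longrightarrow> z \<notin> ball a r"
        by (auto simp: ennreal_eq_0_iff simp del: mem_ball)
    qed
    then have "emeasure lborel (ball a r) = 0"
      by (subst (asm) AE_iff_null_sets[symmetric]) auto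
    then show False using content_ball_pos[OF r, of a] by (simp add: measure_def)
  qed
  then show ?thesis using G.emeasure_eq_measure by (simp add: zero_less_measure_iff)
qed

interpretation complex_chars: additive_functions "{\<lambda>z. Re (w * z) | w. True}"
proof
  show "(\<lambda>x. u x + v x) \<in> {\<lambda>z. Re (w * z) | w. True}"
    if "u \<in> {\<lambda>z. Re (w * z) | w. True}" "v \<in> {\<lambda>z. Re (w * z) | w. True}" for u v
  proof -
    from that obtain a b where "u = (\<lambda>z. Re (a * z))" "v = (\<lambda>z. Re (b * z))" by blast
    then have "(\<lambda>x. u x + v x) = (\<lambda>z. Re ((a + b) * z))" by (auto simp: algebra_simps)
    then show ?thesis by blast
  qed
  show "(\<lambda>x. c * u x) \<in> {\<lambda>z. Re (w * z) | w. True}"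
    if "u \<in> {\<lambda>z. Re (w * z) | w. True}" for u c
  proof -
    from that obtain a where "u = (\<lambda>z. Re (a * z))" by blast
    then have "(\<lambda>x. c * u x) = (\<lambda>z. Re ((of_real c * a) * z))" by (auto simp: algebra_simps)
    then show ?thesis by blast
  qed
qed auto

lemma sets_borel_complex_chars: "sets borel = sigma_sets UNIV complex_chars.gen"
proof
  let ?S = "sigma UNIV complex_chars.gen"
  have S: "sets ?S = sigma_sets UNIV complex_chars.gen" "space ?S = UNIV" by auto
  have "(\<lambda>z. Re (w * z)) \<in> borel_measurable ?S" for w
    unfolding borel_measurable_iff_greater S unfolding complex_chars.gen_def by (intro allI sigma_sets.Basic) auto
  from this[of 1] this[of "-\<i>"] have "Re \<in> borel_measurable ?S" "Im \<in> borel_measurable ?S" by simp_all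
  then have "(\<lambda>z. z) \<in> borel_measurable ?S" by (subst borel_measurable_complex_iff) simp
  from measurable_sets[OF this] show "sets borel \<subseteq> sigma_sets UNIV complex_chars.gen" by (auto simp: S)
  show "sigma_sets UNIV complex_chars.gen \<subseteq> sets (borel :: complex measure)"
  proof (rule sets.sigma_sets_subset[of _ borel, simplified])
    have "{z. a < Re (w * z)} \<in> sets borel" for a w
      by (intro borel_open open_Collect_less continuous_intros)
    then show "complex_chars.gen \<subseteq> sets borel" unfolding complex_chars.gen_def by blast
  qed
qed

lemma cgauss_char_unique:
  fixes M :: "complex measure"
  assumes M: "prob_space M" "sets M = sets borel" and s: "s > 0"
    and eq: "\<And>w. (\<integral>z. cis (Re (w * z)) \<partial>M) = complex_of_real (exp (- s * (cmod w)\<^sup>2 / 4))"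
  shows "M = cgauss s"
proof (rule complex_chars.char_measure_eqI)
  show "finite_measure M" "finite_measure (cgauss s)"
    using M prob_space_cgauss[OF s] by (auto simp: prob_space_def)
  show "sets M = sigma_sets UNIV complex_chars.gen" "sets (cgauss s) = sigma_sets UNIV complex_chars.gen"
    using M sets_borel_complex_chars by auto
  show "(\<integral>x. cis (u x) \<partial>M) = (\<integral>x. cis (u x) \<partial>cgauss s)" if "u \<in> {\<lambda>z. Re (w * z) | w. True}" for u
    using that eq char_cgauss[OF s] by auto
qed

section \<open>Positive semidefinite kernels\<close>

text \<open>Hermitian symmetry is a separate clause because the real part of the quadratic form sees
  only the Hermitian part of \<open>R\<close>.\<close>

definition psd :: "(nat \<Rightarrow> nat \<Rightarrow> complex) \<Rightarrow> bool" where
  "psd R \<longleftrightarrow> (\<forall>n m. R m n = cnj (R n m)) \<and>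
    (\<forall>N a. 0 \<le> Re (\<Sum>n<N. \<Sum>m<N. a n * cnj (a m) * R n m))"

lemma psd_hermitian: "psd R \<Longrightarrow> R m n = cnj (R n m)"
  unfolding psd_def by blast

lemma psd_nonneg: "psd R \<Longrightarrow> 0 \<le> Re (\<Sum>n<N. \<Sum>m<N. a n * cnj (a m) * R n m)"
  unfolding psd_def by blast

lemma psd_two_points:
  assumes R: "psd R" and "n \<noteq> k"
  shows "0 \<le> Re (x * cnj x * R n n + x * cnj y * R n k + y * cnj x * R k n + y * cnj y * R k k)"
proof -
  define N where "N = Suc (max n k)"
  define a where "a i = (if i = n then x else 0) + (if i = k then y else 0)" for i
  have nk: "n < N" "k < N" by (auto simp: N_def)
  have sum: "(\<Sum>i<N. a i * f i) = x * f n + y * f k" for f :: "nat \<Rightarrow> complex"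
    using nk by (simp add: a_def ring_distribs sum.distrib if_distrib[of "\<lambda>z. z * _"] cong: if_cong)
  have sum': "(\<Sum>i<N. cnj (a i) * f i) = cnj x * f n + cnj y * f k" for f :: "nat \<Rightarrow> complex"
    using nk by (simp add: a_def ring_distribs sum.distrib if_distrib[of "\<lambda>z. z * _"] if_distrib[of cnj] cong: if_cong)
  have "(\<Sum>i<N. \<Sum>j<N. a i * cnj (a j) * R i j) = (\<Sum>i<N. a i * (\<Sum>j<N. cnj (a j) * R i j))"
    by (simp add: sum_distrib_left mult.assoc)
  also have "\<dots> = x * cnj x * R n n + x * cnj y * R n k + y * cnj x * R k n + y * cnj y * R k k"
    unfolding sum sum' by (simp add: algebra_simps)
  finally show ?thesis using psd_nonneg[OF R, of a N] by simp
qed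

lemma psd_diag:
  assumes "psd R" shows "R k k = of_real (Re (R k k))" "0 \<le> Re (R k k)"
proof -
  show "R k k = of_real (Re (R k k))"
    using arg_cong[OF psd_hermitian[OF assms, of k k], of Im] by (simp add: complex_eq_iff)
  have "k \<noteq> Suc k" by simp
  from psd_two_points[OF assms this, of 1 0] show "0 \<le> Re (R k k)" by simp
qed

text \<open>With weights \<open>1\<close> and \<open>- t * R n k\<close> the two-point form is
  affine in \<open>t\<close> when \<open>R k k = 0\<close>. It can stay nonnegative for all real
  \<open>t\<close> only if its slope vanishes.\<close>

lemma psd_zero:
  assumes R: "psd R" and k: "R k k = 0"
  shows "R n k = 0" "R k n = 0"
proof -
  show *: "R n k = 0"
  proof (cases "n = k")
    case False
    have *: "0 \<le> Re (R n n) - 2 * t * (cmod (R n k))\<^sup>2" for t :: real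
    proof -
      let ?y = "- of_real t * R n k"
      define v where "v = - t * (cmod (R n k))\<^sup>2"
      have v: "of_real (- t * (cmod (R n k))\<^sup>2) = complex_of_real v" by (simp add: v_def)
      have "cnj ?y * R n k = of_real (- t * (cmod (R n k))\<^sup>2)"
        "?y * R k n = of_real (- t * (cmod (R n k))\<^sup>2)"
        unfolding of_real_mult complex_norm_square psd_hermitian[OF R, of k n] by simp_all
      note this[unfolded v]
      moreover have "0 \<le> Re (R n n + cnj ?y * R n k + ?y * R k n)"
        using psd_two_points[OF R False, of 1 ?y] k by simp
      ultimately have "0 \<le> Re (R n n + of_real v + of_real v)" by simp
      then show ?thesis by (simp add: v_def)
    qed
    show ?thesis
    proof (rule ccontr)
      assume "R n k \<noteq> 0"
      then have p: "(cmod (R n k))\<^sup>2 > 0" by simp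
      \<comment> \<open>This choice of \<open>t\<close> makes the affine expression equal to
        -1.\<close>
      have "2 * ((Re (R n n) + 1) / (2 * (cmod (R n k))\<^sup>2)) * (cmod (R n k))\<^sup>2 = Re (R n n) + 1"
        using p by simp
      with *[of "(Re (R n n) + 1) / (2 * (cmod (R n k))\<^sup>2)"] show False by linarith
    qed
  qed (use k in simp)
  then show "R k n = 0" using psd_hermitian[OF R, of k n] by simp
qed

text \<open>Completing the square: the new form at \<open>a\<close> is the form of \<open>R\<close>
  at the vector obtained from \<open>a\<close> by changing coordinate \<open>k\<close> so as to
  minimise it. If \<open>R k k = 0\<close>, division by zero leaves the kernel unchanged.\<close>

lemma psd_schur_complement:
  assumes R: "psd R"
  shows "psd (\<lambda>n m. R n m - R n k * R k m / R k k)"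
proof (cases "R k k = 0")
  case True
  then show ?thesis using R by simp
next
  case False
  define r where "r = Re (R k k)"
  have r: "R k k = of_real r" "r \<noteq> 0" using psd_diag[OF R, of k] False by (auto simp: r_def)
  show ?thesis
    unfolding psd_def
  proof (intro conjI allI)
    fix n m
    show "R m n - R m k * R k n / R k k = cnj (R n m - R n k * R k m / R k k)"
      using psd_hermitian[OF R, of m n] psd_hermitian[OF R, of k m] psd_hermitian[OF R, of n k]
      unfolding r complex_cnj_diff complex_cnj_divide complex_cnj_mult complex_cnj_complex_of_real
      by (metis complex_cnj_cnj mult.commute)
  next
    fix N and a :: "nat \<Rightarrow> complex"
    \<comment> \<open>The range is enlarged to contain the index \<open>k\<close>, and
      \<open>a'\<close> pads \<open>a\<close> with zeros. The vector \<open>b\<close> is the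
      minimiser.\<close>
    define N' where "N' = max N (Suc k)"
    define a' where "a' n = (if n < N then a n else 0)" for n
    define A where "A = (\<Sum>n<N'. a' n * R n k)"
    define b where "b n = a' n - (if n = k then A / R k k else 0)" for n
    have ext: "(\<Sum>n<N. \<Sum>m<N. a n * cnj (a m) * f n m) = (\<Sum>n<N'. a' n * (\<Sum>m<N'. cnj (a' m) * f n m))" for f
    proof -
      have "(\<Sum>m<N. a n * cnj (a m) * f n m) = a n * (\<Sum>m<N'. cnj (a' m) * f n m)" for n
        unfolding mult.assoc sum_distrib_left[symmetric]
        by (rule arg_cong[where f = "(*) (a n)"], rule sum.mono_neutral_cong_left) (auto simp: N'_def a'_def)
      then have "(\<Sum>n<N. \<Sum>m<N. a n * cnj (a m) * f n m) = (\<Sum>n<N. a n * (\<Sum>m<N'. cnj (a' m) * f n m))"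
        by simp
      also have "\<dots> = (\<Sum>n<N'. a' n * (\<Sum>m<N'. cnj (a' m) * f n m))"
        by (rule sum.mono_neutral_cong_left) (auto simp: N'_def a'_def)
      finally show ?thesis .
    qed
    have k: "k < N'" by (simp add: N'_def)
    have sum: "(\<Sum>i<N'. b i * f i) = (\<Sum>i<N'. a' i * f i) - A / R k k * f k" for f
      using k by (simp add: b_def ring_distribs sum_subtractf if_distrib[of "\<lambda>z. z * _"] cong: if_cong)
    have sum': "(\<Sum>i<N'. cnj (b i) * f i) = (\<Sum>i<N'. cnj (a' i) * f i) - cnj (A / R k k) * f k" for f
      using k by (simp add: b_def ring_distribs sum_subtractf if_distrib[of "\<lambda>z. z * _"] if_distrib[of cnj] cong: if_cong)
    have A': "(\<Sum>i<N'. cnj (a' i) * R k i) = cnj A"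
      unfolding A_def cnj_sum complex_cnj_mult
      by (intro sum.cong refl arg_cong2[where f = times] psd_hermitian[OF R])
    have A'': "(\<Sum>i<N'. a' i * (c * R i k)) = c * A" for c
      by (simp add: A_def sum_distrib_left mult_ac)
    have "(\<Sum>n<N'. \<Sum>m<N'. b n * cnj (b m) * R n m) = (\<Sum>n<N'. b n * (\<Sum>m<N'. cnj (b m) * R n m))"
      by (simp add: sum_distrib_left mult.assoc)
    also have "\<dots> = (\<Sum>n<N'. a' n * (\<Sum>m<N'. cnj (a' m) * R n m)) - A * cnj A / R k k"
      unfolding sum sum' A' right_diff_distrib sum_subtractf A'' using r
      by (simp add: field_simps)
    also have "(\<Sum>n<N'. a' n * (\<Sum>m<N'. cnj (a' m) * R n m)) - A * cnj A / R k k =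
       (\<Sum>n<N'. a' n * (\<Sum>m<N'. cnj (a' m) * (R n m - R n k * R k m / R k k)))"
    proof -
      have "(\<Sum>n<N'. a' n * (\<Sum>m<N'. cnj (a' m) * (R n k * R k m / R k k)))
        = (\<Sum>n<N'. a' n * (R n k / R k k * (\<Sum>m<N'. cnj (a' m) * R k m)))"
        by (simp add: sum_distrib_left mult_ac)
      also have "\<dots> = A * cnj A / R k k"
        unfolding A' by (simp add: A_def sum_distrib_right sum_divide_distrib mult_ac)
      finally show ?thesis by (simp add: right_diff_distrib sum_subtractf)
    qed
    finally show "0 \<le> Re (\<Sum>n<N. \<Sum>m<N. a n * cnj (a m) * (R n m - R n k * R k m / R k k))"
      unfolding ext using psd_nonneg[OF R, of b N'] by simp
  qed
qed

text \<open>Gaussian elimination, one index at a time. \<open>S k\<close> is the kernel left after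
  the indices below \<open>k\<close> are eliminated; its rows and columns below \<open>k\<close>
  vanish, so each entry of \<open>R\<close> is exhausted after finitely many steps.\<close>

theorem cholesky:
  assumes R: "psd R"
  shows "\<exists>c. (\<forall>n k. n < k \<longrightarrow> c n k = 0) \<and> (\<forall>n m. R n m = (\<Sum>k\<le>n. c n k * cnj (c m k)))"
proof -
  define S where "S = rec_nat R (\<lambda>k S n m. S n m - S n k * S k m / S k k)"
  have S0: "S 0 = R" and SS: "S (Suc k) n m = S k n m - S k n k * S k k m / S k k k" for k n m
    by (simp_all add: S_def)
  have psd: "psd (S k)" for k
  proof (induction k)
    case (Suc k)
    from psd_schur_complement[OF this, of k] show ?case unfolding SS[abs_def] .
  qed (simp add: S0 R)
  have zero: "(n < k \<longrightarrow> S k n m = 0) \<and> (m < k \<longrightarrow> S k n m = 0)" for k n m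
  proof (induction k arbitrary: n m)
    case (Suc k)
    show ?case
    proof (cases "S k k k = 0")
      case True
      then have "S k n k = 0" "S k k m = 0" for n m
        using psd_zero[OF psd[of k], where k = k] by blast+
      then show ?thesis using Suc[of n m] by (auto simp: SS less_Suc_eq)
    next
      case False
      then show ?thesis using Suc[of n m] Suc[of n k] Suc[of k m] by (auto simp: SS less_Suc_eq)
    qed
  qed simp
  \<comment> \<open>At a vanishing pivot the column vanishes too, by \<open>psd_zero\<close>, in
    agreement with division by zero.\<close>
  define c where "c n k = S k n k / of_real (sqrt (Re (S k k k)))" for n k
  have cc: "c n k * cnj (c m k) = S k n k * S k k m / S k k k" for n m k
  proof -
    have "of_real (sqrt (Re (S k k k))) * of_real (sqrt (Re (S k k k))) = S k k k"
      using psd_diag[OF psd, of k k] by (simp flip: of_real_mult)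
    then show ?thesis unfolding psd_hermitian[OF psd, of k k m] by (simp add: c_def)
  qed
  have tel: "(\<Sum>k<K. c n k * cnj (c m k)) = R n m - S K n m" for K n m
    by (induction K) (simp_all add: S0 SS cc)
  show ?thesis
  proof (intro exI[of _ c] conjI allI impI)
    show "c n k = 0" if "n < k" for n k using zero that by (simp add: c_def)
    show "R n m = (\<Sum>k\<le>n. c n k * cnj (c m k))" for n m
      using tel[of n m "Suc n"] zero by (simp add: lessThan_Suc_atMost)
  qed
qed

text \<open>Eliminating the indices \<open>s l\<close> one after another subtracts the projections
  on an orthonormal family; what remains on the diagonal is nonnegative.\<close>

lemma psd_bessel:
  assumes R: "psd R" and orth: "\<And>l l'. R (s l) (s l') = of_bool (l = l')"
  shows "(\<Sum>l<L::nat. (cmod (R n (s l)))\<^sup>2) \<le> Re (R n n)"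
proof -
  have "psd (\<lambda>n m. R n m - (\<Sum>l<L. R n (s l) * R (s l) m))"
  proof (induction L)
    case (Suc L)
    have "(\<Sum>l<L. R n (s l) * R (s l) (s L)) = 0" "(\<Sum>l<L. R (s L) (s l) * R (s l) m) = 0" for n m
      by (auto intro!: sum.neutral simp: orth)
    with psd_schur_complement[OF Suc, of "s L"] show ?case
      by (simp add: orth diff_diff_eq add.commute)
  qed (simp add: R)
  note psd_diag(2)[OF this, of n]
  moreover have sq: "Re (R n (s l) * R (s l) n) = (cmod (R n (s l)))\<^sup>2" for l
  proof -
    have "R n (s l) * R (s l) n = of_real ((cmod (R n (s l)))\<^sup>2)"
      unfolding complex_norm_square using psd_hermitian[OF R, of "s l" n] by simp
    then show ?thesis by simp
  qed
  ultimately show ?thesis by (simp only: Re_sum minus_complex.sel sq)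
qed

lemma psd_one: "psd (\<lambda>n m. 1)"
  unfolding psd_def
proof (intro conjI allI)
  fix N and a :: "nat \<Rightarrow> complex"
  have "(\<Sum>n<N. \<Sum>m<N. a n * cnj (a m) * 1) = (\<Sum>n<N. a n) * cnj (\<Sum>n<N. a n)"
    by (simp add: sum_product)
  also have "\<dots> = of_real ((cmod (\<Sum>n<N. a n))\<^sup>2)" by (simp only: complex_norm_square)
  finally show "0 \<le> Re (\<Sum>n<N. \<Sum>m<N. a n * cnj (a m) * 1)" by simp
qed simp

text \<open>The factor \<open>x\<close> is absorbed into the coefficients of the form.\<close>

lemma psd_mult_rank_one:
  assumes "psd R" shows "psd (\<lambda>n m. R n m * (x n * cnj (x m)))"
  unfolding psd_def
proof (intro conjI allI)
  show "R m n * (x m * cnj (x n)) = cnj (R n m * (x n * cnj (x m)))" for n m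
    using psd_hermitian[OF assms, of m n] by simp
  show "0 \<le> Re (\<Sum>n<N. \<Sum>m<N. a n * cnj (a m) * (R n m * (x n * cnj (x m))))" for N a
    using psd_nonneg[OF assms, of "\<lambda>n. a n * x n" N] by (simp add: mult_ac)
qed

lemma psd_add:
  assumes "psd R" "psd S" shows "psd (\<lambda>n m. R n m + S n m)"
  unfolding psd_def
proof (intro conjI allI)
  show "R m n + S m n = cnj (R n m + S n m)" for n m
    using psd_hermitian[OF assms(1), of m n] psd_hermitian[OF assms(2), of m n] by simp
  show "0 \<le> Re (\<Sum>n<N. \<Sum>m<N. a n * cnj (a m) * (R n m + S n m))" for N a
    using psd_nonneg[OF assms(1), of a N] psd_nonneg[OF assms(2), of a N]
    by (simp add: ring_distribs sum.distrib)
qed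

lemma psd_zero_kernel: "psd (\<lambda>n m. 0)"
  by (simp add: psd_def)

lemma psd_sum: "(\<And>i. i \<in> I \<Longrightarrow> psd (R i)) \<Longrightarrow> psd (\<lambda>n m. \<Sum>i\<in>I. R i n m)"
  by (induction I rule: infinite_finite_induct) (auto intro: psd_add psd_zero_kernel)

lemma psd_lim:
  assumes "\<And>K. psd (R K)" and lim: "\<And>n m. (\<lambda>K. R K n m) \<longlonglongrightarrow> S n m"
  shows "psd S"
  unfolding psd_def
proof (intro conjI allI)
  fix n m
  have "(\<lambda>K. R K m n) \<longlonglongrightarrow> cnj (S n m)"
    using tendsto_cnj[OF lim[of n m]] psd_hermitian[OF assms(1), of _ m n] by simp
  then show "S m n = cnj (S n m)" using lim LIMSEQ_unique by blast
next
  fix N a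
  have "(\<lambda>K. Re (\<Sum>n<N. \<Sum>m<N. a n * cnj (a m) * R K n m)) \<longlonglongrightarrow>
      Re (\<Sum>n<N. \<Sum>m<N. a n * cnj (a m) * S n m)"
    by (intro tendsto_intros lim)
  then show "0 \<le> Re (\<Sum>n<N. \<Sum>m<N. a n * cnj (a m) * S n m)"
    by (rule LIMSEQ_le_const) (use psd_nonneg[OF assms(1)] in auto)
qed

lemma psd_mod: "psd (\<lambda>n m. of_bool (n mod q = m mod q))" if "q > 0" for q :: nat
proof -
  have "psd (\<lambda>n m. \<Sum>j<q. 1 * (of_bool (n mod q = j) * cnj (of_bool (m mod q = j))))"
    by (intro psd_sum psd_mult_rank_one psd_one)
  also have "(\<lambda>n m. \<Sum>j<q. 1 * (of_bool (n mod q = j) * cnj (of_bool (m mod q = j))))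
    = (\<lambda>n m. of_bool (n mod q = m mod q) :: complex)"
    using that by (intro ext) (auto simp: of_bool_def if_distrib[of "\<lambda>z. z * _"] if_distrib[of cnj] cong: if_cong)
  finally show ?thesis .
qed

section \<open>The Bohr set and the stationary kernel\<close>

lemma norm_cis_minus_one_le: "cmod (cis x - 1) \<le> \<bar>x\<bar>"
proof -
  have "(cmod (cis x - 1))\<^sup>2 = 2 - 2 * cos x"
    unfolding cmod_power2 using sin_cos_squared_add[of x] by (simp add: power2_diff)
  also have "\<dots> = 4 * (sin (x/2))\<^sup>2"
    using cos_double_sin[of "x/2"] by simp
  also have "\<dots> \<le> 4 * (x/2)\<^sup>2"
    using abs_sin_x_le_abs_x[of "x/2"] by (simp add: abs_le_square_iff[symmetric])
  also have "\<dots> = \<bar>x\<bar>\<^sup>2" by (simp add: power2_eq_square)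
  finally show ?thesis by (rule power2_le_imp_le) simp
qed

lemma cis_2pi_int: "x \<in> \<int> \<Longrightarrow> cis (2 * pi * x) = 1"
  by (auto elim!: Ints_cases)

lemma cis_2pi_half: "x - 1/2 \<in> \<int> \<Longrightarrow> cis (2 * pi * x) = -1"
proof -
  assume "x - 1/2 \<in> \<int>"
  moreover have "cis (2 * pi * x) = cis (2 * pi * (x - 1/2)) * cis pi"
    unfolding cis_mult by (rule arg_cong[where f = cis]) (simp add: algebra_simps)
  ultimately show ?thesis by (simp only: cis_2pi_int cis_pi) simp
qed

section \<open>Scales, admissible times and the product formula for the covariances\<close>

context
  fixes r :: nat
begin

text \<open>Just large enough that \<open>(blk k + k) * r < blk k * (r + 1)\<close>: the
  denominators that achieve accuracy \<open>2 ^ - (blk k + k)\<close> for \<open>r\<close> angles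
  have their valuations inside \<open>r + 1\<close> blocks of this length.\<close>

definition blk :: "nat \<Rightarrow> nat" where "blk k = k * r + 1"

text \<open>For \<open>n < 2 ^ horizon k\<close> the levels after \<open>k\<close> contribute at
  most \<open>20 * n / 2 ^ wt (Suc k)\<close>. One copy of \<open>horizon k\<close> absorbs
  \<open>n\<close>, the other pays for the union bound over the times of the scale, and
  \<open>k + 1\<close> leaves a summable remainder. The value \<open>wt 0 = 1\<close> keeps
  \<open>2 ^ (wt l - 1)\<close> half of \<open>2 ^ wt l\<close>.\<close>

fun wt :: "nat \<Rightarrow> nat" where
  "wt 0 = 1"
| "wt (Suc k) = 2 * (wt k + blk k * (r + 2)) + k + 1"

text \<open>Room for \<open>wt k\<close>, for the \<open>r + 1\<close> blocks of a Dirichlet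
  denominator, and for one more block taken by the corrective power of \<open>2\<close>.\<close>

definition horizon :: "nat \<Rightarrow> nat" where "horizon k = wt k + blk k * (r + 2)"

definition uu :: "nat \<Rightarrow> nat \<Rightarrow> nat" where "uu k j = wt k + Suc j * blk k"

definition times_set :: "nat \<Rightarrow> nat \<Rightarrow> nat set" where
  "times_set k j = {n. n < 2 ^ horizon k \<and> (\<exists>d. odd d \<and> n = 2 ^ (uu k j - 1) * d)}"

lemma blk_pos: "blk k > 0" by (simp add: blk_def)

lemma wt_Suc: "wt (Suc k) = 2 * horizon k + k + 1" by (simp add: horizon_def)

declare wt.simps(2)[simp del]

lemma wt_less_horizon: "wt k < horizon k" using blk_pos[of k] by (simp add: horizon_def)

lemma wt_strict: "l < k \<Longrightarrow> horizon l < wt k"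
proof (induction k)
  case (Suc k)
  then show ?case using wt_less_horizon[of k] by (cases "l = k") (auto simp: wt_Suc)
qed simp

lemma wt_pos: "wt k > 0" by (cases k) (auto simp: wt_Suc)

lemma uu_bounds: "j \<le> r \<Longrightarrow> wt k < uu k j \<and> uu k j < horizon k"
proof
  assume "j \<le> r"
  then have "Suc j * blk k < (r + 2) * blk k" using blk_pos by (intro mult_strict_right_mono) auto
  then show "uu k j < horizon k" by (simp add: uu_def horizon_def mult.commute)
  show "wt k < uu k j" using blk_pos by (simp add: uu_def)
qed

lemma times_set_pos: "n \<in> times_set k j \<Longrightarrow> n > 0"
  by (auto simp: times_set_def intro: Nat.gr0I)

lemma finite_times_set: "finite (times_set k j)" "card (times_set k j) \<le> 2 ^ horizon k"
proof -
  have sub: "times_set k j \<subseteq> {..<2 ^ horizon k}" by (auto simp: times_set_def)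
  then show "finite (times_set k j)" by (rule finite_subset) simp
  from card_mono[OF _ sub] show "card (times_set k j) \<le> 2 ^ horizon k" by simp
qed

text \<open>The scales below \<open>k0\<close> can be discarded because a finer accuracy may always
  be requested; this freedom later makes the exceptional events small.\<close>

lemma r_Bohr_times_set: "r_Bohr r (\<Union>k\<in>{k0..}. \<Union>j\<le>r. times_set k j)"
  unfolding r_Bohr_def
proof (intro allI impI)
  fix lam :: "nat \<Rightarrow> complex" and \<epsilon> :: real
  assume lam: "\<forall>i\<in>{1..r}. cmod (lam i) = 1" and \<epsilon>: "\<epsilon> > 0"
  define \<theta> where "\<theta> i = Arg (lam i) / (2 * pi)" for i
  have lam_eq: "lam i = cis (2 * pi * \<theta> i)" if "i \<in> {1..r}" for i
    
  proof -
    have n: "cmod (lam i) = 1" using lam that by blast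
    then have "lam i \<noteq> 0" by auto
    from cis_Arg[OF this] n show ?thesis by (simp add: \<theta>_def sgn_div_norm)
  qed
  obtain k1 :: nat where k1: "(1/2)^k1 < \<epsilon> / (2 * pi)"
    using real_arch_pow_inv[of "\<epsilon> / (2 * pi)" "1/2"] \<epsilon> by auto
  define k where "k = max k0 k1"
  have k: "k \<ge> k0" "2 * pi * (1/2)^k < \<epsilon>"
  proof -
    have "(1/2::real)^k \<le> (1/2)^k1" by (rule power_decreasing) (auto simp: k_def)
    then have "(1/2)^k < \<epsilon> / (2 * pi)" using k1 by linarith
    then show "2 * pi * (1/2)^k < \<epsilon>" by (simp add: field_simps)
  qed (simp add: k_def)
  let ?m = "blk k"
  \<comment> \<open>The angles are multiplied by \<open>2 ^ wt k\<close> in advance, so that the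
    final time may carry this factor. The part \<open>k\<close> of the accuracy survives the later
    multiplication by \<open>2 ^ s\<close>.\<close>
  obtain d p where d: "0 < d" "d \<le> int ((2 ^ (?m + k)) ^ r)"
    and dp: "\<And>i. i < r \<Longrightarrow> \<bar>of_int d * (2 ^ wt k * \<theta> (Suc i)) - of_int (p i)\<bar> < 1 / (2 ^ (?m + k) :: nat)"
    by (rule Dirichlet_approx_simult[where N = "2 ^ (?m + k)" and \<theta> = "\<lambda>i. 2 ^ wt k * \<theta> (Suc i)" and n = r]) auto
  define D where "D = nat d"
  have D: "D > 0" "of_int d = real D" using d by (auto simp: D_def)
  have "D \<le> (2 ^ (?m + k)) ^ r" using d by (simp add: D_def nat_le_iff)
  also have "\<dots> = 2 ^ ((?m + k) * r)" by (simp add: power_mult)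
  also have "\<dots> < 2 ^ (?m * (r + 1))" by (rule power_strict_increasing) (auto simp: blk_def algebra_simps)
  finally have D_less: "D < 2 ^ (?m * (r + 1))" .
  obtain a D' where a: "D = 2 ^ a * D'" "odd D'"
    using multiplicity_decompose'[of D 2] D by (metis gr_implies_not0 nat_dvd_1_iff_1 numeral_eq_one_iff semiring_norm(85))
  have "(2::nat) ^ a \<le> D" using a by (simp add: odd_pos Suc_leI)
  then have "(2::nat) ^ a < 2 ^ (?m * (r + 1))" using D_less by linarith
  then have a_less: "a < ?m * (r + 1)" by simp
  \<comment> \<open>\<open>s\<close> lifts the valuation \<open>a\<close> of \<open>D\<close> to the
    last position of its block: \<open>a + s = Suc j * blk k - 1\<close>, which becomes
    \<open>uu k j - 1\<close> after adding \<open>wt k\<close>.\<close>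
  define j where "j = a div ?m"
  define s where "s = ?m - 1 - a mod ?m"
  have j: "j \<le> r" using a_less by (simp add: j_def less_mult_imp_div_less mult.commute flip: less_Suc_eq_le)
  have "a mod ?m < ?m" using blk_pos by simp
  moreover have "j * ?m + a mod ?m = a" by (simp only: j_def div_mult_mod_eq)
  ultimately have as: "a + s = Suc j * ?m - 1" and s_less: "s < ?m" by (auto simp: s_def)
  define n where "n = 2 ^ (wt k + s) * D"
  have n1: "n = 2 ^ (uu k j - 1) * D'"
  proof -
    have "uu k j - 1 = (wt k + s) + a" using as blk_pos[of k] by (simp add: uu_def)
    then show ?thesis by (simp add: n_def a power_add)
  qed
  have "n < 2 ^ horizon k"
  proof -
    have "n < 2 ^ (wt k + s) * 2 ^ (?m * (r + 1))" unfolding n_def using D_less by simp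
    also have "\<dots> = 2 ^ (wt k + s + ?m * (r + 1))" by (simp add: power_add)
    also have "\<dots> \<le> 2 ^ horizon k" using s_less by (intro power_increasing) (auto simp: horizon_def)
    finally show ?thesis .
  qed
  with n1 a have n2: "n \<in> times_set k j" by (auto simp: times_set_def)
  have "cmod (lam i ^ n - 1) < \<epsilon>" if i: "i \<in> {1..r}" for i
  proof -
    obtain i' where i': "i = Suc i'" "i' < r" using i by (cases i) auto
    define x where "x = real n * \<theta> i - 2 ^ s * of_int (p i')"
    have "x = 2 ^ s * (real D * (2 ^ wt k * \<theta> i) - of_int (p i'))"
      by (simp add: x_def n_def power_add algebra_simps)
    then have "\<bar>x\<bar> = 2 ^ s * \<bar>real D * (2 ^ wt k * \<theta> i) - of_int (p i')\<bar>" by (simp add: abs_mult)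
    also have "\<dots> \<le> 2 ^ s * (1 / 2 ^ (?m + k))"
      using dp[OF i'(2)] i' D by (intro mult_left_mono) auto
    also have "\<dots> \<le> 2 ^ ?m * (1 / 2 ^ (?m + k))"
      using s_less by (intro mult_right_mono power_increasing) auto
    also have "\<dots> = (1/2)^k" by (simp add: power_add power_one_over)
    finally have x: "\<bar>x\<bar> \<le> (1/2)^k" .
    have "lam i ^ n = cis (2 * pi * (real n * \<theta> i))"
      unfolding lam_eq[OF i] Complex.DeMoivre by (simp add: mult_ac)
    also have "\<dots> = cis (2 * pi * x) * cis (2 * pi * (2 ^ s * of_int (p i')))"
      by (simp add: cis_mult x_def algebra_simps)
    also have "cis (2 * pi * (2 ^ s * of_int (p i'))) = 1"
      by (rule cis_2pi_int) (auto intro!: Ints_mult Ints_power)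
    finally have "cmod (lam i ^ n - 1) \<le> \<bar>2 * pi * x\<bar>"
      using norm_cis_minus_one_le[of "2 * pi * x"] by simp
    also have "\<dots> = 2 * pi * \<bar>x\<bar>" by (simp add: abs_mult)
    also have "\<dots> \<le> 2 * pi * (1/2)^k" using x by simp
    finally show ?thesis using k by linarith
  qed
  then show "\<exists>n\<in>\<Union>k\<in>{k0..}. \<Union>j\<le>r. times_set k j. \<forall>i\<in>{1..r}. cmod (lam i ^ n - 1) < \<epsilon>"
    using n2 k j by blast
qed

text \<open>The characteristic function of the summand of level \<open>k\<close>: the phase of its
  deterministic point times the average over the fair bit.\<close>

definition factor :: "nat \<Rightarrow> nat \<Rightarrow> real \<Rightarrow> complex" where
  "factor k j s = cis (2 * pi * (s / 2 ^ uu k j)) * ((1 + cis (2 * pi * (s / 2 ^ wt k))) / 2)"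

definition partial_rho :: "nat \<Rightarrow> nat \<Rightarrow> real \<Rightarrow> complex" where
  "partial_rho K j s = (\<Prod>k<K. factor k j s)"

definition rho :: "nat \<Rightarrow> real \<Rightarrow> complex" where
  "rho j s = lim (\<lambda>K. partial_rho K j s)"

lemma norm_factor: "cmod (factor k j s) \<le> 1"
proof -
  have "cmod (1 + cis (2 * pi * (s / 2 ^ wt k))) \<le> 2"
    using norm_triangle_ineq[of 1 "cis (2 * pi * (s / 2 ^ wt k))"] by simp
  then show ?thesis by (simp add: factor_def norm_mult norm_divide)
qed

lemma norm_factor_minus_one: "cmod (factor k j s - 1) \<le> 10 * \<bar>s\<bar> / 2 ^ wt k"
proof -
  define A B where "A = cis (2 * pi * (s / 2 ^ uu k j))" and "B = cis (2 * pi * (s / 2 ^ wt k))"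
  have "factor k j s - 1 = A * ((B - 1) / 2) + (A - 1)"
    by (simp add: factor_def A_def B_def field_simps)
  then have "cmod (factor k j s - 1) \<le> cmod (A * ((B - 1) / 2)) + cmod (A - 1)"
    by (metis norm_triangle_ineq)
  also have "cmod (A * ((B - 1) / 2)) = cmod (B - 1) / 2"
    by (simp add: norm_mult norm_divide A_def)
  also have "cmod (B - 1) \<le> 2 * pi * (\<bar>s\<bar> / 2 ^ wt k)"
    using norm_cis_minus_one_le[of "2 * pi * (s / 2 ^ wt k)"] by (simp add: B_def abs_mult)
  also have "cmod (A - 1) \<le> 2 * pi * (\<bar>s\<bar> / 2 ^ uu k j)"
    using norm_cis_minus_one_le[of "2 * pi * (s / 2 ^ uu k j)"] by (simp add: A_def abs_mult)
  also have "2 * pi * (\<bar>s\<bar> / 2 ^ uu k j) \<le> 2 * pi * (\<bar>s\<bar> / 2 ^ wt k)"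
    by (intro mult_left_mono divide_left_mono power_increasing) (auto simp: uu_def)
  also have "2 * pi * (\<bar>s\<bar> / 2 ^ wt k) / 2 + 2 * pi * (\<bar>s\<bar> / 2 ^ wt k) = (3 * pi) * (\<bar>s\<bar> / 2 ^ wt k)"
    by (simp add: algebra_simps)
  \<comment> \<open>The constant \<open>10\<close> is a round bound for
    \<open>3 * pi\<close>.\<close>
  also have "\<dots> \<le> 10 * (\<bar>s\<bar> / 2 ^ wt k)"
    using pi_less_4 pi_approx by (intro mult_right_mono) auto
  finally show ?thesis by (simp add: divide_right_mono)
qed

lemma norm_partial_rho: "cmod (partial_rho K j s) \<le> 1"
  unfolding partial_rho_def prod_norm[symmetric] by (intro prod_le_1) (auto simp: norm_factor)

lemma wt_ge: "wt (K + i) \<ge> wt K + i"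
proof (induction i)
  case (Suc i)
  then show ?case using wt_less_horizon[of "K + i"] by (simp add: wt_Suc)
qed simp

text \<open>Telescoping over the levels: \<open>wt (K + i) \<ge> wt K + i\<close> turns their errors
  into a geometric series of sum at most 2. The bound is uniform in \<open>L\<close> and so survives
  the limit.\<close>

lemma norm_partial_rho_tail:
  "cmod (partial_rho (K + L) j s - partial_rho K j s) \<le> 20 * \<bar>s\<bar> / 2 ^ wt K"
proof -
  have "cmod (partial_rho (K + L) j s - partial_rho K j s) \<le> (\<Sum>i<L. 10 * \<bar>s\<bar> / 2 ^ wt K * (1/2)^i)"
  proof (induction L)
    case (Suc L)
    have "partial_rho (K + Suc L) j s - partial_rho K j s =
      (partial_rho (K + L) j s - partial_rho K j s) + partial_rho (K + L) j s * (factor (K + L) j s - 1)"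
      by (simp add: partial_rho_def algebra_simps)
    then have "cmod (partial_rho (K + Suc L) j s - partial_rho K j s) \<le>
      cmod (partial_rho (K + L) j s - partial_rho K j s) +
      cmod (partial_rho (K + L) j s) * cmod (factor (K + L) j s - 1)"
      using norm_triangle_ineq norm_mult by metis
    also have "cmod (partial_rho (K + L) j s) * cmod (factor (K + L) j s - 1) \<le> 1 * (10 * \<bar>s\<bar> / 2 ^ wt (K + L))"
      by (intro mult_mono norm_partial_rho norm_factor_minus_one) auto
    also have "\<dots> \<le> 10 * \<bar>s\<bar> / 2 ^ (wt K + L)"
      unfolding mult_1 by (intro divide_left_mono power_increasing wt_ge) auto
    also have "\<dots> = 10 * \<bar>s\<bar> / 2 ^ wt K * (1/2)^L" by (simp add: power_add power_one_over)
    finally show ?case using Suc by simp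
  qed simp
  also have "\<dots> = 10 * \<bar>s\<bar> / 2 ^ wt K * (\<Sum>i<L. (1/2)^i)" by (simp add: sum_distrib_left)
  also have "(\<Sum>i<L. (1/2::real)^i) \<le> 2"
  proof -
    have "(\<Sum>i<L. (1/2::real)^i) \<le> (\<Sum>i. (1/2)^i)"
      by (intro sum_le_suminf) auto
    then show ?thesis by (simp add: suminf_geometric)
  qed
  finally show ?thesis by (simp add: mult_left_mono divide_right_mono)
qed

lemma partial_rho_lim: "(\<lambda>K. partial_rho K j s) \<longlonglongrightarrow> rho j s"
proof -
  have "Cauchy (\<lambda>K. partial_rho K j s)"
    unfolding Cauchy_altdef2
  proof (intro allI impI)
    fix e :: real assume e: "e > 0"
    obtain K where K: "20 * \<bar>s\<bar> / e < real K" using reals_Archimedean2 by blast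
    have "K < wt K" using wt_ge[of 0 K] wt_pos[of 0] by simp
    moreover have "wt K < 2 ^ wt K" by simp
    ultimately have "real K < real (2 ^ wt K)" unfolding of_nat_less_iff by (rule less_trans)
    then have "20 * \<bar>s\<bar> / e < 2 ^ wt K" using K by (simp only: of_nat_power of_nat_numeral)
    then have "20 * \<bar>s\<bar> / 2 ^ wt K < e" using e by (simp add: field_simps)
    then have "dist (partial_rho n j s) (partial_rho K j s) < e" if "n \<ge> K" for n
      using norm_partial_rho_tail[of K "n - K" j s] that by (simp add: dist_norm)
    then show "\<exists>K. \<forall>n\<ge>K. dist (partial_rho n j s) (partial_rho K j s) < e" by blast
  qed
  then show ?thesis by (simp add: rho_def Cauchy_convergent convergent_LIMSEQ_iff[symmetric])
qed

lemma rho_zero: "rho j 0 = 1"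
proof -
  have "partial_rho K j 0 = 1" for K by (simp add: partial_rho_def factor_def)
  then show ?thesis using LIMSEQ_unique[OF partial_rho_lim[of j 0]] by auto
qed

lemma norm_rho: "cmod (rho j s) \<le> 1"
  by (rule LIMSEQ_le_const2[OF tendsto_norm[OF partial_rho_lim]]) (auto simp: norm_partial_rho)

lemma rho_tail: "cmod (rho j s - partial_rho K j s) \<le> 20 * \<bar>s\<bar> / 2 ^ wt K"
proof (rule LIMSEQ_le_const2)
  show "(\<lambda>L. cmod (partial_rho (K + L) j s - partial_rho K j s)) \<longlonglongrightarrow> cmod (rho j s - partial_rho K j s)"
    using LIMSEQ_ignore_initial_segment[OF partial_rho_lim, of K j s]
    by (intro tendsto_intros) (simp add: add.commute)
qed (use norm_partial_rho_tail in auto)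

text \<open>The factors below level \<open>k\<close> are trivial at such times, the factor of level \<open>k\<close> is \<open>-1\<close>,
  and the later ones are close to \<open>1\<close>.\<close>

lemma rho_times_set:
  assumes n: "n \<in> times_set k j" and j: "j \<le> r"
  shows "cmod (rho j (real n) + 1) \<le> 10 * (1/2)^k / 2 ^ horizon k"
proof -
  obtain d where d: "odd d" "n = 2 ^ (uu k j - 1) * d" and n_less: "n < 2 ^ horizon k"
    using n by (auto simp: times_set_def)
  have uu: "wt k < uu k j" using uu_bounds[OF j] by simp
  have int: "real n / 2 ^ w \<in> \<int>" if "w \<le> uu k j - 1" for w
  proof -
    have "real n / 2 ^ w = real (2 ^ (uu k j - 1 - w) * d)"
    proof -
      have "(2::real) ^ (uu k j - 1) = 2 ^ w * 2 ^ (uu k j - 1 - w)"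
        unfolding power_add[symmetric] using that by simp
      then show ?thesis unfolding d by simp
    qed
    then show ?thesis by (metis Ints_of_nat)
  qed
  have low: "factor l j (real n) = 1" if "l < k" for l
  proof -
    have "uu l j < wt k" using uu_bounds[OF j, of l] wt_strict[OF that] by simp
    then show ?thesis
      unfolding factor_def using uu uu_bounds[OF j, of l]
      by (subst (1 2) cis_2pi_int) (auto intro!: int)
  qed
  have "real n / 2 ^ uu k j - 1/2 \<in> \<int>"
  proof -
    obtain e where e: "d = 2 * e + 1" using d by (auto elim: oddE)
    have "2 ^ uu k j = (2::real) * 2 ^ (uu k j - 1)" using uu by (cases "uu k j") auto
    then have "real n / 2 ^ uu k j - 1/2 = real e" by (simp add: d(2) e field_simps)
    then show ?thesis by simp
  qed
  from cis_2pi_half[OF this] have mid: "factor k j (real n) = -1"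
    unfolding factor_def using uu by (subst (2) cis_2pi_int) (auto intro!: int)
  have "partial_rho (Suc k) j (real n) = -1"
    by (simp add: partial_rho_def low mid)
  then have "cmod (rho j (real n) + 1) \<le> 20 * real n / 2 ^ wt (Suc k)"
    using rho_tail[of j "real n" "Suc k"] by simp
  also have "\<dots> \<le> 20 * 2 ^ horizon k / 2 ^ wt (Suc k)"
  proof -
    have "real n \<le> 2 ^ horizon k" using of_nat_mono[of n "2 ^ horizon k", where 'a = real] n_less by simp
    then show ?thesis by (simp add: divide_right_mono)
  qed
  also have "\<dots> = 10 * (1/2)^k / 2 ^ horizon k"
  proof -
    have "(2::real) ^ wt (Suc k) = 2 ^ horizon k * 2 ^ horizon k * 2 ^ k * 2"
      by (simp only: wt_Suc mult_2[of "horizon k"] power_add power_one_right)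
    then show ?thesis by (simp add: power_one_over)
  qed
  finally show ?thesis .
qed

text \<open>At the smaller index \<open>i\<close> the larger power of \<open>2\<close> is a multiple
  of \<open>2 ^ wt i\<close>, while the other one is half a period. The bit average of level
  \<open>i\<close> is thus \<open>(1 - 1) / 2\<close>, and one zero factor kills the
  product.\<close>

lemma rho_orthogonal:
  assumes "l \<noteq> l'"
  shows "rho j (2 ^ (wt l - 1) - 2 ^ (wt l' - 1)) = 0"
proof -
  let ?s = "2 ^ (wt l - 1) - 2 ^ (wt l' - 1) :: real"
  define i where "i = min l l'"
  have half: "2 ^ (wt i - 1) / (2 ^ wt i :: real) = 1/2" for i using wt_pos[of i] by (cases "wt i") auto
  have int: "2 ^ (wt i' - 1) / (2 ^ wt i :: real) \<in> \<int>" if "i < i'" for i i'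
  proof -
    have le: "wt i \<le> wt i' - 1" using wt_strict[OF that] wt_less_horizon[of i] by simp
    have "2 ^ (wt i' - 1) / (2 ^ wt i :: real) = 2 ^ (wt i' - 1 - wt i)"
    proof -
      have "(2::real) ^ (wt i' - 1) = 2 ^ wt i * 2 ^ (wt i' - 1 - wt i)"
        unfolding power_add[symmetric] using le by simp
      then show ?thesis by simp
    qed
    then show ?thesis by simp
  qed
  have "?s / 2 ^ wt i - 1/2 \<in> \<int>"
  proof (cases "l < l'")
    case True
    then show ?thesis using int[OF True] half[of l] by (simp add: i_def diff_divide_distrib)
  next
    case False
    then have l: "l' < l" using assms by simp
    have "?s / 2 ^ wt i - 1/2 = 2 ^ (wt l - 1) / 2 ^ wt l' - 1"
      using half[of l'] l by (simp add: i_def diff_divide_distrib)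
    then show ?thesis using int[OF l] by simp
  qed
  from cis_2pi_half[OF this] have "factor i j ?s = 0" by (simp add: factor_def)
  then have "partial_rho K j ?s = 0" if "K \<ge> Suc i" for K
    using that by (auto simp: partial_rho_def intro!: prod_zero bexI[of _ i])
  then have "(\<lambda>K. partial_rho K j ?s) \<longlonglongrightarrow> 0"
    by (intro tendsto_eventually eventually_sequentiallyI[of "Suc i"])
  then show ?thesis using LIMSEQ_unique partial_rho_lim by blast
qed

text \<open>Index \<open>n\<close> means time \<open>n div (r+1)\<close> of process
  \<open>n mod (r+1)\<close>. Distinct processes are uncorrelated, and one time step is a shift of
  the index by \<open>r + 1\<close>.\<close>

definition kernel :: "nat \<Rightarrow> nat \<Rightarrow> complex" where
  "kernel n m = of_bool (n mod (r+1) = m mod (r+1)) *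
     rho (n mod (r+1)) (real (n div (r+1)) - real (m div (r+1)))"

text \<open>Positivity is read off the product formula: passing to one more level amounts to rank
  one multiplications and one sum, starting from the kernel of the residue classes.\<close>

lemma psd_kernel: "psd kernel"
proof (rule psd_lim)
  let ?q = "r + 1"
  let ?P = "\<lambda>K n m. of_bool (n mod ?q = m mod ?q) * 
    partial_rho K (n mod ?q) (real (n div ?q) - real (m div ?q))"
  show "psd (?P K)" for K
  proof (induction K)
    case 0
    then show ?case using psd_mod[of ?q] by (simp add: partial_rho_def)
  next
    case (Suc K)
    define x y where "x n = cis (2 * pi * (real (n div ?q) / 2 ^ uu K (n mod ?q)))"
      and "y n = cis (2 * pi * (real (n div ?q) / 2 ^ wt K))" for n
    \<comment> \<open>\<open>x\<close> carries the phase of level \<open>K\<close> and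
      \<open>y\<close> its bit; the probability 1/2 of each bit is written as the rank one factor
      \<open>1 / sqrt 2\<close> times its conjugate.\<close>
    have "?P (Suc K) n m = (?P K n m * (x n * cnj (x m)) + ?P K n m * (x n * cnj (x m)) * (y n * cnj (y m)))
        * ((1 / sqrt 2) * cnj (1 / sqrt 2))" for n m
    proof (cases "n mod ?q = m mod ?q")
      case True
      have "x n * cnj (x m) = cis (2 * pi * ((real (n div ?q) - real (m div ?q)) / 2 ^ uu K (n mod ?q)))"
        "y n * cnj (y m) = cis (2 * pi * ((real (n div ?q) - real (m div ?q)) / 2 ^ wt K))"
        unfolding x_def y_def cis_cnj cis_mult True by (simp_all add: diff_divide_distrib right_diff_distrib)
      moreover have "complex_of_real (1 / sqrt 2) * cnj (1 / sqrt 2) = 1/2"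
        by (simp flip: of_real_mult)
      ultimately show ?thesis
        by (simp add: partial_rho_def factor_def True ring_distribs)
    qed simp
    then show ?case
      by (simp only:) (intro psd_mult_rank_one psd_add Suc)
  qed
  show "(\<lambda>K. ?P K n m) \<longlonglongrightarrow> kernel n m" for n m
    unfolding kernel_def by (intro tendsto_intros partial_rho_lim)
qed

lemma kernel_diag: "kernel n n = 1" by (simp add: kernel_def rho_zero)

lemma kernel_shift: "kernel (n + (r+1)) (m + (r+1)) = kernel n m"
  unfolding kernel_def by (simp add: div_add_self2 del: One_nat_def add_Suc_right)

lemma kernel_orthonormal:
  "kernel ((r+1) * 2 ^ (wt l - 1) + j) ((r+1) * 2 ^ (wt l' - 1) + j) = of_bool (l = l')" if "j \<le> r"
  using that rho_orthogonal[of l l' j] by (simp add: kernel_def rho_zero del: One_nat_def)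

text \<open>Bessel's inequality for the value at time \<open>t\<close> against the orthonormal
  values of the same process at the times \<open>2 ^ (wt l - 1)\<close>.\<close>

lemma rho_bessel:
  assumes "j \<le> r"
  shows "(\<Sum>l<L. (cmod (rho j (real t - 2 ^ (wt l - 1))))\<^sup>2) \<le> 1"
proof -
  have "cmod (kernel ((r+1) * t + j) ((r+1) * 2 ^ (wt l - 1) + j)) = cmod (rho j (real t - 2 ^ (wt l - 1)))" for l
    using assms by (simp add: kernel_def del: One_nat_def)
  moreover have "(\<Sum>l<L. (cmod (kernel ((r+1) * t + j) ((r+1) * 2 ^ (wt l - 1) + j)))\<^sup>2)
      \<le> Re (kernel ((r+1) * t + j) ((r+1) * t + j))"
    using psd_bessel[where R = kernel and s = "\<lambda>l. (r+1) * 2 ^ (wt l - 1) + j", OF psd_kernel]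
      kernel_orthonormal[OF assms] by blast
  ultimately show ?thesis by (simp add: kernel_diag)
qed

text \<open>Summing Bessel's inequality over \<open>t < N\<close> gives \<open>N\<close> on the
  right. On the left each of \<open>L\<close> shifts reproduces \<open>S N\<close> up to a constant,
  so \<open>L * S N \<le> N + C\<close> with \<open>C\<close> independent of \<open>N\<close>, and
  \<open>L\<close> is arbitrary.\<close>

lemma rho_cesaro_sq:
  assumes "j \<le> r"
  shows "(\<lambda>N. (\<Sum>t<N. (cmod (rho j (real t)))\<^sup>2) / real N) \<longlonglongrightarrow> 0"
proof -
  define g where "g s = (cmod (rho j s))\<^sup>2" for s
  have g: "0 \<le> g s" "g s \<le> 1" for s using norm_rho[of j s] by (auto simp: g_def power_le_one)
  define S where "S N = (\<Sum>t<N. g (real t))" for N :: nat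
  have S0: "0 \<le> S N" for N by (auto simp: S_def sum_nonneg g)
  have shift: "S N - real a \<le> (\<Sum>t<N. g (real t - real a))" for N a :: nat
  proof (cases "a \<le> N")
    case True
    have "S N = S (N - a) + (\<Sum>t\<in>{N - a..<N}. g (real t))"
      unfolding S_def by (subst sum.atLeastLessThan_concat[of 0 "N - a" N, unfolded atLeast0LessThan, symmetric]) auto
    also have "(\<Sum>t\<in>{N - a..<N}. g (real t)) \<le> (\<Sum>t\<in>{N - a..<N}. 1)" by (intro sum_mono g)
    also have "\<dots> = real a" using True by simp
    also have "S (N - a) = (\<Sum>t\<in>{a..<N}. g (real t - real a))"
      unfolding S_def by (rule sum.reindex_bij_witness[of _ "\<lambda>t. t - a" "\<lambda>t. t + a"]) (auto simp: of_nat_diff)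
    also have "\<dots> \<le> (\<Sum>t<N. g (real t - real a))"
      by (intro sum_mono2) (auto simp: g)
    finally show ?thesis by simp
  next
    case False
    have "S N \<le> (\<Sum>t<N. 1)" unfolding S_def by (intro sum_mono g)
    then have "S N \<le> real a" using False by simp
    moreover have "0 \<le> (\<Sum>t<N. g (real t - real a))" by (intro sum_nonneg g)
    ultimately show ?thesis by simp
  qed
  have main: "real L * S N \<le> real N + (\<Sum>l<L. 2 ^ (wt l - 1))" for L N
  proof -
    have "real L * S N - (\<Sum>l<L. 2 ^ (wt l - 1)) = (\<Sum>l<L. S N - real (2 ^ (wt l - 1)))"
      by (simp add: sum_subtractf)
    also have "\<dots> \<le> (\<Sum>l<L. \<Sum>t<N. g (real t - real (2 ^ (wt l - 1))))"
      by (intro sum_mono shift)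
    also have "\<dots> = (\<Sum>t<N. \<Sum>l<L. g (real t - 2 ^ (wt l - 1)))"
      by (subst sum.swap) simp
    also have "\<dots> \<le> (\<Sum>t<N. 1)" unfolding g_def by (intro sum_mono rho_bessel assms)
    finally show ?thesis by simp
  qed
  have "(\<lambda>N. S N / real N) \<longlonglongrightarrow> 0"
  proof (rule LIMSEQ_I)
    fix e :: real assume e: "e > 0"
    \<comment> \<open>The factor \<open>2\<close> leaves room for the shift constant
      \<open>C\<close>, which is below \<open>N\<close> when \<open>N\<close> is large.\<close>
    obtain L :: nat where L: "2 / e < real L" using reals_Archimedean2 by blast
    then have Lpos: "real L > 0" using e by (smt (verit) divide_pos_pos)
    define C where "C = (\<Sum>l<L. 2 ^ (wt l - 1) :: real)"
    have C0: "C \<ge> 0" by (simp add: C_def sum_nonneg)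
    obtain N0 :: nat where N0: "C < real N0" using reals_Archimedean2 by blast
    have "norm (S N / real N - 0) < e" if "N \<ge> N0" for N
    proof -
      have N: "C < real N" "real N > 0" using N0 that C0 by auto
      have "real L * S N < 2 * real N" using main[of L N] N by (simp add: C_def)
      also have "\<dots> \<le> (e * real L) * real N"
        using L e by (intro mult_right_mono) (auto simp: field_simps)
      finally have "real L * S N < real L * (e * real N)" by (simp add: mult_ac)
      then have "S N < e * real N" using Lpos by (simp only: mult_less_cancel_left_pos)
      then show ?thesis using N S0[of N] by (simp add: field_simps)
    qed
    then show "\<exists>no. \<forall>N\<ge>no. norm (S N / real N - 0) < e" by blast
  qed
  then show ?thesis by (simp add: S_def g_def)
qed

text \<open>Cauchy-Schwarz passes from squares to moduli. The offsets \<open>a\<close> and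
  \<open>b\<close> affect at most \<open>a + b\<close> boundary terms, each bounded by 1.\<close>

lemma rho_cesaro:
  assumes "j \<le> r"
  shows "(\<lambda>N. (\<Sum>t<N. cmod (rho j (real t + real a - real b))) / real N) \<longlonglongrightarrow> 0"
proof -
  define h where "h s = cmod (rho j s)" for s
  have h: "0 \<le> h s" "h s \<le> 1" for s by (auto simp: h_def norm_rho)
  have lim: "(\<lambda>N. sqrt ((\<Sum>t<N. (h (real t))\<^sup>2) / real N) + (real a + real b) / real N) \<longlonglongrightarrow> sqrt 0 + 0"
    using rho_cesaro_sq[OF assms] unfolding h_def
    by (intro tendsto_intros lim_const_over_n)
  have le: "(\<Sum>t<N. h (real t + real a - real b)) / real N
      \<le> sqrt ((\<Sum>t<N. (h (real t))\<^sup>2) / real N) + (real a + real b) / real N" for N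
  proof (cases "N = 0")
    case False
    have drop: "(\<Sum>t<N. f (real t - real b)) \<le> real b + (\<Sum>t<N. f (real t))"
      if f: "\<And>s. 0 \<le> f s" "\<And>s. f s \<le> 1" for f :: "real \<Rightarrow> real"
    proof -
      have "(\<Sum>t<N. f (real t - real b)) \<le> (\<Sum>t\<in>{..<b} \<union> {b..<N + b}. f (real t - real b))"
        by (intro sum_mono2) (auto simp: f)
      also have "\<dots> = (\<Sum>t<b. f (real t - real b)) + (\<Sum>t\<in>{b..<N + b}. f (real t - real b))"
        by (intro sum.union_disjoint) auto
      also have "(\<Sum>t\<in>{b..<N + b}. f (real t - real b)) = (\<Sum>t<N. f (real t))"
        by (rule sum.reindex_bij_witness[of _ "\<lambda>t. t + b" "\<lambda>t. t - b"]) (auto simp: of_nat_diff)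
      also have "(\<Sum>t<b. f (real t - real b)) \<le> (\<Sum>t<b. 1)" by (intro sum_mono f)
      finally show ?thesis by simp
    qed
    have "(\<Sum>t<N. h (real t + real a - real b)) \<le> real b + (\<Sum>t<N. h (real t + real a))"
      using drop[of "\<lambda>s. h (s + real a)"] h by (simp add: algebra_simps)
    also have "(\<Sum>t<N. h (real t + real a)) = (\<Sum>t\<in>{a..<N + a}. h (real t))"
      by (rule sum.reindex_bij_witness[of _ "\<lambda>t. t - a" "\<lambda>t. t + a"]) (auto simp: of_nat_diff)
    also have "\<dots> \<le> (\<Sum>t\<in>{..<N} \<union> {N..<N + a}. h (real t))"
      by (intro sum_mono2) (auto simp: h)
    also have "\<dots> = (\<Sum>t<N. h (real t)) + (\<Sum>t\<in>{N..<N + a}. h (real t))"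
      by (intro sum.union_disjoint) auto
    also have "(\<Sum>t\<in>{N..<N + a}. h (real t)) \<le> (\<Sum>t\<in>{N..<N + a}. 1)" by (intro sum_mono h)
    finally have 1: "(\<Sum>t<N. h (real t + real a - real b)) \<le> (\<Sum>t<N. h (real t)) + (real a + real b)"
      by simp
    have "(\<Sum>t<N. h (real t))\<^sup>2 \<le> (\<Sum>t<N. (h (real t))\<^sup>2) * real N"
      using sum_squared_le_sum_of_squares[where I = "{..<N}" and f = "\<lambda>t. h (real t)"] by simp
    then have "(\<Sum>t<N. h (real t))\<^sup>2 / (real N)\<^sup>2 \<le> (\<Sum>t<N. (h (real t))\<^sup>2) * real N / (real N)\<^sup>2"
      by (intro divide_right_mono) auto
    also have "\<dots> = (\<Sum>t<N. (h (real t))\<^sup>2) / real N"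
    proof -
      have "Q * x / x\<^sup>2 = Q / x" for Q x :: real by (cases "x = 0") (simp_all add: power2_eq_square)
      then show ?thesis .
    qed
    finally have "((\<Sum>t<N. h (real t)) / real N)\<^sup>2 \<le> (\<Sum>t<N. (h (real t))\<^sup>2) / real N"
      by (simp only: power_divide)
    then have 2: "(\<Sum>t<N. h (real t)) / real N \<le> sqrt ((\<Sum>t<N. (h (real t))\<^sup>2) / real N)"
      by (rule real_le_rsqrt)
    from divide_right_mono[OF 1, of "real N"] 2 show ?thesis by (simp add: add_divide_distrib)
  qed simp
  have nonneg: "0 \<le> (\<Sum>t<N. h (real t + real a - real b)) / real N" for N
    by (intro divide_nonneg_nonneg sum_nonneg h) simp
  have "(\<lambda>_. 0) \<longlonglongrightarrow> sqrt 0 + (0::real)" by simp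
  from tendsto_sandwich[OF eventuallyI eventuallyI this lim, OF nonneg le]
  have "(\<lambda>N. (\<Sum>t<N. h (real t + real a - real b)) / real N) \<longlonglongrightarrow> 0" by simp
  then show ?thesis by (simp add: h_def)
qed

lemma kernel_cesaro:
  "(\<lambda>N. (\<Sum>t<N. cmod (kernel (i + (r+1) * t) j)) / real N) \<longlonglongrightarrow> 0"
proof (cases "i mod (r+1) = j mod (r+1)")
  case True
  have "j mod (r+1) < r + 1" by (rule mod_less_divisor) simp
  then have "j mod (r+1) \<le> r" by simp
  from rho_cesaro[OF this, of "i div (r+1)" "j div (r+1)"] show ?thesis
    using True by (simp add: kernel_def add.commute del: One_nat_def)
next
  case False
  then show ?thesis by (simp add: kernel_def del: One_nat_def)
qed

end

section \<open>Bounded sequences and coordinates\<close>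

lemma bounded_in_bcontfun:
  fixes f :: "nat \<Rightarrow> complex"
  assumes "\<And>n. cmod (f n) \<le> B"
  shows "f \<in> bcontfun"
  by (rule bcontfun_normI[of _ B]) (auto intro: assms)

lemma apply_Bcontfun:
  fixes f :: "nat \<Rightarrow> complex"
  assumes "\<And>n. cmod (f n) \<le> B"
  shows "apply_bcontfun (Bcontfun f) n = f n"
  by (simp add: Bcontfun_inverse[OF bounded_in_bcontfun[OF assms]])

lemma apply_cscale[simp]: "apply_bcontfun (cscale c x) n = c * apply_bcontfun x n"
  unfolding cscale_def
  by (rule apply_Bcontfun[of _ "cmod c * norm x"]) (simp add: norm_mult mult_left_mono norm_bounded)

lemma apply_sum: "apply_bcontfun (\<Sum>i\<in>I. f i) n = (\<Sum>i\<in>I. apply_bcontfun (f i) n)"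
  by (induction I rule: infinite_finite_induct) auto

lemma norm_cscale: "norm (cscale c x) = cmod c * norm x"
proof (rule antisym)
  show le: "norm (cscale c x) \<le> cmod c * norm x" for c and x :: linf
    by (rule norm_bound) (simp add: norm_mult mult_left_mono norm_bounded)
  show "cmod c * norm x \<le> norm (cscale c x)"
  proof (cases "c = 0")
    case False
    have "x = cscale (inverse c) (cscale c x)" using False by (intro bcontfun_eqI) simp
    then have "norm x \<le> cmod (inverse c) * norm (cscale c x)" using le[of "inverse c" "cscale c x"] by simp
    then show ?thesis using False by (simp add: norm_divide field_simps)
  qed simp
qed

text \<open>The type class structure of \<open>linf\<close> has real scalars; this gives access to
  complex spans and independence.\<close>

interpretation cs: vector_space cscale
  by unfold_locales (auto intro!: bcontfun_eqI simp: algebra_simps)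

lemma cspan_subset_span: "cspan F \<subseteq> cs.span F"
proof
  fix x assume "x \<in> cspan F"
  then obtain c where "x = (\<Sum>v\<in>F. cscale (c v) v)" unfolding cspan_def by blast
  moreover have "(\<Sum>v\<in>F. cscale (c v) v) \<in> cs.span F"
    by (rule cs.span_sum, rule cs.span_scale, rule cs.span_base)
  ultimately show "x \<in> cs.span F" by simp
qed

section \<open>Coordinate functionals, the coordinate sigma-algebra and the weighted shift\<close>

definition lin_func :: "(nat \<Rightarrow> complex) \<Rightarrow> nat \<Rightarrow> linf \<Rightarrow> complex" where
  "lin_func a J x = (\<Sum>j<J. a j * apply_bcontfun x j)"

abbreviation linf_chars :: "(linf \<Rightarrow> real) set" where
  "linf_chars \<equiv> {\<lambda>x. Re (lin_func a J x) | a J. True}"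

lemma lin_func_extend: "J \<le> K \<Longrightarrow> lin_func a J = lin_func (\<lambda>j. if j < J then a j else 0) K"
  unfolding lin_func_def by (intro ext sum.mono_neutral_cong_left) auto

interpretation linf_chars: additive_functions linf_chars
proof
  show "(\<lambda>x. u x + v x) \<in> linf_chars" if "u \<in> linf_chars" "v \<in> linf_chars" for u v
  proof -
    from that obtain a J b K where uv: "u = (\<lambda>x. Re (lin_func a J x))" "v = (\<lambda>x. Re (lin_func b K x))" by blast
    define a' b' where "a' j = (if j < J then a j else 0)" and "b' j = (if j < K then b j else 0)" for j
    have "(\<lambda>x. u x + v x) = (\<lambda>x. Re (lin_func (\<lambda>j. a' j + b' j) (max J K) x))"
      unfolding uv lin_func_extend[of J "max J K" a, OF max.cobounded1]
        lin_func_extend[of K "max J K" b, OF max.cobounded2] a'_def[symmetric] b'_def[symmetric]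
      by (simp add: lin_func_def sum.distrib ring_distribs)
    then show ?thesis by blast
  qed
  show "(\<lambda>x. t * u x) \<in> linf_chars" if "u \<in> linf_chars" for u t
  proof -
    from that obtain a J where u: "u = (\<lambda>x. Re (lin_func a J x))" by blast
    have "(\<lambda>x. t * u x) = (\<lambda>x. Re (lin_func (\<lambda>j. of_real t * a j) J x))"
      unfolding u lin_func_def by (simp add: sum_distrib_left right_diff_distrib mult.assoc)
    then show ?thesis by blast
  qed
qed blast

text \<open>The sigma-algebra on which characters in finitely many coordinates determine a finite
  measure. As \<open>linf\<close> is not separable, it is compared with the Borel sets only on
  separable subsets.\<close>

definition coord_sigma :: "linf measure" where
  "coord_sigma = sigma UNIV linf_chars.gen"

lemma sets_coord_sigma: "sets coord_sigma = sigma_sets UNIV linf_chars.gen"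
  and space_coord_sigma[simp]: "space coord_sigma = UNIV"
  by (auto simp: coord_sigma_def)

lemma measurable_coord[measurable]: "(\<lambda>x. apply_bcontfun x j) \<in> borel_measurable coord_sigma"
proof -
  have "(\<lambda>x. Re (lin_func a J x)) \<in> borel_measurable coord_sigma" for a J
    unfolding borel_measurable_iff_greater
  proof
    fix t
    have "{x. t < Re (lin_func a J x)} \<in> linf_chars.gen" by (rule linf_chars.genI) blast
    then show "{x \<in> space coord_sigma. t < Re (lin_func a J x)} \<in> sets coord_sigma"
      by (simp add: sets_coord_sigma sigma_sets.Basic)
  qed
  from this[of "\<lambda>i. of_bool (i = j)" "Suc j"] this[of "\<lambda>i. - \<i> * of_bool (i = j)" "Suc j"]
  show ?thesis by (subst borel_measurable_complex_iff) (simp add: lin_func_def)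
qed

lemma measurable_coord_sigmaI:
  assumes "\<And>j. (\<lambda>\<omega>. apply_bcontfun (X \<omega>) j) \<in> borel_measurable M"
  shows "X \<in> M \<rightarrow>\<^sub>M coord_sigma"
  unfolding coord_sigma_def
proof (rule measurable_measure_of)
  fix A assume "A \<in> linf_chars.gen"
  then obtain a J t where A: "A = {x. Re (lin_func a J x) > t}" unfolding linf_chars.gen_def by auto
  note [measurable] = assms
  have "(\<lambda>\<omega>. Re (lin_func a J (X \<omega>))) \<in> borel_measurable M"
    unfolding lin_func_def by measurable
  then have "{\<omega> \<in> space M. Re (lin_func a J (X \<omega>)) > t} \<in> sets M" by measurable
  also have "{\<omega> \<in> space M. Re (lin_func a J (X \<omega>)) > t} = X -` A \<inter> space M" by (auto simp: A)
  finally show "X -` A \<inter> space M \<in> sets M" .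
qed auto

text \<open>In the supremum norm a ball is given by countably many coordinate conditions.\<close>

lemma cball_in_coord_sigma: "cball d \<rho> \<in> sets coord_sigma"
proof (cases "\<rho> \<ge> 0")
  case True
  have "cball d \<rho> = {x \<in> space coord_sigma. \<forall>n. cmod (apply_bcontfun x n - apply_bcontfun d n) \<le> \<rho>}"
  proof (intro set_eqI iffI)
    fix x assume "x \<in> cball d \<rho>"
    then have "norm (x - d) \<le> \<rho>" by (simp add: dist_norm norm_minus_commute)
    then have "cmod (apply_bcontfun (x - d) n) \<le> \<rho>" for n
      using norm_bounded[of "x - d" n] by linarith
    then show "x \<in> {x \<in> space coord_sigma. \<forall>n. cmod (apply_bcontfun x n - apply_bcontfun d n) \<le> \<rho>}" by simp
  next
    fix x assume "x \<in> {x \<in> space coord_sigma. \<forall>n. cmod (apply_bcontfun x n - apply_bcontfun d n) \<le> \<rho>}"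
    then have "norm (x - d) \<le> \<rho>" by (intro norm_bound) simp
    then show "x \<in> cball d \<rho>" by (simp add: dist_norm norm_minus_commute)
  qed
  also have "\<dots> \<in> sets coord_sigma" by measurable
  finally show ?thesis .
qed (auto simp: not_le)

text \<open>The balls of radius \<open>1 / Suc n\<close> around points of \<open>D\<close> that fit
  into \<open>S\<close> are countably many and cover \<open>S\<close> within
  \<open>V\<close>.\<close>

lemma separable_open_coord:
  assumes D: "countable D" "D \<subseteq> V" "V \<subseteq> closure D" and S: "open S"
  shows "\<exists>A\<in>sets coord_sigma. A \<subseteq> S \<and> S \<inter> V \<subseteq> A"
proof -
  define I where "I = {(d, n :: nat). d \<in> D \<and> cball d (1 / Suc n) \<subseteq> S}"
  have "countable I" by (rule countable_subset[of _ "D \<times> UNIV"]) (auto simp: I_def D)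
  then have 1: "(\<Union>(d, n)\<in>I. cball d (1 / Suc n)) \<in> sets coord_sigma"
    by (intro sets.countable_UN') (auto simp: cball_in_coord_sigma)
  have "x \<in> (\<Union>(d, n)\<in>I. cball d (1 / Suc n))" if x: "x \<in> S \<inter> V" for x
  proof -
    obtain e where e: "e > 0" "ball x e \<subseteq> S" using S x by (meson IntD1 open_contains_ball)
    obtain n where n: "1 / Suc n < e / 2" using nat_approx_posE[of "e/2"] e by auto
    have "x \<in> closure D" using x D by blast
    then obtain d where d: "d \<in> D" "dist d x < 1 / Suc n"
      unfolding closure_approachable by (metis of_nat_0_less_iff zero_less_Suc zero_less_divide_1_iff)
    have "cball d (1 / Suc n) \<subseteq> ball x e"
    proof
      fix y assume "y \<in> cball d (1 / Suc n)"
      then have "dist d y \<le> 1 / Suc n" by simp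
      then have "dist x y < e" using n d(2) dist_triangle[of x y d] by (simp add: dist_commute)
      then show "y \<in> ball x e" by simp
    qed
    then have "(d, n) \<in> I" using d e by (auto simp: I_def)
    then show ?thesis using d by (force simp: dist_commute less_imp_le)
  qed
  moreover have "(\<Union>(d, n)\<in>I. cball d (1 / Suc n)) \<subseteq> S" by (auto simp: I_def)
  ultimately show ?thesis using 1 by blast
qed

lemma borel_eq_coord_on_separable:
  assumes D: "countable D" "D \<subseteq> V" "V \<subseteq> closure D"
  shows "(\<lambda>x. x) \<in> borel_measurable (restrict_space coord_sigma V)"
proof (rule borel_measurableI)
  fix S :: "linf set" assume "open S"
  from separable_open_coord[OF D this] obtain A where A: "A \<in> sets coord_sigma" "A \<subseteq> S" "S \<inter> V \<subseteq> A" by blast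
  then have "(\<lambda>x. x) -` S \<inter> space (restrict_space coord_sigma V) = V \<inter> A"
    by (auto simp: space_restrict_space)
  then show "(\<lambda>x. x) -` S \<inter> space (restrict_space coord_sigma V) \<in> sets (restrict_space coord_sigma V)"
    using A by (auto simp: sets_restrict_space)
qed

text \<open>A closed \<open>V\<close> consists of the points that \<open>D\<close> approximates to
  every accuracy \<open>1 / Suc n\<close>.\<close>

lemma closed_separable_in_coord_sigma:
  assumes D: "countable D" "D \<subseteq> V" "V \<subseteq> closure D" and V: "closed V"
  shows "V \<in> sets coord_sigma"
proof -
  have "V = (\<Inter>n. \<Union>d\<in>D. cball d (1 / Suc n))"
  proof (intro set_eqI iffI INT_I)
    fix x n assume "x \<in> V"
    then have "x \<in> closure D" using D by blast
    then obtain d where "d \<in> D" "dist d x < 1 / Suc n"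
      unfolding closure_approachable by (metis of_nat_0_less_iff zero_less_Suc zero_less_divide_1_iff)
    then show "x \<in> (\<Union>d\<in>D. cball d (1 / Suc n))" by force
  next
    fix x assume x: "x \<in> (\<Inter>n. \<Union>d\<in>D. cball d (1 / Suc n))"
    have "x \<in> closure V"
      unfolding closure_approachable
    proof (intro allI impI)
      fix e :: real assume "e > 0"
      then obtain n where n: "1 / Suc n < e" using nat_approx_posE by metis
      from x obtain d where "d \<in> D" "dist d x \<le> 1 / Suc n" by force
      then show "\<exists>y\<in>V. dist y x < e" using n D by (intro bexI[of _ d]) auto
    qed
    then show "x \<in> V" using V by simp
  qed
  also have "\<dots> \<in> sets coord_sigma"
    using D sets.top[of coord_sigma] by (intro sets.countable_INT'' sets.countable_UN') (auto simp: cball_in_coord_sigma)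
  finally show ?thesis .
qed

definition shift_op :: "nat \<Rightarrow> linf \<Rightarrow> linf" where
  "shift_op q x = Bcontfun (\<lambda>n. 2 ^ q * apply_bcontfun x (n + q))"

lemma apply_shift_op[simp]: "apply_bcontfun (shift_op q x) n = 2 ^ q * apply_bcontfun x (n + q)"
  unfolding shift_op_def
  by (rule apply_Bcontfun[of _ "2 ^ q * norm x"]) (simp add: norm_mult norm_power norm_bounded)

lemma apply_shift_op_pow: "apply_bcontfun ((shift_op q ^^ t) x) n = 2 ^ (q * t) * apply_bcontfun x (n + q * t)"
  by (induction t arbitrary: n) (simp_all add: power_add algebra_simps)

lemma norm_shift_op: "norm (shift_op q x) \<le> 2 ^ q * norm x"
  by (rule norm_bound) (simp add: norm_mult norm_power norm_bounded)

lemma shift_op_add: "shift_op q (x + y) = shift_op q x + shift_op q y"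
  by (rule bcontfun_eqI) (simp add: algebra_simps)

lemma shift_op_diff: "shift_op q (x - y) = shift_op q x - shift_op q y"
  by (rule bcontfun_eqI) (simp add: algebra_simps)

lemma shift_op_cscale: "shift_op q (cscale c x) = cscale c (shift_op q x)"
  by (rule bcontfun_eqI) (simp add: algebra_simps)

lemma measurable_shift_op_pow[measurable]: "(shift_op q ^^ t) \<in> coord_sigma \<rightarrow>\<^sub>M coord_sigma"
  by (rule measurable_coord_sigmaI) (simp add: apply_shift_op_pow)

lemma measurable_shift_op[measurable]: "shift_op q \<in> coord_sigma \<rightarrow>\<^sub>M coord_sigma"
  by (rule measurable_coord_sigmaI) simp

section \<open>Weak mixing from mixing of characters\<close>

definition cesaro_null :: "(nat \<Rightarrow> complex) \<Rightarrow> bool" where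
  "cesaro_null D \<longleftrightarrow> (\<lambda>N. (\<Sum>n<N. cmod (D n)) / real N) \<longlonglongrightarrow> 0"

lemma cesaro_null_le:
  assumes "cesaro_null D" "\<And>n. cmod (D' n) \<le> C * cmod (D n)"
  shows "cesaro_null D'"
  unfolding cesaro_null_def
proof (rule tendsto_sandwich[where f = "\<lambda>_. 0"])
  show "(\<lambda>N. C * ((\<Sum>n<N. cmod (D n)) / real N)) \<longlonglongrightarrow> 0"
    using tendsto_mult_left[OF assms(1)[unfolded cesaro_null_def], of C] by simp
  show "\<forall>\<^sub>F N in sequentially. (\<Sum>n<N. cmod (D' n)) / real N \<le> C * ((\<Sum>n<N. cmod (D n)) / real N)"
  proof (rule always_eventually, rule allI)
    fix N
    have "(\<Sum>n<N. cmod (D' n)) \<le> C * (\<Sum>n<N. cmod (D n))"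
      unfolding sum_distrib_left by (intro sum_mono assms)
    then show "(\<Sum>n<N. cmod (D' n)) / real N \<le> C * ((\<Sum>n<N. cmod (D n)) / real N)"
      using divide_right_mono[of _ _ "real N"] by fastforce
  qed
qed (auto intro!: always_eventually divide_nonneg_nonneg sum_nonneg)

lemma cesaro_null_add:
  assumes "cesaro_null D" "cesaro_null E"
  shows "cesaro_null (\<lambda>n. D n + E n)"
  unfolding cesaro_null_def
proof (rule tendsto_sandwich[where f = "\<lambda>_. 0"])
  show "(\<lambda>N. (\<Sum>n<N. cmod (D n)) / real N + (\<Sum>n<N. cmod (E n)) / real N) \<longlonglongrightarrow> 0"
    using tendsto_add[OF assms[unfolded cesaro_null_def]] by simp
  show "\<forall>\<^sub>F N in sequentially. (\<Sum>n<N. cmod (D n + E n)) / real N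
      \<le> (\<Sum>n<N. cmod (D n)) / real N + (\<Sum>n<N. cmod (E n)) / real N"
    unfolding add_divide_distrib[symmetric] sum.distrib[symmetric]
    by (intro always_eventually allI divide_right_mono sum_mono norm_triangle_ineq) simp
qed (auto intro!: always_eventually divide_nonneg_nonneg sum_nonneg)

text \<open>The error \<open>\<delta> i\<close> does not depend on \<open>n\<close>, so averaging
  preserves it.\<close>

lemma cesaro_null_approx:
  assumes "\<And>i. cesaro_null (D i)" "\<And>i n. cmod (E n - D i n) \<le> \<delta> i" "\<delta> \<longlonglongrightarrow> (0 :: real)"
  shows "cesaro_null E"
  unfolding cesaro_null_def
proof (rule LIMSEQ_I)
  fix e :: real assume e: "e > 0"
  obtain i where i: "\<bar>\<delta> i\<bar> < e / 2"
    using LIMSEQ_D[OF assms(3), of "e/2"] e by auto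
  obtain N0 where N0: "\<And>N. N \<ge> N0 \<Longrightarrow> norm ((\<Sum>n<N. cmod (D i n)) / real N - 0) < e / 2"
    using LIMSEQ_D[OF assms(1)[of i, unfolded cesaro_null_def], of "e/2"] e by auto
  have "norm ((\<Sum>n<N. cmod (E n)) / real N - 0) < e" if N: "N \<ge> max 1 N0" for N
  proof -
    have "(\<Sum>n<N. cmod (E n)) \<le> (\<Sum>n<N. cmod (D i n) + \<delta> i)"
    proof (rule sum_mono)
      fix n show "cmod (E n) \<le> cmod (D i n) + \<delta> i"
        using norm_triangle_ineq2[of "E n" "D i n"] assms(2)[of n i] by linarith
    qed
    then have "(\<Sum>n<N. cmod (E n)) / real N \<le> ((\<Sum>n<N. cmod (D i n)) + real N * \<delta> i) / real N"
      by (intro divide_right_mono) (auto simp: sum.distrib)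
    also have "\<dots> = (\<Sum>n<N. cmod (D i n)) / real N + \<delta> i" using N by (simp add: add_divide_distrib)
    also have "(\<Sum>n<N. cmod (D i n)) / real N < e / 2"
    proof -
      have "norm ((\<Sum>n<N. cmod (D i n)) / real N - 0) < e / 2" using N0 N by simp
      then show ?thesis unfolding real_norm_def diff_0_right by linarith
    qed
    also have "e / 2 + \<delta> i < e" using i by linarith
    finally show ?thesis by (auto simp: abs_of_nonneg sum_nonneg)
  qed
  then show "\<exists>no. \<forall>N\<ge>no. norm ((\<Sum>n<N. cmod (E n)) / real N - 0) < e" by blast
qed

definition bdd_meas :: "'a measure \<Rightarrow> ('a \<Rightarrow> complex) \<Rightarrow> bool" where
  "bdd_meas M f \<longleftrightarrow> f \<in> borel_measurable M \<and> (\<exists>B. \<forall>x. cmod (f x) \<le> B)"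

lemma bdd_meas_add: "bdd_meas M f \<Longrightarrow> bdd_meas M g \<Longrightarrow> bdd_meas M (\<lambda>x. f x + g x)"
  unfolding bdd_meas_def
proof (elim conjE exE, intro conjI)
  fix B C assume "\<forall>x. cmod (f x) \<le> B" "\<forall>x. cmod (g x) \<le> C"
  then have "cmod (f x + g x) \<le> B + C" for x using norm_triangle_mono by blast
  then show "\<exists>B. \<forall>x. cmod (f x + g x) \<le> B" by blast
qed simp

lemma bdd_meas_scale: "bdd_meas M f \<Longrightarrow> bdd_meas M (\<lambda>x. c * f x)"
  unfolding bdd_meas_def
proof (elim conjE exE, intro conjI)
  fix B assume "\<forall>x. cmod (f x) \<le> B"
  then have "cmod (c * f x) \<le> cmod c * B" for x by (simp add: norm_mult mult_left_mono)
  then show "\<exists>B. \<forall>x. cmod (c * f x) \<le> B" by blast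
qed simp

lemma bdd_meas_mult: "bdd_meas M f \<Longrightarrow> bdd_meas M g \<Longrightarrow> bdd_meas M (\<lambda>x. f x * g x)"
  unfolding bdd_meas_def
proof (elim conjE exE, intro conjI)
  fix B C assume *: "\<forall>x. cmod (f x) \<le> B" "\<forall>x. cmod (g x) \<le> C"
  have "cmod (f x * g x) \<le> B * C" for x
    unfolding norm_mult using * order_trans[OF norm_ge_zero spec[OF *(1)]]
    by (intro mult_mono) auto
  then show "\<exists>B. \<forall>x. cmod (f x * g x) \<le> B" by blast
qed simp

lemma (in prob_space) bdd_meas_integrable: "bdd_meas M f \<Longrightarrow> integrable M f"
  unfolding bdd_meas_def by (auto intro: integrable_const_bound)

text \<open>\<open>D n\<close> stands for a correlation at time \<open>n\<close> with one slot
  frozen. Its bound by the mean of \<open>cmod (f x)\<close>, uniform in \<open>n\<close>, makes the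
  Cesaro property stable under bounded pointwise limits.\<close>

lemma (in prob_space) cesaro_bounded_closure:
  assumes f: "bounded_closure F f"
    and base: "\<And>f. f \<in> F \<Longrightarrow> bdd_meas M f \<and> cesaro_null (\<lambda>n. D n f)"
    and add: "\<And>n f g. bdd_meas M f \<Longrightarrow> bdd_meas M g \<Longrightarrow> D n (\<lambda>x. f x + g x) = D n f + D n g"
    and scale: "\<And>n f c. bdd_meas M f \<Longrightarrow> D n (\<lambda>x. c * f x) = c * D n f"
    and bound: "\<And>n f. bdd_meas M f \<Longrightarrow> cmod (D n f) \<le> C * (\<integral>x. cmod (f x) \<partial>M)"
  shows "bdd_meas M f \<and> cesaro_null (\<lambda>n. D n f)"
  using f
proof induction
  case (base f)
  then show ?case by (rule assms(2))
next
  case (add f g)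
  then show ?case using assms(3)[of f g] bdd_meas_add[of M f g]
      cesaro_null_add[of "\<lambda>n. D n f" "\<lambda>n. D n g"] by simp
next
  case (scale f c)
  then have "cesaro_null (\<lambda>n. D n f)" by blast
  then have "cesaro_null (\<lambda>n. c * D n f)"
    by (rule cesaro_null_le[where C = "cmod c"]) (simp only: norm_mult order_refl)
  then show ?case using scale assms(4)[of f _ c] bdd_meas_scale[of M f c] by simp
next
  case (lim G B f)
  have fB: "cmod (f x) \<le> B" for x
    using lim by (intro LIMSEQ_le_const2[OF tendsto_norm[OF lim(3)]]) auto
  have f: "bdd_meas M f"
    unfolding bdd_meas_def
  proof
    show "f \<in> borel_measurable M"
      by (rule borel_measurable_LIMSEQ_metric[where f = G]) (use lim in \<open>auto simp: bdd_meas_def\<close>)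
    show "\<exists>B. \<forall>x. cmod (f x) \<le> B" using fB by blast
  qed
  have diff: "bdd_meas M (\<lambda>x. f x + (-1) * G i x)" for i
    using f lim by (intro bdd_meas_add bdd_meas_scale) auto
  have D: "D n f - D n (G i) = D n (\<lambda>x. f x + (-1) * G i x)" for n i
    using assms(3)[OF f bdd_meas_scale[of M "G i" "-1"], of n] assms(4)[of "G i" n "-1"] lim by auto
  \<comment> \<open>Closeness of \<open>G i\<close> to \<open>f\<close> in mean bounds the
    difference of \<open>D n (G i)\<close> and \<open>D n f\<close> for all \<open>n\<close> at
    once.\<close>
  have "(\<lambda>i. \<integral>x. cmod (f x + (-1) * G i x) \<partial>M) \<longlonglongrightarrow> (\<integral>x. 0 \<partial>M)"
  proof (rule integral_dominated_convergence[where w = "\<lambda>_. 2 * B"])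
    show "(\<lambda>x. cmod (f x + (-1) * G i x)) \<in> borel_measurable M" for i
      using diff[of i] by (auto simp: bdd_meas_def)
    show "AE x in M. (\<lambda>i. cmod (f x + (-1) * G i x)) \<longlonglongrightarrow> 0"
    proof (rule AE_I2)
      fix x
      have "(\<lambda>i. cmod (f x + (-1) * G i x)) \<longlonglongrightarrow> cmod (f x + (-1) * f x)"
        by (intro tendsto_intros lim(3))
      then show "(\<lambda>i. cmod (f x + (-1) * G i x)) \<longlonglongrightarrow> 0" by simp
    qed
    show "AE x in M. norm (cmod (f x + (-1) * G i x)) \<le> 2 * B" for i
    proof (rule AE_I2)
      fix x
      show "norm (cmod (f x + (-1) * G i x)) \<le> 2 * B"
        using norm_triangle_ineq4[of "f x" "G i x"] fB[of x] lim(2)[of i x] by simp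
    qed
  qed auto
  then have "(\<lambda>i. C * (\<integral>x. cmod (f x + (-1) * G i x) \<partial>M)) \<longlonglongrightarrow> 0"
    using tendsto_mult_left[of _ 0 sequentially C] by simp
  then have "cesaro_null (\<lambda>n. D n f)"
  proof (rule cesaro_null_approx[rotated 2])
    show "cesaro_null (\<lambda>n. D n (G i))" for i using lim by blast
    show "cmod (D n f - D n (G i)) \<le> C * (\<integral>x. cmod (f x + (-1) * G i x) \<partial>M)" for i n
      unfolding D by (rule assms(5)[OF diff])
  qed
  then show ?case using f by blast
qed

text \<open>The two slots of the correlation are extended in turn from characters to their closure.
  Invariance of the measure supplies bounds in mean that are uniform in the time.\<close>

lemma (in prob_space) weak_mixing_of_characters:
  assumes S: "additive_functions S" and S_sets: "sets M = sigma_sets UNIV (additive_functions.gen S)"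
    and T: "T \<in> M \<rightarrow>\<^sub>M M" "distr M M T = M"
    and mix: "\<And>u v. u \<in> S \<Longrightarrow> v \<in> S \<Longrightarrow> cesaro_null (\<lambda>n. (\<integral>x. cis (u ((T ^^ n) x)) * cis (v x) \<partial>M) -
        (\<integral>x. cis (u x) \<partial>M) * (\<integral>x. cis (v x) \<partial>M))"
    and AB: "A \<in> sets M" "B \<in> sets M"
  shows "(\<lambda>N. (\<Sum>n<N. \<bar>measure M {x \<in> space M. (T ^^ n) x \<in> A \<and> x \<in> B} - measure M A * measure M B\<bar>) / real N) \<longlonglongrightarrow> 0"
proof -
  interpret S: additive_functions S by fact
  define D where "D f g n = (\<integral>x. f ((T ^^ n) x) * g x \<partial>M) - (\<integral>x. f x \<partial>M) * (\<integral>x. g x \<partial>M)" for f g :: "_ \<Rightarrow> complex" and n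
  have Tn[measurable]: "(T ^^ n) \<in> M \<rightarrow>\<^sub>M M" for n
    by (induction n) (auto intro: measurable_compose[OF _ T(1)] simp: id_def comp_def)
  have Tn_distr: "distr M M (T ^^ n) = M" for n
  proof (induction n)
    case (Suc n)
    then show ?case using distr_distr[OF T(1) Tn[of n], symmetric] T(2) by (simp add: comp_def)
  qed (simp add: id_def distr_id)
  have bT: "bdd_meas M (\<lambda>x. f ((T ^^ n) x))" if "bdd_meas M f" for f n
    using that measurable_compose[OF Tn] unfolding bdd_meas_def by blast
  have int_T: "(\<integral>x. cmod (f ((T ^^ n) x)) \<partial>M) = (\<integral>x. cmod (f x) \<partial>M)" if "bdd_meas M f" for f n
  proof -
    have "(\<lambda>x. cmod (f x)) \<in> borel_measurable M"
    proof -
      have [measurable]: "f \<in> borel_measurable M" using that by (simp add: bdd_meas_def)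
      show ?thesis by measurable
    qed
    from integral_distr[OF Tn this, of n] show ?thesis by (simp add: Tn_distr)
  qed
  have bnd: "cmod (\<integral>x. f x * g x \<partial>M) \<le> K * (\<integral>x. cmod (f x) \<partial>M)"
    if f: "bdd_meas M f" and g: "bdd_meas M g" and K: "\<And>x. cmod (g x) \<le> K" for f g K
  proof -
    have "cmod (\<integral>x. f x * g x \<partial>M) \<le> (\<integral>x. cmod (f x * g x) \<partial>M)" by (rule integral_norm_bound)
    also have "\<dots> \<le> (\<integral>x. K * cmod (f x) \<partial>M)"
    proof (rule integral_mono)
      show "integrable M (\<lambda>x. cmod (f x * g x))" "integrable M (\<lambda>x. K * cmod (f x))"
        using bdd_meas_integrable f bdd_meas_mult[OF f g] by (auto intro!: integrable_norm)
      show "cmod (f x * g x) \<le> K * cmod (f x)" for x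
        using mult_left_mono[OF K, of "cmod (f x)"] by (simp add: norm_mult mult.commute)
    qed
    finally show ?thesis by simp
  qed
  have bnd2: "cmod (\<integral>x. g x \<partial>M) \<le> K" if "bdd_meas M g" "\<And>x. cmod (g x) \<le> K" for g K
  proof -
    have "cmod (\<integral>x. g x \<partial>M) \<le> (\<integral>x. cmod (g x) \<partial>M)" by (rule integral_norm_bound)
    also have "\<dots> \<le> (\<integral>x. K \<partial>M)"
      by (intro integral_mono integrable_norm bdd_meas_integrable that) auto
    finally show ?thesis by (simp add: prob_space)
  qed
  have D_bound1: "cmod (D f g n) \<le> 2 * K * (\<integral>x. cmod (f x) \<partial>M)"
    if f: "bdd_meas M f" and g: "bdd_meas M g" and K: "\<And>x. cmod (g x) \<le> K" for f g K n
  proof -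
    have "cmod (D f g n) \<le> cmod (\<integral>x. f ((T ^^ n) x) * g x \<partial>M) + cmod (\<integral>x. f x \<partial>M) * cmod (\<integral>x. g x \<partial>M)"
      unfolding D_def norm_mult[symmetric] by (rule norm_triangle_ineq4)
    also have "cmod (\<integral>x. f ((T ^^ n) x) * g x \<partial>M) \<le> K * (\<integral>x. cmod (f x) \<partial>M)"
      using bnd[OF bT[OF f] g K] int_T[OF f] by simp
    also have "cmod (\<integral>x. f x \<partial>M) * cmod (\<integral>x. g x \<partial>M) \<le> (\<integral>x. cmod (f x) \<partial>M) * K"
      by (intro mult_mono integral_norm_bound bnd2 g K) (auto intro!: Bochner_Integration.integral_nonneg)
    finally show ?thesis by (simp add: algebra_simps)
  qed
  have D_bound2: "cmod (D f g n) \<le> 2 * K * (\<integral>x. cmod (g x) \<partial>M)"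
    if f: "bdd_meas M f" and g: "bdd_meas M g" and K: "\<And>x. cmod (f x) \<le> K" for f g K n
  proof -
    have "cmod (D f g n) \<le> cmod (\<integral>x. f ((T ^^ n) x) * g x \<partial>M) + cmod (\<integral>x. f x \<partial>M) * cmod (\<integral>x. g x \<partial>M)"
      unfolding D_def norm_mult[symmetric] by (rule norm_triangle_ineq4)
    also have "cmod (\<integral>x. f ((T ^^ n) x) * g x \<partial>M) \<le> K * (\<integral>x. cmod (g x) \<partial>M)"
      using bnd[OF g bT[OF f, of n], of K] K by (simp add: mult.commute)
    also have "cmod (\<integral>x. f x \<partial>M) * cmod (\<integral>x. g x \<partial>M) \<le> K * (\<integral>x. cmod (g x) \<partial>M)"
      by (intro mult_mono integral_norm_bound bnd2 f K) (use order_trans[OF norm_ge_zero K] in auto)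
    finally show ?thesis by (simp add: algebra_simps)
  qed
  have int[intro]: "integrable M f" if "bdd_meas M f" for f using bdd_meas_integrable that .
  have D_add1: "D (\<lambda>x. f x + f' x) g n = D f g n + D f' g n"
    if "bdd_meas M f" "bdd_meas M f'" "bdd_meas M g" for f f' g n
    using that int[OF bdd_meas_mult[OF bT[of f n] that(3)]] int[OF bdd_meas_mult[OF bT[of f' n] that(3)]] int
    by (simp add: D_def ring_distribs)
  have D_add2: "D f (\<lambda>x. g x + g' x) n = D f g n + D f g' n"
    if "bdd_meas M f" "bdd_meas M g" "bdd_meas M g'" for f g g' n
    using that int[OF bdd_meas_mult[OF bT[of f n] that(2)]] int[OF bdd_meas_mult[OF bT[of f n] that(3)]] int
    by (simp add: D_def ring_distribs)
  have D_scale1: "D (\<lambda>x. c * f x) g n = c * D f g n" for f g c n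
    by (simp add: D_def mult.assoc right_diff_distrib)
  have D_scale2: "D f (\<lambda>x. c * g x) n = c * D f g n" for f g c n
    by (simp add: D_def mult.left_commute[of _ c] right_diff_distrib)
  have trig: "bdd_meas M f" if "f \<in> S.trig" for f
  proof -
    from that obtain u where u: "u \<in> S" "f = (\<lambda>x. cis (u x))" by blast
    have "space M = UNIV" using S_sets by (metis sets.top sigma_sets_top sets.sets_into_space subset_UNIV top.extremum_unique)
    then have "u \<in> borel_measurable M"
      unfolding borel_measurable_iff_greater S_sets using u by (auto simp: S.gen_def intro!: sigma_sets.Basic)
    from measurable_compose[OF this borel_measurable_continuous_onI[of cis]]
    have "f \<in> borel_measurable M" by (simp add: u continuous_on_cis)
    then show ?thesis unfolding bdd_meas_def by (auto simp: u intro!: exI[of _ 1])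
  qed
  have step1: "bdd_meas M f \<and> cesaro_null (D f g)" if g: "g \<in> S.trig" and f: "S.trig_closure f" for f g
  proof -
    have g1: "cmod (g x) \<le> 1" for x using g by auto
    show ?thesis
    proof (rule cesaro_bounded_closure[OF f, where D = "\<lambda>n f. D f g n" and C = 2])
      fix f assume f: "f \<in> S.trig"
      then obtain u v where "u \<in> S" "f = (\<lambda>x. cis (u x))" "v \<in> S" "g = (\<lambda>x. cis (v x))" using g by blast
      then show "bdd_meas M f \<and> cesaro_null (D f g)" using trig[OF f] mix[of u v] by (simp add: D_def[abs_def])
    qed (use D_add1 D_scale1 D_bound1[OF _ trig[OF g] g1] trig[OF g] in auto)
  qed
  \<comment> \<open>Now \<open>f\<close> is frozen anywhere in the closure, and \<open>step1\<close>
    is the base case of the induction on \<open>g\<close>.\<close>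
  have step2: "bdd_meas M g \<and> cesaro_null (D f g)" if f: "S.trig_closure f" and g: "S.trig_closure g" for f g
  proof -
    obtain u where "u \<in> S" using S.U_nonempty by blast
    then have fb: "bdd_meas M f" using step1[OF _ f] by blast
    then obtain K where K: "\<And>x. cmod (f x) \<le> K" by (auto simp: bdd_meas_def)
    show ?thesis
    proof (rule cesaro_bounded_closure[OF g, where D = "\<lambda>n g. D f g n" and C = "2 * K"])
      show "bdd_meas M g \<and> cesaro_null (D f g)" if "g \<in> S.trig" for g
        using step1[OF that f] trig[OF that] by simp
    qed (use D_add2[OF fb] D_scale2 D_bound2[OF fb _ K] in auto)
  qed
  have "cesaro_null (D (indicator A) (indicator B))"
    using step2 S.trig_closure_indicator AB S_sets by blast
  moreover have "D (indicator A) (indicator B) n =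
     of_real (measure M {x \<in> space M. (T ^^ n) x \<in> A \<and> x \<in> B} - measure M A * measure M B)" for n
  proof -
    have ind: "(\<integral>x. indicator E x \<partial>M) = complex_of_real (measure M E)" if "E \<in> sets M" for E
    proof -
      have "(\<integral>x. indicator E x \<partial>M) = (\<integral>x. complex_of_real (indicator E x) \<partial>M)" by (simp add: of_real_indicator)
      also have "\<dots> = complex_of_real (measure M (E \<inter> space M))" by simp
      finally show ?thesis using that by (simp add: sets.Int_space_eq2)
    qed
    have E: "{x \<in> space M. (T ^^ n) x \<in> A \<and> x \<in> B} \<in> sets M" using AB by measurable
    have "(\<integral>x. indicator A ((T ^^ n) x) * indicator B x \<partial>M) =
        (\<integral>x. indicator {x \<in> space M. (T ^^ n) x \<in> A \<and> x \<in> B} x \<partial>M :: complex)"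
      by (intro Bochner_Integration.integral_cong) (auto simp: indicator_def)
    then show ?thesis using ind[OF E] ind AB by (simp add: D_def)
  qed
  ultimately show ?thesis by (simp add: cesaro_null_def del: of_real_diff of_real_mult)
qed

section \<open>Sequences of independent Gaussian variables\<close>

abbreviation gauss_seq :: "(nat \<Rightarrow> complex) measure" where
  "gauss_seq \<equiv> PiM UNIV (\<lambda>_. cgauss 1)"

interpretation gseq: sequence_space "cgauss 1"
proof -
  interpret prob_space "cgauss 1" by (rule prob_space_cgauss) simp
  show "sequence_space (cgauss 1)" by unfold_locales
qed

lemma space_gauss_seq[simp]: "space gauss_seq = UNIV"
  by (simp add: space_PiM)

lemma measurable_gauss_component[measurable]: "(\<lambda>\<omega>. \<omega> k) \<in> borel_measurable gauss_seq"
  by (subst measurable_cong_sets[OF refl sets_cgauss[of 1, symmetric]]) (rule measurable_component_singleton, simp)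

lemma borel_measurable_cgauss[simp]: "borel_measurable (cgauss s) = borel_measurable borel"
  by (rule measurable_cong_sets) auto

lemma cis_sum: "cis (\<Sum>i\<in>I. f i) = (\<Prod>i\<in>I. cis (f i))"
  by (induction I rule: infinite_finite_induct) (auto simp: cis_mult[symmetric])

lemma borel_measurable_cis[measurable]: "cis \<in> borel_measurable borel"
  by (intro borel_measurable_continuous_onI continuous_intros)

text \<open>Only \<open>K\<close> coordinates occur, so the integral lives on a finite product and
  factors.\<close>

lemma char_gauss_seq:
  "(\<integral>\<omega>. cis (Re (\<Sum>k<K. z k * \<omega> k)) \<partial>gauss_seq) = complex_of_real (exp (- (\<Sum>k<K. (cmod (z k))\<^sup>2) / 4))"
proof -
  let ?M = "\<lambda>_::nat. cgauss 1"
  have "(\<integral>\<omega>. cis (Re (\<Sum>k<K. z k * \<omega> k)) \<partial>gauss_seq)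
    = (\<integral>\<omega>. (\<Prod>k<K. cis (Re (z k * (restrict \<omega> {..<K}) k))) \<partial>gauss_seq)"
    by (intro Bochner_Integration.integral_cong) (simp_all only: Re_sum cis_sum, simp)
  also have "\<dots> = (\<integral>\<omega>. (\<Prod>k<K. cis (Re (z k * \<omega> k))) \<partial>distr gauss_seq (PiM {..<K} ?M) (\<lambda>\<omega>. restrict \<omega> {..<K}))"
  proof (subst integral_distr)
    show "(\<lambda>\<omega>. restrict \<omega> {..<K}) \<in> gauss_seq \<rightarrow>\<^sub>M PiM {..<K} ?M"
      by (rule measurable_restrict_subset) simp
    have "(\<lambda>\<omega>. \<omega> k) \<in> borel_measurable (PiM {..<K} ?M)" if "k < K" for k
      by (subst measurable_cong_sets[OF refl sets_cgauss[of 1, symmetric]])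
        (rule measurable_component_singleton, use that in simp)
    then show "(\<lambda>\<omega>. \<Prod>k<K. cis (Re (z k * \<omega> k))) \<in> borel_measurable (PiM {..<K} ?M)"
      by (intro borel_measurable_prod measurable_compose[OF _ borel_measurable_cis]
          measurable_compose[OF _ borel_measurable_Re] borel_measurable_times) auto
  qed simp
  also have "distr gauss_seq (PiM {..<K} ?M) (\<lambda>\<omega>. restrict \<omega> {..<K}) = PiM {..<K} ?M"
    by (rule gseq.distr_PiM_restrict_finite) auto
  also have "(\<integral>\<omega>. (\<Prod>k<K. cis (Re (z k * \<omega> k))) \<partial>PiM {..<K} ?M)
      = (\<Prod>k<K. \<integral>w. cis (Re (z k * w)) \<partial>cgauss 1)"
  proof (rule gseq.product_integral_prod)
    show "integrable (cgauss 1) (\<lambda>w. cis (Re (z k * w)))" for k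
    proof (rule gseq.M.integrable_const_bound[of _ 1])
      have "(\<lambda>w. cis (Re (z k * w))) \<in> borel_measurable borel" by measurable
      then show "(\<lambda>w. cis (Re (z k * w))) \<in> borel_measurable (cgauss 1)" by simp
    qed simp
  qed simp
  also have "\<dots> = complex_of_real (\<Prod>k<K. exp (- (cmod (z k))\<^sup>2 / 4))"
    unfolding of_real_prod by (intro prod.cong refl, subst char_cgauss) simp_all
  also have "(\<Prod>k<K. exp (- (cmod (z k))\<^sup>2 / 4)) = exp (\<Sum>k<K. - (cmod (z k))\<^sup>2 / 4)"
    by (rule exp_sum[symmetric]) simp
  finally show ?thesis by (simp add: sum_negf sum_divide_distrib)
qed

text \<open>In \<open>ennreal\<close> the series always has a value, which makes measurability
  immediate. The weights match the bound \<open>norm (e k) \<le> (1/2)^k\<close> for the vectors of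
  the later random series.\<close>

definition good :: "(nat \<Rightarrow> complex) \<Rightarrow> bool" where
  "good \<omega> \<longleftrightarrow> (\<Sum>k. ennreal (cmod (\<omega> k) * (1/2)^k)) < \<infinity>"

lemma good_summable: "good \<omega> \<longleftrightarrow> summable (\<lambda>k. cmod (\<omega> k) * (1/2)^k)"
proof
  show "good \<omega> \<Longrightarrow> summable (\<lambda>k. cmod (\<omega> k) * (1/2)^k)"
    unfolding good_def by (intro summable_suminf_not_top) auto
  show "summable (\<lambda>k. cmod (\<omega> k) * (1/2)^k) \<Longrightarrow> good \<omega>"
    unfolding good_def by (subst suminf_ennreal2) auto
qed

lemma measurable_good[measurable]: "Measurable.pred gauss_seq good"
  unfolding good_def[abs_def] by measurable

text \<open>The expectation of the weighted series is finite: a modulus is at most one plus its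
  square, so each mean modulus is at most 2.\<close>

lemma AE_good: "AE \<omega> in gauss_seq. good \<omega>"
proof -
  have comp: "(\<integral>\<^sup>+\<omega>. ennreal (cmod (\<omega> k)) \<partial>gauss_seq) \<le> 2" for k :: nat
  proof -
    have "(\<integral>\<^sup>+\<omega>. ennreal (cmod (\<omega> k)) \<partial>gauss_seq) = (\<integral>\<^sup>+w. ennreal (cmod w) \<partial>distr gauss_seq (cgauss 1) (\<lambda>\<omega>. \<omega> k))"
      by (subst nn_integral_distr) auto
    also have "distr gauss_seq (cgauss 1) (\<lambda>\<omega>. \<omega> k) = cgauss 1" by (rule gseq.PiM_component) simp
    also have "(\<integral>\<^sup>+w. ennreal (cmod w) \<partial>cgauss 1) \<le> (\<integral>\<^sup>+w. 1 + ennreal ((cmod w)\<^sup>2) \<partial>cgauss 1)"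
    proof (rule nn_integral_mono)
      fix w :: complex
      have "2 * cmod w \<le> 1 + (cmod w)\<^sup>2" using sum_squares_bound[of 1 "cmod w"] by simp
      then have "cmod w \<le> 1 + (cmod w)\<^sup>2" using norm_ge_zero[of w] by linarith
      then show "ennreal (cmod w) \<le> 1 + ennreal ((cmod w)\<^sup>2)"
        by (metis ennreal_1 ennreal_leI ennreal_plus zero_le_one zero_le_power2)
    qed
    also have "\<dots> = 1 + 1"
      using nn_integral_sq_cgauss[of 1] gseq.M.emeasure_space_1 by (subst nn_integral_add) auto
    finally show ?thesis by simp
  qed
  have "(\<integral>\<^sup>+\<omega>. (\<Sum>k. ennreal (cmod (\<omega> k) * (1/2)^k)) \<partial>gauss_seq)
      = (\<Sum>k. \<integral>\<^sup>+\<omega>. ennreal (cmod (\<omega> k) * (1/2)^k) \<partial>gauss_seq)"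
    by (rule nn_integral_suminf) measurable
  also have "\<dots> \<le> (\<Sum>k. ennreal (2 * (1/2)^k))"
  proof (rule suminf_le)
    fix k
    have "(\<integral>\<^sup>+\<omega>. ennreal (cmod (\<omega> k) * (1/2)^k) \<partial>gauss_seq)
      = (\<integral>\<^sup>+\<omega>. ennreal (cmod (\<omega> k)) \<partial>gauss_seq) * ennreal ((1/2)^k)"
      by (simp add: ennreal_mult nn_integral_multc)
    also have "\<dots> \<le> ennreal 2 * ennreal ((1/2)^k)" by (intro mult_right_mono) (use comp[of k] in auto)
    also have "\<dots> = ennreal (2 * (1/2)^k)" by (rule ennreal_mult[symmetric]) auto
    finally show "(\<integral>\<^sup>+\<omega>. ennreal (cmod (\<omega> k) * (1/2)^k) \<partial>gauss_seq) \<le> ennreal (2 * (1/2)^k)" .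
  qed auto
  also have "\<dots> < \<infinity>"
    by (subst suminf_ennreal2) (auto intro: summable_mult)
  finally have "AE \<omega> in gauss_seq. (\<Sum>k. ennreal (cmod (\<omega> k) * (1/2)^k)) \<noteq> \<infinity>"
    by (intro nn_integral_noteq_infinite) auto
  then show ?thesis by (simp add: good_def less_top)
qed

lemma prod_ge_one_minus_sum:
  fixes f :: "'a \<Rightarrow> real"
  assumes "\<And>i. i \<in> I \<Longrightarrow> 0 \<le> f i" "\<And>i. i \<in> I \<Longrightarrow> f i \<le> 1"
  shows "1 - (\<Sum>i\<in>I. f i) \<le> (\<Prod>i\<in>I. 1 - f i)"
  using assms
proof (induction I rule: infinite_finite_induct)
  case (insert i I)
  have p: "0 \<le> (\<Prod>i\<in>I. 1 - f i)" "(\<Prod>i\<in>I. 1 - f i) \<le> 1"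
    using insert by (auto intro!: prod_nonneg prod_le_1)
  have IH: "1 - (\<Sum>i\<in>I. f i) \<le> (\<Prod>i\<in>I. 1 - f i)" using insert by simp
  have "f i * (\<Prod>i\<in>I. 1 - f i) \<le> f i * 1" using insert p by (intro mult_left_mono) auto
  then show ?case using insert IH by (simp add: left_diff_distrib)
qed auto

text \<open>The tolerance at the coordinate \<open>k\<close> grows fast enough for the exceptional probabilities to be
  summable, and slowly enough for the weighted sum to be small.\<close>

lemma gauss_seq_small_ball:
  assumes "\<epsilon> > 0" and b: "\<And>k. k \<ge> K \<Longrightarrow> b k = 0"
  shows "\<exists>E\<in>sets gauss_seq. measure gauss_seq E > 0 \<and>
    (\<forall>\<omega>\<in>E. good \<omega> \<and> summable (\<lambda>k. cmod (\<omega> k - b k) * (1/2)^k) \<and> (\<Sum>k. cmod (\<omega> k - b k) * (1/2)^k) < \<epsilon>)"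
proof -
  \<comment> \<open>The divisor \<open>8\<close> gives slack: \<open>\<epsilon> / 8\<close> times
    \<open>4\<close>, the sum of \<open>(3/4)^k\<close>, is below \<open>\<epsilon>\<close>.\<close>
  define \<delta> where "\<delta> k = \<epsilon> / 8 * (3/2)^k" for k :: nat
  have \<delta>: "\<delta> k > 0" for k using assms(1) by (simp add: \<delta>_def)
  define \<eta> where "\<eta> k = 1 / (\<delta> k)\<^sup>2" for k
  have \<eta>_eq: "\<eta> k = 64 / \<epsilon>\<^sup>2 * (4/9)^k" for k
    by (simp add: \<eta>_def \<delta>_def power_mult_distrib power_divide power2_eq_square)
      (simp add: power_mult_distrib[symmetric] field_simps)
  have "summable \<eta>" unfolding \<eta>_eq[abs_def] by (intro summable_mult summable_geometric) simp
  then obtain K' where K': "\<And>n. n \<ge> K' \<Longrightarrow> norm (\<Sum>i. \<eta> (i + n)) < 1/2"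
    using suminf_exist_split[of "1/2" \<eta>] by auto
  \<comment> \<open>From \<open>K\<close> on the centre is \<open>0\<close>, where Chebyshev
    applies; from \<open>K'\<close> on the exceptional probabilities sum to less than 1/2. For the
    finitely many coordinates below \<open>L\<close>, positivity of each ball suffices.\<close>
  define L where "L = max K K'"
  define S where "S k = ball (b k) (\<delta> k)" for k
  define p where "p k = measure (cgauss 1) (S k)" for k
  have p: "p k > 0" "p k \<le> 1" for k
    unfolding p_def S_def by (auto intro: cgauss_ball_pos \<delta>)
  have p_tail: "1 - \<eta> k \<le> p k" if "k \<ge> L" for k
  proof -
    have "b k = 0" using b that by (simp add: L_def)
    then have "S k = space (cgauss 1) - {z. cmod z \<ge> \<delta> k}" by (auto simp: S_def not_le)
    then have "p k = 1 - measure (cgauss 1) {z. cmod z \<ge> \<delta> k}"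
      unfolding p_def by (simp only:, subst gseq.M.prob_compl) auto
    then show ?thesis using cgauss_tail[of 1 "\<delta> k"] \<delta>[of k] by (simp add: \<eta>_def)
  qed
  define E where "E = Pi UNIV S"
  have ES: "S k \<in> sets (cgauss 1)" for k by (simp add: S_def)
  have E: "E \<in> sets gauss_seq" unfolding E_def by (rule gseq.infprod_in_sets[OF ES])
  have tail_prod: "1/2 \<le> (\<Prod>k\<in>{L..n}. p k)" for n
  proof -
    have "(\<Sum>k\<in>{L..n}. 1 - p k) \<le> (\<Sum>k\<in>{L..n}. \<eta> k)"
      using p_tail by (intro sum_mono) (auto simp: algebra_simps)
    also have "\<dots> \<le> (\<Sum>i<Suc n - L. \<eta> (i + L))"
      by (rule eq_refl, rule sum.reindex_bij_witness[of _ "\<lambda>i. i + L" "\<lambda>i. i - L"]) auto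
    also have "\<dots> \<le> (\<Sum>i. \<eta> (i + L))"
    proof (intro sum_le_suminf summable_ignore_initial_segment \<open>summable \<eta>\<close>)
      show "0 \<le> \<eta> (i + L)" for i by (simp add: \<eta>_def)
    qed simp
    also have "\<dots> < 1/2" using K'[of L] by (auto simp: L_def)
    finally have "(\<Sum>k\<in>{L..n}. 1 - p k) < 1/2" .
    moreover have "1 - (\<Sum>k\<in>{L..n}. 1 - p k) \<le> (\<Prod>k\<in>{L..n}. 1 - (1 - p k))"
      by (rule prod_ge_one_minus_sum) (use p in \<open>auto simp: less_imp_le\<close>)
    ultimately show ?thesis by simp
  qed
  have "(\<Prod>k<L. p k) * (1/2) \<le> measure gauss_seq E"
  proof (rule LIMSEQ_le_const)
    show "(\<lambda>n. \<Prod>k\<le>n. measure (cgauss 1) (S k)) \<longlonglongrightarrow> measure gauss_seq E"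
      unfolding E_def by (rule gseq.measure_PiM_countable[OF ES])
    show "\<exists>N. \<forall>n\<ge>N. (\<Prod>k<L. p k) * (1/2) \<le> (\<Prod>k\<le>n. measure (cgauss 1) (S k))"
    proof (intro exI[of _ L] allI impI)
      fix n assume "n \<ge> L"
      then have "{..n} = {..<L} \<union> {L..n}" by auto
      then have "(\<Prod>k\<le>n. p k) = (\<Prod>k<L. p k) * (\<Prod>k\<in>{L..n}. p k)"
        by (simp add: prod.union_disjoint[of "{..<L}" "{L..n}"] ivl_disj_int)
      moreover have "(\<Prod>k<L. p k) * (1/2) \<le> (\<Prod>k<L. p k) * (\<Prod>k\<in>{L..n}. p k)"
        using p by (intro mult_left_mono tail_prod prod_nonneg) (auto simp: less_imp_le)
      ultimately show "(\<Prod>k<L. p k) * (1/2) \<le> (\<Prod>k\<le>n. measure (cgauss 1) (S k))"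
        unfolding p_def by simp
    qed
  qed
  moreover have "0 < (\<Prod>k<L. p k) * (1/2)" using p by (simp add: prod_pos)
  ultimately have pos: "measure gauss_seq E > 0" by linarith
  have close: "good \<omega> \<and> summable (\<lambda>k. cmod (\<omega> k - b k) * (1/2)^k) \<and> (\<Sum>k. cmod (\<omega> k - b k) * (1/2)^k) < \<epsilon>"
    if \<omega>: "\<omega> \<in> E" for \<omega>
  proof -
    have le: "cmod (\<omega> k - b k) * (1/2)^k \<le> \<epsilon> / 8 * (3/4)^k" for k
    proof -
      have "cmod (\<omega> k - b k) \<le> \<delta> k" 
      proof -
        have "\<omega> k \<in> S k" using \<omega> unfolding E_def by blast
        then show ?thesis by (simp add: S_def dist_norm norm_minus_commute)
      qed
      then have "cmod (\<omega> k - b k) * (1/2)^k \<le> \<epsilon> / 8 * (3/2)^k * (1/2)^k" unfolding \<delta>_def by (intro mult_right_mono) auto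
      also have "\<dots> = \<epsilon> / 8 * (3/4)^k" by (simp add: power_mult_distrib[symmetric])
      finally show ?thesis .
    qed
    have sm: "summable (\<lambda>k. \<epsilon> / 8 * (3/4::real)^k)" by (intro summable_mult summable_geometric) simp
    have 1: "summable (\<lambda>k. cmod (\<omega> k - b k) * (1/2)^k)"
      by (rule summable_comparison_test[OF _ sm]) (use le in \<open>auto intro!: exI[of _ 0]\<close>)
    have "(\<Sum>k. cmod (\<omega> k - b k) * (1/2)^k) \<le> (\<Sum>k. \<epsilon> / 8 * (3/4)^k)"
      by (intro suminf_le le 1 sm)
    also have "\<dots> = \<epsilon> / 8 * 4" by (subst suminf_mult) (auto simp: suminf_geometric summable_geometric)
    finally have 2: "(\<Sum>k. cmod (\<omega> k - b k) * (1/2)^k) < \<epsilon>" using assms(1) by simp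
    have "summable (\<lambda>k. cmod (\<omega> k) * (1/2)^k)"
    proof (rule summable_cong[THEN iffD1, OF _ 1], rule eventually_sequentiallyI[of K])
      fix k assume "K \<le> k"
      then show "cmod (\<omega> k - b k) * (1/2)^k = cmod (\<omega> k) * (1/2)^k" by (simp add: b)
    qed
    then show ?thesis using 1 2 by (simp add: good_summable)
  qed
  show ?thesis by (rule bexI[OF _ E]) (use pos close in simp)
qed

section \<open>The linear system of a stationary kernel\<close>

text \<open>Used to bound the difference of two characteristic functions by the covariance that
  separates their exponents.\<close>

lemma abs_exp_minus_diff_le:
  fixes x y :: real
  assumes "0 \<le> x" "0 \<le> y"
  shows "\<bar>exp (- x) - exp (- y)\<bar> \<le> \<bar>x - y\<bar>"
proof -
  have *: "exp (- x) - exp (- y) \<le> y - x" if "0 \<le> x" "x \<le> y" for x y :: real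
  proof -
    have "exp (- x) - exp (- y) = exp (- x) * (1 - exp (x - y))" by (simp add: algebra_simps exp_add[symmetric])
    also have "\<dots> \<le> 1 * (y - x)"
    proof (rule mult_mono)
      show "1 - exp (x - y) \<le> y - x" using exp_ge_add_one_self[of "x - y"] by linarith
    qed (use that in auto)
    finally show ?thesis by simp
  qed
  show ?thesis using *[of x y] *[of y x] assms by (cases "x \<le> y") auto
qed

lemma cesaro_null_zero: "cesaro_null (\<lambda>n. 0)"
  by (simp add: cesaro_null_def)

lemma cesaro_null_sum:
  "(\<And>i. i \<in> I \<Longrightarrow> cesaro_null (D i)) \<Longrightarrow> cesaro_null (\<lambda>n. \<Sum>i\<in>I. D i n)"
proof (induction I rule: infinite_finite_induct)
  case (insert i I)
  then show ?case using cesaro_null_add[of "D i" "\<lambda>n. \<Sum>i\<in>I. D i n"] by simp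
qed (simp_all add: cesaro_null_zero)

lemma continuous_on_coord: "continuous_on S (\<lambda>x :: linf. apply_bcontfun x j)"
proof -
  have "cmod (apply_bcontfun x j - apply_bcontfun y j) \<le> dist x y" for x y :: linf
    using norm_bounded[of "x - y" j] by (simp add: dist_norm)
  then show ?thesis
    by (intro lipschitz_on_continuous_on[of 1] lipschitz_onI) (auto simp: dist_norm)
qed

lemma measurable_id_coord_sigma: "(\<lambda>x. x) \<in> borel \<rightarrow>\<^sub>M coord_sigma"
  by (rule measurable_coord_sigmaI) (rule borel_measurable_continuous_onI[OF continuous_on_coord])

text \<open>\<open>c\<close> is a Cholesky factor of the covariance \<open>R\<close>.
  \<open>R_shift\<close> yields invariance, \<open>R_cesaro\<close> weak mixing, and the orthonormal
  indices \<open>s\<close> of \<open>R_orth\<close> infinite dimension.\<close>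

locale gauss_shift =
  fixes c :: "nat \<Rightarrow> nat \<Rightarrow> complex" and q :: nat and R :: "nat \<Rightarrow> nat \<Rightarrow> complex" and s :: "nat \<Rightarrow> nat"
  assumes c_lower: "n < k \<Longrightarrow> c n k = 0"
    and R_eq: "R n m = (\<Sum>k\<le>n. c n k * cnj (c m k))"
    and R_diag: "R n n = 1"
    and R_shift: "R (n + q) (m + q) = R n m"
    and R_cesaro: "(\<lambda>N. (\<Sum>t<N. cmod (R (i + q * t) j)) / real N) \<longlonglongrightarrow> 0"
    and R_orth: "R (s l) (s l') = of_bool (l = l')"
begin

lemma R_eq_lessThan: "n < K \<Longrightarrow> (\<Sum>k<K. c n k * cnj (c m k)) = R n m"
  unfolding R_eq by (rule sum.mono_neutral_right) (auto simp: c_lower not_le)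

lemma R_shift_mult: "R (n + q * t) (m + q * t) = R n m"
proof (induction t)
  case (Suc t)
  then show ?case using R_shift[of "n + q * t" "m + q * t"] by (simp add: ac_simps)
qed simp

text \<open>Unit variance says that the squared moduli in each row of \<open>c\<close> sum to
  1.\<close>

lemma norm_c_le: "cmod (c n k) \<le> 1"
proof (cases "k \<le> n")
  case True
  have "complex_of_real (\<Sum>k\<le>n. (cmod (c n k))\<^sup>2) = 1"
    using R_diag[of n] unfolding R_eq of_real_sum complex_norm_square .
  then have "(\<Sum>k\<le>n. (cmod (c n k))\<^sup>2) = 1" using of_real_eq_1_iff by blast
  moreover have "(cmod (c n k))\<^sup>2 \<le> (\<Sum>k\<le>n. (cmod (c n k))\<^sup>2)"
    using True by (intro member_le_sum) auto
  ultimately show ?thesis by (simp add: power2_le_iff_abs_le abs_le_square_iff[symmetric] power_le_one_iff)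
qed (simp add: c_lower)

text \<open>Column \<open>k\<close> of the Cholesky factor in weighted coordinates. Its entries
  start at coordinate \<open>k\<close>, so the weight forces norm at most
  \<open>(1/2)^k\<close>.\<close>

definition e :: "nat \<Rightarrow> linf" where "e k = Bcontfun (\<lambda>n. c n k / 2 ^ n)"

lemma norm_e_coord: "cmod (c n k / 2 ^ n) \<le> (1/2)^k"
proof (cases "n < k")
  case False
  have "cmod (c n k / 2 ^ n) \<le> 1 / 2 ^ n"
    by (simp add: norm_divide norm_power divide_right_mono norm_c_le)
  also have "\<dots> \<le> (1/2)^k" using False by (simp add: power_one_over[symmetric] power_decreasing)
  finally show ?thesis .
qed (simp add: c_lower)

lemma apply_e: "apply_bcontfun (e k) n = c n k / 2 ^ n"
  unfolding e_def by (rule apply_Bcontfun[OF norm_e_coord])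

lemma norm_e: "norm (e k) \<le> (1/2)^k"
  by (rule norm_bound) (simp only: apply_e norm_e_coord)

section \<open>The separable Banach space spanned by the columns\<close>

definition comb :: "(nat \<Rightarrow> complex) \<Rightarrow> nat \<Rightarrow> linf" where
  "comb b K = (\<Sum>k<K. cscale (b k) (e k))"

lemma apply_comb: "apply_bcontfun (comb b K) n = (\<Sum>k<K. b k * c n k) / 2 ^ n"
  by (simp add: comb_def apply_sum apply_e sum_divide_distrib)

lemma comb_extend: "J \<le> K \<Longrightarrow> comb b J = comb (\<lambda>k. if k < J then b k else 0) K"
  unfolding comb_def by (rule sum.mono_neutral_cong_left) simp_all

lemma comb_add: "\<exists>d L. comb a J + comb b K = comb d L"
proof -
  define a' b' where "a' k = (if k < J then a k else 0)" and "b' k = (if k < K then b k else 0)" for k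
  have "comb a J = comb a' (max J K)" "comb b K = comb b' (max J K)"
    unfolding a'_def b'_def by (intro comb_extend; simp)+
  moreover have "comb a' L + comb b' L = comb (\<lambda>k. a' k + b' k) L" for L
    by (simp add: comb_def sum.distrib cs.scale_left_distrib)
  ultimately show ?thesis by metis
qed

lemma comb_scale: "cscale t (comb a J) = comb (\<lambda>k. t * a k) J"
  unfolding comb_def by (simp add: cs.scale_sum_right)

definition combs :: "linf set" where "combs = {comb b K | b K. True}"

lemma comb_in_combs: "comb b K \<in> combs" by (auto simp: combs_def)

definition V :: "linf set" where "V = closure combs"

lemma closed_V: "closed V" by (simp add: V_def)

lemma combs_subset_V: "combs \<subseteq> V" by (simp add: V_def closure_subset)

lemma comb_in_V: "comb b K \<in> V" using combs_subset_V comb_in_combs by blast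

lemma e_in_V: "e k \<in> V"
proof -
  have "comb (\<lambda>i. of_bool (i = k)) (Suc k) = e k"
    by (rule bcontfun_eqI) (simp add: apply_comb apply_e)
  then show ?thesis using comb_in_V by metis
qed

lemma tendsto_cscale: "(f \<longlongrightarrow> x) F \<Longrightarrow> ((\<lambda>i. cscale t (f i)) \<longlongrightarrow> cscale t x) F"
proof -
  assume f: "(f \<longlongrightarrow> x) F"
  have "((\<lambda>i. cmod t * dist (f i) x) \<longlongrightarrow> cmod t * 0) F"
    by (rule tendsto_mult[OF tendsto_const iffD1[OF tendsto_dist_iff f]])
  moreover have "cmod t * dist (f i) x = dist (cscale t (f i)) (cscale t x)" for i
    by (simp add: dist_norm norm_cscale cs.scale_right_diff_distrib[symmetric])
  ultimately have "((\<lambda>i. dist (cscale t (f i)) (cscale t x)) \<longlongrightarrow> 0) F" by simp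
  then show ?thesis by (rule iffD2[OF tendsto_dist_iff])
qed

lemma complex_subspace_V: "complex_subspace V"
  unfolding complex_subspace_def
proof (intro conjI ballI allI)
  have "comb (\<lambda>_. 0) 0 = 0" by (simp add: comb_def)
  then show "0 \<in> V" using comb_in_V by metis
next
  fix x y assume "x \<in> V" "y \<in> V"
  then obtain f g where f: "\<And>n. f n \<in> combs" "f \<longlonglongrightarrow> x" and g: "\<And>n. g n \<in> combs" "g \<longlonglongrightarrow> y"
    unfolding V_def closure_sequential by blast
  have "f n + g n \<in> combs" for n
  proof -
    obtain a J b K where "f n = comb a J" "g n = comb b K" using f(1)[of n] g(1)[of n] by (auto simp: combs_def)
    then show ?thesis using comb_add[of a J b K] comb_in_combs by auto
  qed
  then show "x + y \<in> V"
    unfolding V_def closure_sequential using tendsto_add[OF f(2) g(2)]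
    by (intro exI[of _ "\<lambda>n. f n + g n"]) simp
next
  fix t x assume "x \<in> V"
  then obtain f where f: "\<And>n. f n \<in> combs" "f \<longlonglongrightarrow> x" unfolding V_def closure_sequential by blast
  have "cscale t (f n) \<in> combs" for n
  proof -
    obtain b K where "f n = comb b K" using f(1)[of n] by (auto simp: combs_def)
    then show ?thesis using comb_scale[of t b K] comb_in_combs by simp
  qed
  then show "cscale t x \<in> V"
    unfolding V_def closure_sequential using tendsto_cscale[OF f(2)]
    by (intro exI[of _ "\<lambda>n. cscale t (f n)"]) simp
qed

lemma separable_V: "\<exists>D. countable D \<and> D \<subseteq> V \<and> V \<subseteq> closure D"
proof -
  obtain Q :: "complex set" where Q: "countable Q" "\<And>S. open S \<Longrightarrow> S \<noteq> {} \<Longrightarrow> \<exists>d\<in>Q. d \<in> S"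
    using countable_dense_exists by blast
  define D where "D = (\<lambda>bs. comb (nth bs) (length bs)) ` lists Q"
  have "combs \<subseteq> closure D"
  proof
    fix x assume "x \<in> combs"
    then obtain b K where x: "x = comb b K" by (auto simp: combs_def)
    show "x \<in> closure D"
      unfolding closure_approachable
    proof (intro allI impI)
      fix r :: real assume r: "r > 0"
      have "\<exists>d\<in>Q. d \<in> ball (b k) (r / (K + 1))" for k
      proof (rule Q)
        have "r / (K + 1) > 0" using r by simp
        then show "ball (b k) (r / (K + 1)) \<noteq> {}" using centre_in_ball by blast
      qed simp
      then obtain b' where b': "\<And>k. b' k \<in> Q" "\<And>k. b' k \<in> ball (b k) (r / (K + 1))" by metis
      define bs where "bs = map b' [0..<K]"
      have bs: "comb (nth bs) (length bs) = comb b' K"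
        unfolding comb_def by (intro sum.cong) (auto simp: bs_def)
      have "comb b K - comb b' K = (\<Sum>k<K. cscale (b k - b' k) (e k))"
        by (simp add: comb_def sum_subtractf cs.scale_left_diff_distrib)
      then have "norm (comb b K - comb b' K) \<le> (\<Sum>k<K. cmod (b k - b' k) * norm (e k))"
        using norm_sum[of "\<lambda>k. cscale (b k - b' k) (e k)" "{..<K}"] by (simp add: norm_cscale)
      also have "\<dots> \<le> (\<Sum>k<K. r / (K + 1) * 1)"
      proof (intro sum_mono mult_mono)
        show "cmod (b k - b' k) \<le> r / (K + 1)" for k using b'(2)[of k] by (simp add: dist_norm)
        show "norm (e k) \<le> 1" for k using norm_e[of k] power_le_one[of "1/2::real" k] by simp
      qed (use r in auto)
      also have "\<dots> < r" using r by (simp add: field_simps)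
      finally have "dist (comb b' K) x < r" by (simp add: x dist_norm norm_minus_commute)
      moreover have "comb b' K \<in> D"
        unfolding D_def bs[symmetric] by (intro imageI) (auto simp: bs_def b')
      ultimately show "\<exists>y\<in>D. dist y x < r" by blast
    qed
  qed
  then have "V \<subseteq> closure D" unfolding V_def by (intro closure_minimal) auto
  moreover have "countable D" using Q by (simp add: D_def)
  moreover have "D \<subseteq> V" using comb_in_V by (auto simp: D_def)
  ultimately show ?thesis by blast
qed

text \<open>The covariance vector of index \<open>n\<close>: the mean of the random vector
  \<open>X\<close> times the conjugate of its unweighted coordinate \<open>n\<close>.\<close>

definition y :: "nat \<Rightarrow> linf" where "y n = comb (\<lambda>k. cnj (c n k)) (Suc n)"

lemma apply_y: "apply_bcontfun (y n) m = cnj (R n m) / 2 ^ m"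
proof -
  have "cnj (R n m) = (\<Sum>k<Suc n. cnj (c n k) * c m k)"
    by (subst R_eq_lessThan[of n "Suc n", symmetric]) (simp_all del: sum.lessThan_Suc)
  then show ?thesis by (simp only: y_def apply_comb)
qed

text \<open>The functionals \<open>x \<mapsto> 2 ^ s l * x (s l)\<close> are dual to the vectors \<open>y (s l)\<close>, which are therefore
  linearly independent.\<close>

lemma infinite_dim_V:
  assumes "finite F" "F \<subseteq> V" shows "\<not> V \<subseteq> cspan F"
proof
  assume sub: "V \<subseteq> cspan F"
  have y_s: "2 ^ s l * apply_bcontfun (y (s l')) (s l) = of_bool (l = l')" for l l'
    by (simp add: apply_y R_orth)
  have inj: "inj (\<lambda>l. y (s l))"
  proof (rule injI)
    fix l l' assume "y (s l) = y (s l')"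
    then show "l = l'" using y_s[of l l] y_s[of l l'] by (simp split: if_splits)
  qed
  let ?S = "(\<lambda>l. y (s l)) ` {..card F}"
  have ind: "\<not> cs.dependent ?S"
    unfolding cs.independent_explicit_module
  proof (intro allI impI)
    fix t u v assume t: "finite t" "t \<subseteq> ?S" and sum: "(\<Sum>v\<in>t. cscale (u v) v) = 0" and v: "v \<in> t"
    from v t obtain l where l: "v = y (s l)" by blast
    have "0 = (\<Sum>w\<in>t. u w * (2 ^ s l * apply_bcontfun w (s l)))"
      using arg_cong[OF sum, of "\<lambda>x. 2 ^ s l * apply_bcontfun x (s l)"]
      by (simp add: apply_sum sum_distrib_left mult_ac)
    also have "\<dots> = (\<Sum>w\<in>t. if w = v then u v else 0)"
    proof (intro sum.cong refl)
      fix w assume "w \<in> t"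
      then obtain l' where l': "w = y (s l')" using t by blast
      have "w = v \<longleftrightarrow> l = l'" unfolding l l' using inj by (metis injD)
      then show "u w * (2 ^ s l * apply_bcontfun w (s l)) = (if w = v then u v else 0)"
        using y_s[of l l'] l l' by (cases "l = l'") auto
    qed
    also have "\<dots> = u v" using t v by simp
    finally show "u v = 0" by simp
  qed
  have "?S \<subseteq> cs.span F"
    using comb_in_V sub cspan_subset_span unfolding y_def by fastforce
  from cs.independent_span_bound[OF assms(1) ind this] have "card ?S \<le> card F" by blast
  moreover have "card ?S = Suc (card F)"
    using inj by (subst card_image) (auto intro: inj_on_subset)
  ultimately show False by simp
qed

lemma sep_inf_banach_V: "sep_inf_banach V"
  unfolding sep_inf_banach_def
  using complex_subspace_V closed_V separable_V infinite_dim_V by blast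

text \<open>By triangularity each coordinate is a finite sum. On sequences that are not
  \<open>good\<close> the value is \<open>0\<close>, so that \<open>X\<close> maps the whole sample
  space into \<open>V\<close>.\<close>

definition X :: "(nat \<Rightarrow> complex) \<Rightarrow> linf" where
  "X \<omega> = (if good \<omega> then Bcontfun (\<lambda>n. (\<Sum>k\<le>n. c n k * \<omega> k) / 2 ^ n) else 0)"

lemma coord_bound:
  assumes "summable (\<lambda>k. cmod (\<omega> k) * (1/2)^k)"
  shows "cmod ((\<Sum>k\<le>n. c n k * \<omega> k) / 2 ^ n) \<le> (\<Sum>k. cmod (\<omega> k) * (1/2)^k)"
proof -
  have "cmod ((\<Sum>k\<le>n. c n k * \<omega> k) / 2 ^ n) = cmod (\<Sum>k\<le>n. c n k / 2 ^ n * \<omega> k)"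
    by (simp add: sum_divide_distrib)
  also have "\<dots> \<le> (\<Sum>k\<le>n. cmod (c n k / 2 ^ n * \<omega> k))" by (rule norm_sum)
  also have "\<dots> \<le> (\<Sum>k\<le>n. cmod (\<omega> k) * (1/2)^k)"
    unfolding norm_mult[of "_ / _"] mult.commute[of "cmod (\<omega> _)"]
    by (intro sum_mono mult_right_mono norm_e_coord) auto
  also have "\<dots> \<le> (\<Sum>k. cmod (\<omega> k) * (1/2)^k)"
    by (intro sum_le_suminf assms) auto
  finally show ?thesis .
qed

lemma apply_X: "good \<omega> \<Longrightarrow> apply_bcontfun (X \<omega>) n = (\<Sum>k\<le>n. c n k * \<omega> k) / 2 ^ n"
  unfolding X_def good_summable by (simp add: apply_Bcontfun[OF coord_bound])

lemma norm_X_minus_comb: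
  assumes "good \<omega>" and b: "\<And>k. k \<ge> K \<Longrightarrow> b k = 0"
    and sm: "summable (\<lambda>k. cmod (\<omega> k - b k) * (1/2)^k)"
  shows "norm (X \<omega> - comb b K) \<le> (\<Sum>k. cmod (\<omega> k - b k) * (1/2)^k)"
proof (rule norm_bound)
  fix n
  have "(\<Sum>k<K. b k * c n k) = (\<Sum>k<K + Suc n. b k * c n k)"
    by (rule sum.mono_neutral_left) (auto simp: b not_less)
  also have "\<dots> = (\<Sum>k\<le>n. c n k * b k)"
    by (rule sum.mono_neutral_cong_right) (auto simp: c_lower not_le)
  finally have "apply_bcontfun (X \<omega> - comb b K) n = (\<Sum>k\<le>n. c n k * (\<omega> k - b k)) / 2 ^ n"
    using apply_X[OF assms(1)] by (simp add: apply_comb right_diff_distrib sum_subtractf diff_divide_distrib)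
  then show "cmod (apply_bcontfun (X \<omega> - comb b K) n) \<le> (\<Sum>k. cmod (\<omega> k - b k) * (1/2)^k)"
    using coord_bound[OF sm, of n] by simp
qed

lemma X_lim: assumes "good \<omega>" shows "(\<lambda>K. comb \<omega> K) \<longlonglongrightarrow> X \<omega>"
proof -
  let ?f = "\<lambda>k. cmod (\<omega> k) * (1/2)^k"
  have f: "summable ?f" using assms good_summable by blast
  have le: "norm (X \<omega> - comb \<omega> K) \<le> suminf ?f - sum ?f {..<K}" for K
  proof -
    define b where "b k = (if k < K then \<omega> k else 0)" for k
    let ?g = "\<lambda>k. if k < K then ?f k else 0"
    have eq: "(\<lambda>k. cmod (\<omega> k - b k) * (1/2)^k) = (\<lambda>k. ?f k - ?g k)" by (auto simp: b_def)
    have g: "?g sums sum ?f {..<K}"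
    proof -
      have "sum ?g {..<K} = sum ?f {..<K}" by (intro sum.cong) auto
      then show ?thesis using sums_finite[of "{..<K}" ?g] by simp
    qed
    have d: "(\<lambda>k. ?f k - ?g k) sums (suminf ?f - sum ?f {..<K})"
      by (intro sums_diff g summable_sums f)
    have "norm (X \<omega> - comb b K) \<le> (\<Sum>k. cmod (\<omega> k - b k) * (1/2)^k)"
      by (rule norm_X_minus_comb[OF assms]) (use d in \<open>auto simp: b_def eq[unfolded b_def] sums_iff\<close>)
    also have "\<dots> = suminf ?f - sum ?f {..<K}" unfolding eq using d by (simp add: sums_iff)
    finally show ?thesis using comb_extend[of K K \<omega>] by (simp add: b_def[abs_def])
  qed
  have "(\<lambda>K. suminf ?f - sum ?f {..<K}) \<longlonglongrightarrow> suminf ?f - suminf ?f"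
    by (intro tendsto_intros summable_LIMSEQ f)
  then have z: "(\<lambda>K. suminf ?f - sum ?f {..<K}) \<longlonglongrightarrow> 0" by simp
  have "(\<lambda>K. X \<omega> - comb \<omega> K) \<longlonglongrightarrow> 0"
    by (rule Lim_null_comparison[OF _ z]) (use le in auto)
  from tendsto_diff[OF tendsto_const this, of "X \<omega>"] show ?thesis by simp
qed

lemma X_in_V: "X \<omega> \<in> V"
proof (cases "good \<omega>")
  case True
  show ?thesis by (rule closed_sequentially[OF closed_V _ X_lim[OF True]]) (rule comb_in_V)
next
  case False
  then show ?thesis using complex_subspace_V by (simp add: X_def complex_subspace_def)
qed

section \<open>Measurability, law and support of the random vector\<close>

lemma measurable_X[measurable]: "X \<in> gauss_seq \<rightarrow>\<^sub>M coord_sigma"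
proof (rule measurable_coord_sigmaI)
  fix j
  have "(\<lambda>\<omega>. apply_bcontfun (X \<omega>) j) = (\<lambda>\<omega>. if good \<omega> then (\<Sum>k\<le>j. c j k * \<omega> k) / 2 ^ j else 0)"
  proof
    fix \<omega>
    show "apply_bcontfun (X \<omega>) j = (if good \<omega> then (\<Sum>k\<le>j. c j k * \<omega> k) / 2 ^ j else 0)"
      by (cases "good \<omega>") (simp_all only: apply_X if_True if_False, simp add: X_def)
  qed
  also have "\<dots> \<in> borel_measurable gauss_seq" by measurable
  finally show "(\<lambda>\<omega>. apply_bcontfun (X \<omega>) j) \<in> borel_measurable gauss_seq" .
qed

lemma borel_coord_V: "(\<lambda>x. x) \<in> borel_measurable (restrict_space coord_sigma V)"
  using separable_V borel_eq_coord_on_separable by blast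

lemma V_coord: "V \<in> sets coord_sigma"
  using separable_V closed_separable_in_coord_sigma closed_V by blast

lemma measurable_X_borel[measurable]: "X \<in> borel_measurable gauss_seq"
proof -
  have "X \<in> gauss_seq \<rightarrow>\<^sub>M restrict_space coord_sigma V"
    by (rule measurable_restrict_space2) (auto simp: X_in_V)
  from measurable_compose[OF this borel_coord_V] show ?thesis .
qed

lemma measurable_X_V[measurable]: "X \<in> gauss_seq \<rightarrow>\<^sub>M restrict_space borel V"
  by (rule measurable_restrict_space2) (auto simp: X_in_V)

text \<open>One law in two guises: \<open>mu\<close> on all of \<open>linf\<close>, where characters
  determine it, and \<open>m\<close> on the Borel sets of \<open>V\<close>, as the system demands.
  \<open>emeasure_m\<close> translates between them.\<close>

definition mu :: "linf measure" where "mu = distr gauss_seq coord_sigma X"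

definition m :: "linf measure" where "m = distr gauss_seq (restrict_space borel V) X"

lemma prob_space_mu: "prob_space mu"
  unfolding mu_def by (rule gseq.P.prob_space_distr) simp

lemma prob_space_m: "prob_space m"
  unfolding m_def by (rule gseq.P.prob_space_distr) simp

lemma sets_mu[simp, measurable_cong]: "sets mu = sets coord_sigma"
  and space_mu[simp]: "space mu = UNIV"
  by (simp_all add: mu_def)

lemma sets_m: "sets m = sets (restrict_space borel V)" and space_m: "space m = V"
  by (simp_all add: m_def space_restrict_space)

lemma coord_in_sets_m: "A \<in> sets coord_sigma \<Longrightarrow> V \<inter> A \<in> sets m"
  using measurable_sets[OF measurable_id_coord_sigma, of A]
  by (auto simp: sets_m sets_restrict_space)

lemma sets_m_coord:
  assumes "A \<in> sets m" shows "\<exists>A'\<in>sets coord_sigma. A = V \<inter> A'"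
proof -
  obtain S where S: "S \<in> sets borel" "A = V \<inter> S" using assms by (auto simp: sets_m sets_restrict_space)
  from measurable_sets[OF borel_coord_V S(1)]
  have "V \<inter> S \<in> sets (restrict_space coord_sigma V)"
    by (simp add: space_restrict_space Int_commute)
  then show ?thesis by (auto simp: S sets_restrict_space)
qed

lemma emeasure_m:
  assumes "A \<in> sets coord_sigma" shows "emeasure m (V \<inter> A) = emeasure mu A"
proof -
  have "emeasure m (V \<inter> A) = emeasure gauss_seq (X -` (V \<inter> A) \<inter> space gauss_seq)"
    unfolding m_def by (rule emeasure_distr) (use coord_in_sets_m[OF assms] in \<open>simp_all add: sets_m\<close>)
  also have "X -` (V \<inter> A) = X -` A" using X_in_V by auto
  finally show ?thesis unfolding mu_def by (subst emeasure_distr) (use assms in auto)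
qed

lemma measure_m: "A \<in> sets coord_sigma \<Longrightarrow> measure m (V \<inter> A) = measure mu A"
  by (simp add: measure_def emeasure_m)

text \<open>Finite combinations are dense in \<open>V\<close>, and with positive probability the
  random coefficients stay near the prescribed ones in the weighted norm that controls
  \<open>X\<close>.\<close>

lemma gauss_seq_ball_pos:
  assumes U: "open U" "U \<inter> V \<noteq> {}"
  shows "measure gauss_seq (X -` U) > 0"
proof -
  obtain z where z: "z \<in> U" "z \<in> V" using U by blast
  obtain r where r: "r > 0" "ball z r \<subseteq> U" using U z by (meson open_contains_ball)
  have "\<exists>x\<in>combs. dist x z < r / 2"
    using z r unfolding V_def closure_approachable by (meson half_gt_zero)
  then obtain b0 K where b0: "dist (comb b0 K) z < r / 2" by (auto simp: combs_def)
  define b where "b k = (if k < K then b0 k else 0)" for k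
  have b: "dist (comb b K) z < r / 2" using b0 comb_extend[of K K b0] by (simp add: b_def[abs_def])
  have "b k = 0" if "k \<ge> K" for k using that by (simp add: b_def)
  from gauss_seq_small_ball[of "r / 2" K b, OF _ this] r obtain E where
    E: "E \<in> sets gauss_seq" "measure gauss_seq E > 0"
      "\<And>\<omega>. \<omega> \<in> E \<Longrightarrow> good \<omega> \<and> summable (\<lambda>k. cmod (\<omega> k - b k) * (1/2)^k) \<and> (\<Sum>k. cmod (\<omega> k - b k) * (1/2)^k) < r / 2"
    by auto
  have "E \<subseteq> X -` U"
  proof
    fix \<omega> assume \<omega>: "\<omega> \<in> E"
    have "norm (X \<omega> - comb b K) < r / 2"
      using norm_X_minus_comb[of \<omega> K b] E(3)[OF \<omega>] by (force simp: b_def)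
    then have "dist (X \<omega>) z < r" using b dist_triangle[of "X \<omega>" z "comb b K"]
      by (simp add: dist_norm)
    then show "\<omega> \<in> X -` U" using r by (auto simp: dist_commute)
  qed
  moreover have "X -` U \<in> sets gauss_seq"
    using measurable_sets[OF measurable_X_borel, of U] U by simp
  ultimately show ?thesis using gseq.P.finite_measure_mono[of E "X -` U"] E by linarith
qed

lemma non_degenerate_m: "non_degenerate V m"
  unfolding non_degenerate_def
proof (intro allI impI)
  fix U :: "linf set" assume U: "open U \<and> U \<inter> V \<noteq> {}"
  have "U \<inter> V \<in> sets (restrict_space borel V)"
    unfolding sets_restrict_space using U by (intro image_eqI[of _ _ U]) auto
  from emeasure_distr[OF measurable_X_V this]
  have "emeasure m (U \<inter> V) = emeasure gauss_seq (X -` (U \<inter> V) \<inter> space gauss_seq)"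
    unfolding m_def .
  also have "X -` (U \<inter> V) \<inter> space gauss_seq = X -` U" using X_in_V by auto
  finally show "0 < emeasure m (U \<inter> V)"
    using gauss_seq_ball_pos U by (simp add: gseq.P.emeasure_eq_measure)
qed

section \<open>Characteristic functions, invariance and mixing\<close>

abbreviation T :: "linf \<Rightarrow> linf" where "T \<equiv> shift_op q"

text \<open>The coefficient of \<open>\<omega> k\<close> when \<open>lin_func a J\<close> is applied
  to the iterate \<open>T ^^ t\<close> of the random vector.\<close>

definition zv :: "(nat \<Rightarrow> complex) \<Rightarrow> nat \<Rightarrow> nat \<Rightarrow> nat \<Rightarrow> complex" where
  "zv a J t k = (\<Sum>j<J. a j / 2 ^ j * c (j + q * t) k)"

text \<open>The covariance of \<open>lin_func a J\<close> at time \<open>t\<close> with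
  \<open>lin_func b J'\<close> at time \<open>0\<close>.\<close>

definition pairing :: "(nat \<Rightarrow> complex) \<Rightarrow> nat \<Rightarrow> (nat \<Rightarrow> complex) \<Rightarrow> nat \<Rightarrow> nat \<Rightarrow> complex" where
  "pairing a J b J' t = (\<Sum>j<J. \<Sum>j'<J'. a j / 2 ^ j * cnj (b j' / 2 ^ j') * R (j + q * t) j')"

lemma lin_func_shift_X:
  assumes "good \<omega>" "J + q * t \<le> K"
  shows "lin_func a J ((T ^^ t) (X \<omega>)) = (\<Sum>k<K. zv a J t k * \<omega> k)"
proof -
  have "(\<Sum>k\<le>j + q * t. c (j + q * t) k * \<omega> k) = (\<Sum>k<K. c (j + q * t) k * \<omega> k)" if "j < J" for j
    using that assms by (intro sum.mono_neutral_left) (auto simp: c_lower not_le)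
  then have "lin_func a J ((T ^^ t) (X \<omega>)) = (\<Sum>j<J. a j / 2 ^ j * (\<Sum>k<K. c (j + q * t) k * \<omega> k))"
    unfolding lin_func_def
    by (intro sum.cong refl) (simp add: apply_shift_op_pow apply_X[OF assms(1)] power_add)
  also have "\<dots> = (\<Sum>k<K. zv a J t k * \<omega> k)"
    unfolding zv_def sum_distrib_left sum_distrib_right mult.assoc by (rule sum.swap)
  finally show ?thesis .
qed

lemma sum_zv:
  assumes "J + q * t \<le> K"
  shows "(\<Sum>k<K. zv a J t k * cnj (zv b J' t' k))
    = (\<Sum>j<J. \<Sum>j'<J'. a j / 2 ^ j * cnj (b j' / 2 ^ j') * R (j + q * t) (j' + q * t'))"
proof -
  have "(\<Sum>k<K. zv a J t k * cnj (zv b J' t' k)) =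
    (\<Sum>k<K. \<Sum>j<J. \<Sum>j'<J'. a j / 2 ^ j * cnj (b j' / 2 ^ j') * (c (j + q * t) k * cnj (c (j' + q * t') k)))"
    unfolding zv_def cnj_sum sum_product by (intro sum.cong refl) (simp add: mult_ac)
  also have "\<dots> = (\<Sum>j<J. \<Sum>j'<J'. \<Sum>k<K. a j / 2 ^ j * cnj (b j' / 2 ^ j') * (c (j + q * t) k * cnj (c (j' + q * t') k)))"
    by (subst sum.swap) (intro sum.cong refl sum.swap)
  also have "\<dots> = (\<Sum>j<J. \<Sum>j'<J'. a j / 2 ^ j * cnj (b j' / 2 ^ j') * R (j + q * t) (j' + q * t'))"
    unfolding sum_distrib_left[symmetric] using assms
    by (intro sum.cong refl arg_cong2[where f = times] R_eq_lessThan) auto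
  finally show ?thesis .
qed

lemma sum_zv_pairing:
  assumes "J + q * t \<le> K"
  shows "(\<Sum>k<K. zv a J t k * cnj (zv b J' 0 k)) = pairing a J b J' t"
  using sum_zv[OF assms, of a b J' 0] by (simp add: pairing_def)

lemma sum_zv_sq:
  assumes "J + q * t \<le> K"
  shows "(\<Sum>k<K. (cmod (zv a J t k))\<^sup>2) = Re (pairing a J a J 0)"
proof -
  have "complex_of_real (\<Sum>k<K. (cmod (zv a J t k))\<^sup>2) = pairing a J a J 0"
    unfolding of_real_sum complex_norm_square sum_zv[OF assms] by (simp add: pairing_def R_shift_mult)
  then show ?thesis by (metis Re_complex_of_real)
qed

text \<open>Stationarity of \<open>R\<close> removes \<open>t\<close> from the variance; comparing
  \<open>t = 1\<close> with \<open>t = 0\<close> gives the invariance of the law.\<close>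

lemma char_mu_shift:
  "(\<integral>x. cis (Re (lin_func a J ((T ^^ t) x))) \<partial>mu) = complex_of_real (exp (- Re (pairing a J a J 0) / 4))"
proof -
  let ?K = "J + q * t"
  have [measurable]: "lin_func a J \<in> borel_measurable coord_sigma" unfolding lin_func_def[abs_def] by measurable
  have "(\<integral>x. cis (Re (lin_func a J ((T ^^ t) x))) \<partial>mu) = (\<integral>\<omega>. cis (Re (lin_func a J ((T ^^ t) (X \<omega>)))) \<partial>gauss_seq)"
    unfolding mu_def by (rule integral_distr) measurable
  also have "\<dots> = (\<integral>\<omega>. cis (Re (\<Sum>k<?K. zv a J t k * \<omega> k)) \<partial>gauss_seq)"
  proof (rule integral_cong_AE)
    show "AE \<omega> in gauss_seq. cis (Re (lin_func a J ((T ^^ t) (X \<omega>)))) = cis (Re (\<Sum>k<?K. zv a J t k * \<omega> k))"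
      using AE_good by eventually_elim (simp add: lin_func_shift_X[where K = ?K])
  qed measurable
  finally show ?thesis by (simp only: char_gauss_seq sum_zv_sq[OF order_refl])
qed

text \<open>The two functionals add up to one linear form in \<open>\<omega>\<close>. Its variance
  is a sum of squares, which also gives the nonnegativity that the Lipschitz bound for the
  exponential requires.\<close>

lemma char_mu_pair:
  "(\<integral>x. cis (Re (lin_func a J ((T ^^ t) x))) * cis (Re (lin_func b J' x)) \<partial>mu)
    = complex_of_real (exp (- (Re (pairing a J a J 0) + Re (pairing b J' b J' 0) + 2 * Re (pairing a J b J' t)) / 4))"
  and pairing_nonneg: "0 \<le> Re (pairing a J a J 0) + Re (pairing b J' b J' 0) + 2 * Re (pairing a J b J' t)"
proof -
  define K where "K = J + q * t + J'"
  have K: "J + q * t \<le> K" "J' + q * 0 \<le> K" by (auto simp: K_def)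
  let ?z = "\<lambda>k. zv a J t k + zv b J' 0 k"
  have sq: "(\<Sum>k<K. (cmod (?z k))\<^sup>2)
    = Re (pairing a J a J 0) + Re (pairing b J' b J' 0) + 2 * Re (pairing a J b J' t)"
  proof -
    have "(cmod (x + y))\<^sup>2 = (cmod x)\<^sup>2 + (cmod y)\<^sup>2 + 2 * Re (x * cnj y)" for x y :: complex
      unfolding cmod_power2 by (simp add: power2_eq_square algebra_simps)
    then have "(\<Sum>k<K. (cmod (?z k))\<^sup>2) = (\<Sum>k<K. (cmod (zv a J t k))\<^sup>2) + (\<Sum>k<K. (cmod (zv b J' 0 k))\<^sup>2)
      + 2 * Re (\<Sum>k<K. zv a J t k * cnj (zv b J' 0 k))"
      by (simp only: sum.distrib Re_sum sum_distrib_left)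
    then show ?thesis unfolding sum_zv_sq[OF K(1)] sum_zv_sq[OF K(2)] sum_zv_pairing[OF K(1)] .
  qed
  show "0 \<le> Re (pairing a J a J 0) + Re (pairing b J' b J' 0) + 2 * Re (pairing a J b J' t)"
    unfolding sq[symmetric] by (intro sum_nonneg) simp
  have [measurable]: "lin_func a J \<in> borel_measurable coord_sigma" for a J unfolding lin_func_def[abs_def] by measurable
  have "(\<integral>x. cis (Re (lin_func a J ((T ^^ t) x))) * cis (Re (lin_func b J' x)) \<partial>mu)
    = (\<integral>\<omega>. cis (Re (lin_func a J ((T ^^ t) (X \<omega>)))) * cis (Re (lin_func b J' (X \<omega>))) \<partial>gauss_seq)"
    unfolding mu_def by (rule integral_distr) measurable
  also have "\<dots> = (\<integral>\<omega>. cis (Re (\<Sum>k<K. ?z k * \<omega> k)) \<partial>gauss_seq)"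
  proof (rule integral_cong_AE)
    show "AE \<omega> in gauss_seq. cis (Re (lin_func a J ((T ^^ t) (X \<omega>)))) * cis (Re (lin_func b J' (X \<omega>)))
      = cis (Re (\<Sum>k<K. ?z k * \<omega> k))"
      using AE_good
    proof eventually_elim
      case (elim \<omega>)
      have 1: "lin_func a J ((T ^^ t) (X \<omega>)) = (\<Sum>k<K. zv a J t k * \<omega> k)" by (rule lin_func_shift_X[OF elim K(1)])
      have 2: "lin_func b J' (X \<omega>) = (\<Sum>k<K. zv b J' 0 k * \<omega> k)" using lin_func_shift_X[OF elim K(2), of b] by simp
      show ?case unfolding 1 2 cis_mult by (simp only: distrib_right sum.distrib plus_complex.sel)
    qed
  qed measurable
  finally show "(\<integral>x. cis (Re (lin_func a J ((T ^^ t) x))) * cis (Re (lin_func b J' x)) \<partial>mu)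
    = complex_of_real (exp (- (Re (pairing a J a J 0) + Re (pairing b J' b J' 0) + 2 * Re (pairing a J b J' t)) / 4))"
    by (simp only: char_gauss_seq sq)
qed

lemma mu_invariant: "distr mu coord_sigma T = mu"
proof (rule linf_chars.char_measure_eqI)
  interpret mu: prob_space mu by (rule prob_space_mu)
  show "finite_measure (distr mu coord_sigma T)" "finite_measure mu"
    using mu.prob_space_distr[of T coord_sigma] mu.finite_measure_axioms by (auto simp: prob_space_def)
  show "sets (distr mu coord_sigma T) = sigma_sets UNIV linf_chars.gen" "sets mu = sigma_sets UNIV linf_chars.gen"
    by (auto simp: sets_coord_sigma)
  fix u :: "linf \<Rightarrow> real" assume "u \<in> linf_chars"
  then obtain a J where u: "u = (\<lambda>x. Re (lin_func a J x))" by blast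
  have [measurable]: "lin_func a J \<in> borel_measurable coord_sigma" unfolding lin_func_def[abs_def] by measurable
  have "(\<integral>x. cis (u x) \<partial>distr mu coord_sigma T) = (\<integral>x. cis (Re (lin_func a J (T x))) \<partial>mu)"
    unfolding u by (rule integral_distr) measurable
  then show "(\<integral>x. cis (u x) \<partial>distr mu coord_sigma T) = (\<integral>x. cis (u x) \<partial>mu)"
    using char_mu_shift[of a J 1] char_mu_shift[of a J 0] by (simp add: u)
qed

lemma cesaro_null_pairing: "cesaro_null (\<lambda>t. pairing a J b J' t)"
  unfolding pairing_def
proof (intro cesaro_null_sum)
  fix j j'
  have "cesaro_null (\<lambda>t. R (j + q * t) j')" using R_cesaro by (simp add: cesaro_null_def)
  then show "cesaro_null (\<lambda>t. a j / 2 ^ j * cnj (b j' / 2 ^ j') * R (j + q * t) j')"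
    by (rule cesaro_null_le[where C = "cmod (a j / 2 ^ j * cnj (b j' / 2 ^ j'))"])
      (simp only: norm_mult order_refl)
qed

text \<open>The joint characteristic function differs from the product only by
  \<open>pairing\<close> in the exponent, so decorrelation of characters reduces to the Cesaro decay
  of covariances.\<close>

lemma mixing_mu:
  assumes "A \<in> sets coord_sigma" "B \<in> sets coord_sigma"
  shows "(\<lambda>N. (\<Sum>n<N. \<bar>measure mu {x. (T ^^ n) x \<in> A \<and> x \<in> B} - measure mu A * measure mu B\<bar>) / real N) \<longlonglongrightarrow> 0"
proof -
  interpret mu: prob_space mu by (rule prob_space_mu)
  have "(\<lambda>N. (\<Sum>n<N. \<bar>measure mu {x \<in> space mu. (T ^^ n) x \<in> A \<and> x \<in> B} - measure mu A * measure mu B\<bar>) / real N) \<longlonglongrightarrow> 0"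
  proof (rule mu.weak_mixing_of_characters[OF linf_chars.additive_functions_axioms])
    show "sets mu = sigma_sets UNIV linf_chars.gen" by (simp add: sets_coord_sigma)
    show "T \<in> mu \<rightarrow>\<^sub>M mu" by measurable
    show "distr mu mu T = mu" using mu_invariant by (simp cong: distr_cong)
    show "A \<in> sets mu" "B \<in> sets mu" using assms by auto
    fix u v assume "u \<in> linf_chars" "v \<in> linf_chars"
    then obtain a J b J' where u: "u = (\<lambda>x. Re (lin_func a J x))" and v: "v = (\<lambda>x. Re (lin_func b J' x))" by blast
    let ?Q = "Re (pairing a J a J 0)" and ?Q' = "Re (pairing b J' b J' 0)"
    have Q: "0 \<le> ?Q" "0 \<le> ?Q'" unfolding sum_zv_sq[of _ 0, OF order_refl, symmetric] by (intro sum_nonneg; simp)+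
    show "cesaro_null (\<lambda>n. (\<integral>x. cis (u ((T ^^ n) x)) * cis (v x) \<partial>mu) - (\<integral>x. cis (u x) \<partial>mu) * (\<integral>x. cis (v x) \<partial>mu))"
    proof (rule cesaro_null_le[OF cesaro_null_pairing[of a J b J'], where C = 1])
      fix n
      let ?B = "pairing a J b J' n"
      have 1: "(\<integral>x. cis (u ((T ^^ n) x)) * cis (v x) \<partial>mu) = complex_of_real (exp (- ((?Q + ?Q' + 2 * Re ?B) / 4)))"
        unfolding u v char_mu_pair minus_divide_left ..
      have 2: "(\<integral>x. cis (u x) \<partial>mu) * (\<integral>x. cis (v x) \<partial>mu) = complex_of_real (exp (- ((?Q + ?Q') / 4)))"
      proof -
        have "- ?Q / 4 + - ?Q' / 4 = - ((?Q + ?Q') / 4)" by (simp add: add_divide_distrib)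
        then show ?thesis
          using char_mu_shift[of a J 0] char_mu_shift[of b J' 0]
          by (simp only: u v funpow_0 of_real_mult[symmetric] exp_add[symmetric])
      qed
      have "(\<integral>x. cis (u ((T ^^ n) x)) * cis (v x) \<partial>mu) - (\<integral>x. cis (u x) \<partial>mu) * (\<integral>x. cis (v x) \<partial>mu)
        = complex_of_real (exp (- ((?Q + ?Q' + 2 * Re ?B) / 4)) - exp (- ((?Q + ?Q') / 4)))"
        unfolding 1 2 of_real_diff ..
      then have "cmod ((\<integral>x. cis (u ((T ^^ n) x)) * cis (v x) \<partial>mu) - (\<integral>x. cis (u x) \<partial>mu) * (\<integral>x. cis (v x) \<partial>mu))
        = \<bar>exp (- ((?Q + ?Q' + 2 * Re ?B) / 4)) - exp (- ((?Q + ?Q') / 4))\<bar>"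
        by (simp only: norm_of_real)
      also have "\<dots> \<le> \<bar>(?Q + ?Q' + 2 * Re ?B) / 4 - (?Q + ?Q') / 4\<bar>"
        using pairing_nonneg[of a J b J' n] Q by (intro abs_exp_minus_diff_le) auto
      also have "\<dots> = \<bar>Re ?B\<bar> / 2" by (simp add: add_divide_distrib)
      also have "\<dots> \<le> 1 * cmod ?B" using abs_Re_le_cmod[of ?B] by simp
      finally show "cmod ((\<integral>x. cis (u ((T ^^ n) x)) * cis (v x) \<partial>mu) - (\<integral>x. cis (u x) \<partial>mu) * (\<integral>x. cis (v x) \<partial>mu))
        \<le> 1 * cmod ?B" .
    qed
  qed
  then show ?thesis by simp
qed

text \<open>If \<open>T x\<close> left the closed \<open>V\<close>, so would the images of a whole
  ball around \<open>x\<close>. That ball has positive probability, yet by invariance the preimage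
  of \<open>V\<close> under \<open>T\<close> has full measure.\<close>

lemma T_V: "x \<in> V \<Longrightarrow> T x \<in> V"
proof (rule ccontr)
  assume x: "x \<in> V" and nx: "T x \<notin> V"
  have "open (- V)" using closed_V by (simp add: open_Compl)
  then obtain r where r: "r > 0" "ball (T x) r \<subseteq> - V" using nx by (meson ComplI open_contains_ball)
  \<comment> \<open>\<open>2 ^ q\<close> bounds the norm of \<open>T\<close>, so radius
    \<open>d\<close> is mapped inside radius \<open>r\<close>.\<close>
  define d where "d = r / 2 ^ q"
  have d: "d > 0" using r by (simp add: d_def)
  have out: "T z \<notin> V" if "z \<in> ball x d" for z
  proof -
    have "norm (T x - T z) \<le> 2 ^ q * norm (x - z)" using norm_shift_op[of q "x - z"] by (simp add: shift_op_diff)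
    also have "\<dots> < 2 ^ q * d" using that by (simp add: dist_norm)
    finally have "T z \<in> ball (T x) r" by (simp add: dist_norm d_def)
    then show ?thesis using r by blast
  qed
  have "0 < measure gauss_seq (X -` ball x d)"
  proof (rule gauss_seq_ball_pos[OF open_ball])
    have "x \<in> ball x d \<inter> V" using x d by simp
    then show "ball x d \<inter> V \<noteq> {}" by blast
  qed
  interpret mu: prob_space mu by (rule prob_space_mu)
  have V1: "measure mu V = 1"
    unfolding mu_def using V_coord gseq.P.prob_space X_in_V
    by (subst measure_distr) (auto simp: vimage_def)
  have TV: "T -` V \<in> sets coord_sigma" using measurable_sets[OF measurable_shift_op V_coord] by simp
  have "measure mu (T -` V) = measure (distr mu coord_sigma T) V"
    by (subst measure_distr) (use V_coord in auto)
  then have "measure mu (T -` V) = 1" using V1 by (simp add: mu_invariant)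
  then have 1: "measure gauss_seq (X -` (T -` V)) = 1"
    unfolding mu_def using TV by (subst (asm) measure_distr) auto
  have s: "X -` ball x d \<in> sets gauss_seq" "X -` (T -` V) \<in> sets gauss_seq"
    using measurable_sets[OF measurable_X_borel, of "ball x d"] measurable_sets[OF measurable_X TV] by auto
  have "X -` ball x d \<inter> X -` (T -` V) = {}" using out by auto
  from gseq.P.finite_measure_Union[OF s this] 1
  have "measure gauss_seq (X -` ball x d \<union> X -` (T -` V)) = measure gauss_seq (X -` ball x d) + 1" by simp
  with gseq.P.prob_le_1[of "X -` ball x d \<union> X -` (T -` V)"] \<open>0 < measure gauss_seq (X -` ball x d)\<close>
  show False by linarith
qed

lemma T_pow_V: "x \<in> V \<Longrightarrow> (T ^^ n) x \<in> V"
  by (induction n) (auto intro: T_V)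

lemma bounded_op_T: "bounded_op V T"
  unfolding bounded_op_def using T_V shift_op_add shift_op_cscale norm_shift_op by blast

lemma weakly_mixing_m: "weakly_mixing m T"
  unfolding weakly_mixing_def
proof (intro ballI)
  fix A B assume "A \<in> sets m" "B \<in> sets m"
  then obtain A' B' where A: "A' \<in> sets coord_sigma" "A = V \<inter> A'" and B: "B' \<in> sets coord_sigma" "B = V \<inter> B'"
    using sets_m_coord by metis
  have "measure m ((T ^^ n) -` A \<inter> B) = measure mu {x. (T ^^ n) x \<in> A' \<and> x \<in> B'}" for n
  proof -
    have "{x \<in> space coord_sigma. (T ^^ n) x \<in> A' \<and> x \<in> B'} \<in> sets coord_sigma" using A B by measurable
    moreover have "(T ^^ n) -` A \<inter> B = V \<inter> {x. (T ^^ n) x \<in> A' \<and> x \<in> B'}" using T_pow_V by (auto simp: A B)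
    ultimately show ?thesis by (simp add: measure_m)
  qed
  then show "(\<lambda>N. (\<Sum>n<N. \<bar>measure m ((T ^^ n) -` A \<inter> B) - measure m A * measure m B\<bar>) / real N) \<longlonglongrightarrow> 0"
    using mixing_mu[OF A(1) B(1)] by (simp add: A B measure_m)
qed

lemma measure_preserving_m: "measure_preserving_map m T"
  unfolding measure_preserving_map_def
proof
  have pre: "T -` (V \<inter> A') \<inter> V = V \<inter> T -` A'" for A' using T_V by auto
  have TA: "T -` A' \<in> sets coord_sigma" if "A' \<in> sets coord_sigma" for A'
    using measurable_sets[OF measurable_shift_op that] by simp
  show "T \<in> m \<rightarrow>\<^sub>M m"
  proof (rule measurableI)
    show "T x \<in> space m" if "x \<in> space m" for x using that T_V by (simp add: space_m)
    fix A assume "A \<in> sets m"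
    then obtain A' where A: "A' \<in> sets coord_sigma" "A = V \<inter> A'" using sets_m_coord by metis
    show "T -` A \<inter> space m \<in> sets m" unfolding A space_m pre by (intro coord_in_sets_m TA A)
  qed
  show "\<forall>A\<in>sets m. emeasure m (T -` A \<inter> space m) = emeasure m A"
  proof
    fix A assume "A \<in> sets m"
    then obtain A' where A: "A' \<in> sets coord_sigma" "A = V \<inter> A'" using sets_m_coord by metis
    have "emeasure mu (T -` A') = emeasure (distr mu coord_sigma T) A'"
      by (subst emeasure_distr) (use A in auto)
    then show "emeasure m (T -` A \<inter> space m) = emeasure m A"
      unfolding A space_m pre by (simp add: emeasure_m TA A mu_invariant)
  qed
qed

section \<open>Continuous functionals and their Gaussian laws\<close>

lemma cdual_continuous: assumes "cdual V \<phi>" shows "continuous_on V \<phi>"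
proof -
  obtain K where add: "\<And>x y. x \<in> V \<Longrightarrow> y \<in> V \<Longrightarrow> \<phi> (x + y) = \<phi> x + \<phi> y"
    and scale: "\<And>a x. x \<in> V \<Longrightarrow> \<phi> (cscale a x) = a * \<phi> x"
    and K: "\<And>x. x \<in> V \<Longrightarrow> cmod (\<phi> x) \<le> K * norm x"
    using assms unfolding cdual_def by metis
  have neg: "cscale (-1) x = - x" for x by (rule bcontfun_eqI) simp
  have V: "x - y \<in> V" "cscale (-1) y \<in> V" if "x \<in> V" "y \<in> V" for x y
    using complex_subspace_V that neg unfolding complex_subspace_def by (metis uminus_add_conv_diff add.commute)+
  have diff: "\<phi> (x - y) = \<phi> x - \<phi> y" if "x \<in> V" "y \<in> V" for x y
    using add[OF that(1) V(2)[OF that]] scale[OF that(2), of "-1"] by (simp add: neg)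
  have "cmod (\<phi> x - \<phi> y) \<le> \<bar>K\<bar> * norm (x - y)" if "x \<in> V" "y \<in> V" for x y
  proof -
    have "cmod (\<phi> x - \<phi> y) \<le> K * norm (x - y)" using K[OF V(1)[OF that]] diff[OF that] by simp
    also have "\<dots> \<le> \<bar>K\<bar> * norm (x - y)" by (intro mult_right_mono) auto
    finally show ?thesis .
  qed
  then show ?thesis
    by (intro lipschitz_on_continuous_on[of "\<bar>K\<bar>"] lipschitz_onI) (auto simp: dist_norm)
qed

lemma cdual_comb:
  assumes "cdual V \<phi>" shows "\<phi> (comb b K) = (\<Sum>k<K. \<phi> (e k) * b k)"
proof (induction K)
  case 0
  have "cscale 0 0 = (0 :: linf)" "(0 :: linf) \<in> V" using complex_subspace_V by (simp_all add: complex_subspace_def)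
  then have "\<phi> 0 = 0" using assms unfolding cdual_def by (metis mult_zero_left)
  then show ?case by (simp add: comb_def)
next
  case (Suc K)
  have "comb b (Suc K) = comb b K + cscale (b K) (e K)" by (simp add: comb_def)
  moreover have "cscale (b K) (e K) \<in> V" using complex_subspace_V e_in_V by (simp add: complex_subspace_def)
  ultimately have "\<phi> (comb b (Suc K)) = \<phi> (comb b K) + b K * \<phi> (e K)"
    using assms comb_in_V e_in_V unfolding cdual_def by metis
  then show ?case using Suc by simp
qed

text \<open>Almost surely \<open>\<phi> (X \<omega>)\<close> is the limit of the partial sums with
  coefficients \<open>\<phi> (e k)\<close>. Their characteristic functions are explicit and pass to
  the limit; boundedness of \<open>\<phi>\<close> and decay of \<open>norm (e k)\<close> make the
  variances converge.\<close>

lemma cdual_law: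
  assumes \<phi>: "cdual V \<phi>"
  shows "\<phi> \<in> borel_measurable m"
    and "summable (\<lambda>k. (cmod (\<phi> (e k)))\<^sup>2)"
    and "(\<integral>x. cis (Re (w * x)) \<partial>distr m borel \<phi>) = complex_of_real (exp (- (\<Sum>k. (cmod (\<phi> (e k)))\<^sup>2) * (cmod w)\<^sup>2 / 4))"
proof -
  show meas: "\<phi> \<in> borel_measurable m"
    using borel_measurable_continuous_on_restrict[OF cdual_continuous[OF \<phi>]]
    by (simp add: measurable_cong_sets[OF sets_m refl])
  obtain K where K: "\<And>x. x \<in> V \<Longrightarrow> cmod (\<phi> x) \<le> K * norm x"
    using \<phi> unfolding cdual_def by metis
  have le: "(cmod (\<phi> (e k)))\<^sup>2 \<le> K\<^sup>2 * (1/4)^k" for k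
  proof -
    have "cmod (\<phi> (e k)) \<le> \<bar>K\<bar> * (1/2)^k"
    proof -
      have "cmod (\<phi> (e k)) \<le> K * norm (e k)" by (rule K[OF e_in_V])
      also have "\<dots> \<le> \<bar>K\<bar> * norm (e k)" by (intro mult_right_mono) auto
      also have "\<dots> \<le> \<bar>K\<bar> * (1/2)^k" by (intro mult_left_mono norm_e) auto
      finally show ?thesis .
    qed
    from power_mono[OF this, of 2] have "(cmod (\<phi> (e k)))\<^sup>2 \<le> K\<^sup>2 * ((1/2)^k)\<^sup>2" by (simp add: power_mult_distrib)
    also have "((1/2::real)^k)\<^sup>2 = (1/4)^k" by (simp add: power2_eq_square power_mult_distrib[symmetric])
    finally show ?thesis .
  qed
  show sm: "summable (\<lambda>k. (cmod (\<phi> (e k)))\<^sup>2)"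
  proof (rule summable_comparison_test)
    show "\<exists>N. \<forall>n\<ge>N. norm ((cmod (\<phi> (e n)))\<^sup>2) \<le> K\<^sup>2 * (1/4)^n" using le by auto
    show "summable (\<lambda>k. K\<^sup>2 * (1/4::real)^k)" by (intro summable_mult summable_geometric) simp
  qed
  have [measurable]: "(\<lambda>\<omega>. \<phi> (X \<omega>)) \<in> borel_measurable gauss_seq"
  proof -
    have "X \<in> gauss_seq \<rightarrow>\<^sub>M m" using measurable_X_V by (simp add: measurable_cong_sets[OF refl sets_m])
    from measurable_compose[OF this meas] show ?thesis .
  qed
  have "(\<integral>x. cis (Re (w * x)) \<partial>distr m borel \<phi>) = (\<integral>x. cis (Re (w * \<phi> x)) \<partial>m)"
    by (rule integral_distr[OF meas]) measurable
  also have "\<dots> = (\<integral>\<omega>. cis (Re (w * \<phi> (X \<omega>))) \<partial>gauss_seq)"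
    unfolding m_def
  proof (rule integral_distr[OF measurable_X_V])
    have [measurable]: "\<phi> \<in> borel_measurable (restrict_space borel V)"
      using meas by (simp add: measurable_cong_sets[OF sets_m refl])
    show "(\<lambda>x. cis (Re (w * \<phi> x))) \<in> borel_measurable (restrict_space borel V)" by measurable
  qed
  finally have 1: "(\<integral>x. cis (Re (w * x)) \<partial>distr m borel \<phi>) = (\<integral>\<omega>. cis (Re (w * \<phi> (X \<omega>))) \<partial>gauss_seq)" .
  have "(\<lambda>N. \<integral>\<omega>. cis (Re (\<Sum>k<N. (w * \<phi> (e k)) * \<omega> k)) \<partial>gauss_seq) \<longlonglongrightarrow> (\<integral>\<omega>. cis (Re (w * \<phi> (X \<omega>))) \<partial>gauss_seq)"
  proof (rule integral_dominated_convergence[where w = "\<lambda>_. 1"])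
    show "AE \<omega> in gauss_seq. (\<lambda>N. cis (Re (\<Sum>k<N. (w * \<phi> (e k)) * \<omega> k))) \<longlonglongrightarrow> cis (Re (w * \<phi> (X \<omega>)))"
      using AE_good
    proof eventually_elim
      case (elim \<omega>)
      have "(\<lambda>N. \<phi> (comb \<omega> N)) \<longlonglongrightarrow> \<phi> (X \<omega>)"
        by (rule continuous_on_tendsto_compose[OF cdual_continuous[OF \<phi>] X_lim[OF elim] X_in_V])
          (simp add: comb_in_V)
      then have "(\<lambda>N. w * (\<Sum>k<N. \<phi> (e k) * \<omega> k)) \<longlonglongrightarrow> w * \<phi> (X \<omega>)"
        unfolding cdual_comb[OF \<phi>] by (intro tendsto_intros)
      then have "(\<lambda>N. \<Sum>k<N. (w * \<phi> (e k)) * \<omega> k) \<longlonglongrightarrow> w * \<phi> (X \<omega>)"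
        by (simp add: sum_distrib_left mult.assoc)
      then have "(\<lambda>N. Re (\<Sum>k<N. (w * \<phi> (e k)) * \<omega> k)) \<longlonglongrightarrow> Re (w * \<phi> (X \<omega>))" by (rule tendsto_Re)
      moreover have "continuous_on UNIV cis" by (intro continuous_intros)
      ultimately show ?case using continuous_on_tendsto_compose[of UNIV cis] by auto
    qed
    show "(\<lambda>\<omega>. cis (Re (w * \<phi> (X \<omega>)))) \<in> borel_measurable gauss_seq" by measurable
    show "(\<lambda>\<omega>. cis (Re (\<Sum>k<N. (w * \<phi> (e k)) * \<omega> k))) \<in> borel_measurable gauss_seq" for N by measurable
  qed simp_all
  moreover have "(\<integral>\<omega>. cis (Re (\<Sum>k<N. (w * \<phi> (e k)) * \<omega> k)) \<partial>gauss_seq)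
     = complex_of_real (exp (- (\<Sum>k<N. (cmod (\<phi> (e k)))\<^sup>2) * (cmod w)\<^sup>2 / 4))" for N
    unfolding char_gauss_seq norm_mult power_mult_distrib sum_distrib_left[symmetric] by (simp add: mult.commute)
  moreover have "(\<lambda>N. complex_of_real (exp (- (\<Sum>k<N. (cmod (\<phi> (e k)))\<^sup>2) * (cmod w)\<^sup>2 / 4)))
     \<longlonglongrightarrow> complex_of_real (exp (- (\<Sum>k. (cmod (\<phi> (e k)))\<^sup>2) * (cmod w)\<^sup>2 / 4))"
    by (intro tendsto_intros summable_LIMSEQ sm) simp_all
  ultimately show "(\<integral>x. cis (Re (w * x)) \<partial>distr m borel \<phi>) = complex_of_real (exp (- (\<Sum>k. (cmod (\<phi> (e k)))\<^sup>2) * (cmod w)\<^sup>2 / 4))"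
    unfolding 1 using LIMSEQ_unique by simp
qed

lemma cdual_cgauss:
  assumes \<phi>: "cdual V \<phi>" and pos: "(\<Sum>k. (cmod (\<phi> (e k)))\<^sup>2) > 0"
  shows "distr m borel \<phi> = cgauss (\<Sum>k. (cmod (\<phi> (e k)))\<^sup>2)"
proof (rule cgauss_char_unique[OF _ _ pos])
  interpret m: prob_space m by (rule prob_space_m)
  show "prob_space (distr m borel \<phi>)" by (rule m.prob_space_distr[OF cdual_law(1)[OF \<phi>]])
  show "(\<integral>z. cis (Re (w * z)) \<partial>distr m borel \<phi>) = complex_of_real (exp (- (\<Sum>k. (cmod (\<phi> (e k)))\<^sup>2) * (cmod w)\<^sup>2 / 4))" for w
    by (rule cdual_law(3)[OF \<phi>])
qed simp

text \<open>Zero variance makes \<open>\<phi>\<close> vanish on every \<open>e k\<close>, hence on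
  the closure of their span. This is the degenerate case of the Gaussian law.\<close>

lemma cdual_eq_zero:
  assumes \<phi>: "cdual V \<phi>" and zero: "(\<Sum>k. (cmod (\<phi> (e k)))\<^sup>2) = 0" and x: "x \<in> V"
  shows "\<phi> x = 0"
proof -
  have "\<phi> (e k) = 0" for k using suminf_eq_zero_iff[OF cdual_law(2)[OF \<phi>]] zero by simp
  then have comb0: "\<phi> x = 0" if "x \<in> combs" for x using that by (auto simp: combs_def cdual_comb[OF \<phi>])
  obtain f where f: "\<And>n. f n \<in> combs" "f \<longlonglongrightarrow> x" using x unfolding V_def closure_sequential by blast
  have "(\<lambda>n. \<phi> (f n)) \<longlonglongrightarrow> \<phi> x"
    by (rule continuous_on_tendsto_compose[OF cdual_continuous[OF \<phi>] f(2) x])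
      (use f(1) combs_subset_V in \<open>intro always_eventually, blast\<close>)
  then show ?thesis using comb0 f(1) by (simp add: LIMSEQ_const_iff)
qed

lemma gaussian_measure_m: "gaussian_measure V m"
  unfolding gaussian_measure_def borel_prob_on_def
proof (intro conjI prob_space_m space_m sets_m allI impI)
  fix \<phi> assume \<phi>: "cdual V \<phi>"
  let ?s = "\<Sum>k. (cmod (\<phi> (e k)))\<^sup>2"
  have sm: "summable (\<lambda>k. (cmod (\<phi> (e k)))\<^sup>2)" by (rule cdual_law(2)[OF \<phi>])
  show "complex_gaussian_law (distr m borel \<phi>)"
  proof (cases "?s > 0")
    case True
    then show ?thesis using cdual_cgauss[OF \<phi> True] unfolding complex_gaussian_law_def cgauss_def by blast
  next
    case False
    then have "?s = 0" using suminf_nonneg[OF sm] by simp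
    then have "\<phi> x = 0" if "x \<in> V" for x using cdual_eq_zero[OF \<phi> _ that] by blast
    then have "distr m borel \<phi> = distr m borel (\<lambda>_. 0)" by (intro distr_cong) (auto simp: space_m)
    also have "\<dots> = return borel 0"
    proof (rule measure_eqI)
      interpret m: prob_space m by (rule prob_space_m)
      fix A assume "A \<in> sets (distr m borel (\<lambda>_. 0 :: complex))"
      then show "emeasure (distr m borel (\<lambda>_. 0)) A = emeasure (return borel 0) A"
        using m.emeasure_space_1 by (subst emeasure_distr) (auto simp: indicator_def vimage_def)
    qed simp
    finally show ?thesis by (simp add: complex_gaussian_law_def)
  qed
qed

lemma cdual_tail:
  assumes \<phi>: "cdual V \<phi>"
  shows "measure m {x \<in> V. 1 \<le> cmod (\<phi> x)} \<le> (\<Sum>k. (cmod (\<phi> (e k)))\<^sup>2)"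
proof (cases "(\<Sum>k. (cmod (\<phi> (e k)))\<^sup>2) > 0")
  case True
  have "measure m {x \<in> V. 1 \<le> cmod (\<phi> x)} = measure (distr m borel \<phi>) {z. 1 \<le> cmod z}"
    by (subst measure_distr[OF cdual_law(1)[OF \<phi>]]) (auto simp: space_m intro!: arg_cong[where f = "measure m"])
  then show ?thesis using cgauss_tail[OF True, of 1] by (simp add: cdual_cgauss[OF \<phi> True])
next
  case False
  then have "(\<Sum>k. (cmod (\<phi> (e k)))\<^sup>2) = 0" using suminf_nonneg[OF cdual_law(2)[OF \<phi>]] by simp
  moreover from cdual_eq_zero[OF \<phi> this] have "{x \<in> V. 1 \<le> cmod (\<phi> x)} = {}" by auto
  ultimately show ?thesis by (simp only: measure_empty order_refl)
qed

text \<open>Undoes the weight \<open>2 ^ - i\<close> and recovers the value with index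
  \<open>i\<close> of the stationary sequence.\<close>

definition gcoord :: "nat \<Rightarrow> linf \<Rightarrow> complex" where
  "gcoord i x = 2 ^ i * apply_bcontfun x i"

lemma cdual_gcoord_add: "cdual V (\<lambda>x. gcoord i x + gcoord j x)"
  unfolding cdual_def
proof (intro conjI exI[of _ "2 ^ i + 2 ^ j"] ballI)
  fix x
  have "cmod (gcoord i x + gcoord j x) \<le> cmod (gcoord i x) + cmod (gcoord j x)" by (rule norm_triangle_ineq)
  also have "\<dots> \<le> 2 ^ i * norm x + 2 ^ j * norm x"
    unfolding gcoord_def norm_mult norm_power by (intro add_mono mult_mono norm_bounded) auto
  finally show "cmod (gcoord i x + gcoord j x) \<le> (2 ^ i + 2 ^ j) * norm x" by (simp add: distrib_right)
qed (simp_all add: gcoord_def algebra_simps)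

text \<open>The sum of two unit variables with covariance \<open>R i j\<close> has variance
  \<open>2 + 2 * Re (R i j)\<close>, which is small when the covariance is near -1.\<close>

lemma gcoord_add_tail:
  "measure m {x \<in> V. 1 \<le> cmod (gcoord i x + gcoord j x)} \<le> 2 * Re (1 + R i j)"
proof -
  define K where "K = Suc (max i j)"
  have K: "i < K" "j < K" by (auto simp: K_def)
  have "(\<lambda>k. (cmod (gcoord i (e k) + gcoord j (e k)))\<^sup>2) sums
      (\<Sum>k<K. (cmod (gcoord i (e k) + gcoord j (e k)))\<^sup>2)"
    by (rule sums_finite) (auto simp: gcoord_def apply_e c_lower K_def)
  moreover have "(\<Sum>k<K. (cmod (gcoord i (e k) + gcoord j (e k)))\<^sup>2) = 2 * Re (1 + R i j)"
  proof -
    have sq: "(cmod (x + y))\<^sup>2 = Re (x * cnj x) + Re (y * cnj y) + 2 * Re (x * cnj y)" for x y :: complex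
      unfolding cmod_power2 by (simp add: power2_eq_square algebra_simps)
    have "(\<Sum>k<K. (cmod (gcoord i (e k) + gcoord j (e k)))\<^sup>2) =
      Re (\<Sum>k<K. c i k * cnj (c i k)) + Re (\<Sum>k<K. c j k * cnj (c j k)) + 2 * Re (\<Sum>k<K. c i k * cnj (c j k))"
      unfolding sq by (simp add: gcoord_def apply_e sum.distrib sum_distrib_left)
    then show ?thesis unfolding R_eq_lessThan[OF K(1)] R_eq_lessThan[OF K(2)] R_diag by simp
  qed
  ultimately show ?thesis using cdual_tail[OF cdual_gcoord_add[of i j]] by (simp add: sums_iff)
qed

theorem weakly_mixing_lds_m: "weakly_mixing_lds V T m"
  unfolding weakly_mixing_lds_def
  using sep_inf_banach_V bounded_op_T gaussian_measure_m non_degenerate_m measure_preserving_m weakly_mixing_m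
  by blast

end

section \<open>Non-recurrence\<close>

theorem theorem3:
  fixes r :: nat
  assumes "r \<ge> 1"
  shows "\<exists>N :: nat set. (\<forall>n\<in>N. n > 0) \<and> r_Bohr r N \<and>
           (\<exists>V T m. weakly_mixing_lds V T m \<and> non_recurrence_set m T N)"
proof -
  obtain c where c: "\<And>n k. n < k \<Longrightarrow> c n k = 0" "\<And>n m. kernel r n m = (\<Sum>k\<le>n. c n k * cnj (c m k))"
    using cholesky[OF psd_kernel[of r]] by blast
  \<comment> \<open>The process with residue \<open>0\<close> alone supplies the orthonormal
    indices; the summand \<open>0\<close> keeps the shape of
    \<open>kernel_orthonormal\<close>.\<close>
  interpret gauss_shift c "r + 1" "kernel r" "\<lambda>l. (r + 1) * 2 ^ (wt r l - 1) + 0"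
  proof
    show "kernel r ((r + 1) * 2 ^ (wt r l - 1) + 0) ((r + 1) * 2 ^ (wt r l' - 1) + 0) = of_bool (l = l')" for l l'
      by (rule kernel_orthonormal) simp
  qed (fact c kernel_diag kernel_shift kernel_cesaro)+
  interpret m: prob_space m by (rule prob_space_m)
  let ?q = "r + 1"
  \<comment> \<open>The bound 1/2 is half the threshold 1 in \<open>B\<close>: two values with real
    part above 1/2 have a sum of modulus above 1.\<close>
  define A0 where "A0 = {x. \<forall>j\<in>{..r}. 1/2 < Re (gcoord j x)}"
  define B where "B k = (\<Union>j\<in>{..r}. \<Union>n\<in>times_set r k j.
    {x \<in> V. 1 \<le> cmod (gcoord (j + ?q * n) x + gcoord j x)})" for k
  have open_A0: "open A0"
  proof -
    have "A0 = (\<Inter>j\<in>{..r}. {x. 1/2 < Re (gcoord j x)})" by (auto simp: A0_def)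
    also have "open \<dots>"
      unfolding gcoord_def
      by (intro open_INT finite_atMost ballI open_Collect_less continuous_intros continuous_on_coord)
    finally show ?thesis .
  qed
  have [measurable]: "gcoord i \<in> borel_measurable coord_sigma" for i
    unfolding gcoord_def[abs_def] by measurable
  have A0_sets: "V \<inter> A0 \<in> sets m"
    unfolding sets_m sets_restrict_space using open_A0 by (intro imageI) simp
  have bad_sets: "{x \<in> V. 1 \<le> cmod (gcoord i x + gcoord j x)} \<in> sets m" for i j
  proof -
    have "{x \<in> space coord_sigma. 1 \<le> cmod (gcoord i x + gcoord j x)} \<in> sets coord_sigma" by measurable
    from coord_in_sets_m[OF this] show ?thesis by (simp add: Int_def)
  qed
  have B_sets: "B k \<in> sets m" for k
    unfolding B_def by (intro sets.finite_UN finite_atMost finite_times_set bad_sets)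
  \<comment> \<open>A point of \<open>A0\<close> in \<open>V\<close>: distinct processes are
    uncorrelated at time \<open>0\<close>, so the sum of their covariance vectors has all initial
    values equal to 1. Non-degeneracy then gives \<open>A0\<close> positive measure.\<close>
  have "(\<Sum>l\<le>r. y l) \<in> V"
  proof -
    have "(\<Sum>l\<in>L. y l) \<in> V" if "finite L" for L
      using that complex_subspace_V comb_in_V
      by (induction L) (auto simp: complex_subspace_def y_def)
    then show ?thesis by simp
  qed
  moreover have "(\<Sum>l\<le>r. y l) \<in> A0"
    unfolding A0_def
  proof (intro CollectI ballI)
    fix j assume j: "j \<in> {..r}"
    have ker: "kernel r l j = of_bool (l = j)" if "l \<le> r" for l
      using j that by (simp add: kernel_def rho_zero)
    have "gcoord j (\<Sum>l\<le>r. y l) = (\<Sum>l\<le>r. cnj (kernel r l j))"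
      by (simp add: gcoord_def apply_sum apply_y sum_distrib_left)
    also have "\<dots> = (\<Sum>l\<le>r. if l = j then 1 else 0)" by (intro sum.cong) (auto simp: ker)
    also have "\<dots> = 1" using j by simp
    finally show "1/2 < Re (gcoord j (\<Sum>l\<le>r. y l))" by simp
  qed
  ultimately have "A0 \<inter> V \<noteq> {}" by blast
  then have "0 < emeasure m (V \<inter> A0)"
    using non_degenerate_m open_A0 unfolding non_degenerate_def by (metis Int_commute)
  then have A0_pos: "0 < measure m (V \<inter> A0)" by (simp add: m.emeasure_eq_measure)
  have B_le: "measure m (B k) \<le> 20 * (r + 1) * (1/2)^k" for k
  proof -
    have "measure m (B k) \<le> (\<Sum>j\<le>r. measure m (\<Union>n\<in>times_set r k j.
        {x \<in> V. 1 \<le> cmod (gcoord (j + ?q * n) x + gcoord j x)}))"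
      unfolding B_def by (intro measure_UNION_le sets.finite_UN finite_atMost finite_times_set bad_sets)
    also have "\<dots> \<le> (\<Sum>j\<le>r. \<Sum>n\<in>times_set r k j. measure m
        {x \<in> V. 1 \<le> cmod (gcoord (j + ?q * n) x + gcoord j x)})"
      by (intro sum_mono measure_UNION_le finite_times_set bad_sets)
    also have "\<dots> \<le> (\<Sum>j\<le>r. \<Sum>n\<in>times_set r k j. 20 * (1/2)^k / 2 ^ horizon r k)"
    proof (intro sum_mono)
      fix j n assume j: "j \<in> {..r}" and n: "n \<in> times_set r k j"
      have "kernel r (j + ?q * n) j = rho r j (real n)"
        using j by (simp add: kernel_def del: One_nat_def)
      then have "measure m {x \<in> V. 1 \<le> cmod (gcoord (j + ?q * n) x + gcoord j x)} \<le> 2 * Re (1 + rho r j (real n))"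
        using gcoord_add_tail[of "j + ?q * n" j] by simp
      also have "\<dots> \<le> 2 * cmod (rho r j (real n) + 1)"
        using complex_Re_le_cmod[of "1 + rho r j (real n)"] by (simp add: add.commute)
      also have "\<dots> \<le> 2 * (10 * (1/2)^k / 2 ^ horizon r k)"
        using rho_times_set[OF n] j by (intro mult_left_mono) auto
      finally show "measure m {x \<in> V. 1 \<le> cmod (gcoord (j + ?q * n) x + gcoord j x)} \<le> 20 * (1/2)^k / 2 ^ horizon r k"
        by simp
    qed
    also have "\<dots> = (\<Sum>j\<le>r. real (card (times_set r k j)) * (20 * (1/2)^k / 2 ^ horizon r k))" by simp
    \<comment> \<open>The number of times cancels the factor \<open>2 ^ horizon r k\<close> that the
      growth of \<open>wt\<close> put into the denominator.\<close>
    also have "\<dots> \<le> (\<Sum>j\<le>r. 2 ^ horizon r k * (20 * (1/2)^k / 2 ^ horizon r k))"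
    proof (intro sum_mono mult_right_mono)
      show "real (card (times_set r k j)) \<le> 2 ^ horizon r k" for j
        using of_nat_mono[OF finite_times_set(2)[of r k j], where 'a = real] by simp
    qed simp
    also have "\<dots> = 20 * (r + 1) * (1/2)^k" by simp
    finally show ?thesis .
  qed
  \<comment> \<open>\<open>40\<close> is \<open>20\<close> times the sum of the geometric series.
    The measure does not depend on \<open>k0\<close>, so the initial scales can be discarded after
    it is fixed.\<close>
  obtain k0 where k0: "(1/2)^k0 < measure m (V \<inter> A0) / (40 * real (r + 1))"
    using real_arch_pow_inv[of "measure m (V \<inter> A0) / (40 * real (r + 1))" "1/2"] A0_pos by auto
  have geo: "(\<lambda>i. 20 * real (r + 1) * (1/2)^(i + k0)) sums (40 * real (r + 1) * (1/2)^k0)"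
  proof -
    have "(\<lambda>i. (20 * real (r + 1) * (1/2)^k0) * (1/2)^i) sums ((20 * real (r + 1) * (1/2)^k0) * 2)"
      using sums_mult[OF geometric_sums[of "1/2::real"]] by simp
    moreover have "20 * real (r + 1) * (1/2)^k0 * 2 = 40 * real (r + 1) * (1/2)^k0" by linarith
    ultimately show ?thesis by (simp only: power_add mult_ac)
  qed
  have sm: "summable (\<lambda>i. measure m (B (i + k0)))"
    by (rule summable_comparison_test[OF _ sums_summable[OF geo]]) (use B_le in \<open>auto intro!: exI[of _ 0]\<close>)
  have "measure m (\<Union>i. B (i + k0)) \<le> (\<Sum>i. measure m (B (i + k0)))"
    by (rule m.finite_measure_subadditive_countably) (use B_sets sm in auto)
  also have "\<dots> \<le> 40 * real (r + 1) * (1/2)^k0"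
    unfolding sums_unique[OF geo] by (intro suminf_le sm sums_summable[OF geo]) (use B_le in auto)
  also have "\<dots> < measure m (V \<inter> A0)" using k0 by (simp add: field_simps)
  finally have less: "measure m (\<Union>i. B (i + k0)) < measure m (V \<inter> A0)" .
  define A where "A = V \<inter> A0 - (\<Union>i. B (i + k0))"
  have UB: "(\<Union>i. B (i + k0)) \<in> sets m" by (intro sets.countable_UN) (use B_sets in auto)
  have A_sets: "A \<in> sets m" unfolding A_def by (intro sets.Diff A0_sets UB)
  have "V \<inter> A0 \<subseteq> A \<union> (\<Union>i. B (i + k0))" by (auto simp: A_def)
  then have "measure m (V \<inter> A0) \<le> measure m (A \<union> (\<Union>i. B (i + k0)))"
    using A_sets UB by (intro m.finite_measure_mono) auto
  also have "\<dots> \<le> measure m A + measure m (\<Union>i. B (i + k0))"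
    by (rule measure_Un_le[OF A_sets UB])
  finally have A_pos: "measure m A > 0" using less by linarith
  define N where "N = (\<Union>k\<in>{k0..}. \<Union>j\<le>r. times_set r k j)"
  \<comment> \<open>The intersection is truly empty: a return at time \<open>n\<close> would put
    \<open>gcoord j x\<close> and \<open>gcoord (j + ?q * n) x\<close> both in the half plane,
    although outside \<open>B k\<close> their sum has modulus below 1.\<close>
  have "(T ^^ n) -` A \<inter> A = {}" if n: "n \<in> N" for n
  proof (rule ccontr)
    assume "(T ^^ n) -` A \<inter> A \<noteq> {}"
    then obtain x where x: "x \<in> A" "(T ^^ n) x \<in> A" by blast
    obtain k j where kj: "k \<ge> k0" "j \<le> r" "n \<in> times_set r k j" using n by (auto simp: N_def)
    have shift: "gcoord j ((T ^^ n) x) = gcoord (j + ?q * n) x"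
      by (simp add: gcoord_def apply_shift_op_pow power_add del: One_nat_def)
    have "x \<notin> B ((k - k0) + k0)" using x(1) by (auto simp: A_def)
    then have "x \<notin> B k" using kj(1) by simp
    then have "cmod (gcoord (j + ?q * n) x + gcoord j x) < 1"
      using kj x(1) by (force simp: B_def A_def not_le)
    moreover have "1/2 < Re (gcoord j x)" "1/2 < Re (gcoord (j + ?q * n) x)"
      using x kj(2) unfolding shift[symmetric] by (auto simp: A_def A0_def)
    ultimately show False using complex_Re_le_cmod[of "gcoord (j + ?q * n) x + gcoord j x"] by simp
  qed
  then have "non_recurrence_set m T N"
    unfolding non_recurrence_set_def using A_sets A_pos by (intro bexI[of _ A]) auto
  moreover have "r_Bohr r N" unfolding N_def by (rule r_Bohr_times_set)
  moreover have "\<forall>n\<in>N. n > 0" using times_set_pos by (auto simp: N_def)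
  ultimately show ?thesis using weakly_mixing_lds_m by blast
qed

end
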